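(* Let $\Theta$ be an oriented connected graph, all of whose vertices have odd valence, which is non-zero as an element of $c\mathcal G'$. Let $\mu_\Theta\colon f\mathcal G'\to\mathbb Q$ be the composition of the graphical trace $\operatorname{Tr}^{\mathcal G}\colon f\mathcal G'\to c\mathcal G'$ with the projection of $c\mathcal G'$ onto the span of $\Theta$. Then $\mu_\Theta$ is non-trivial as a cocycle (i.e. the cocycle $\mu_\Theta$ is not the zero map).
   Context: All vector spaces are over $\mathbb Q$; graphs are finite, with loops and multiple edges allowed. **The complex $f\mathcal G'$.** A (trivalent) forested graph is a pair $(G,F)$ with $G$ a finite graph all of whose vertices are trivalent and $F\subset G$ an acyclic subgraph containing all vertices of $G$ (components of $F$ may be single vertices). An orientation is an ordering of the edges of $F$ up to even permutation. $f\mathcal G'$ is the $\mathbb Q$-vector space spanned by isomorphism classes of oriented connected trivalent forested graphs, modulo: (i) $(G,F,-or)=-(G,F,or)$; (ii) $(G,F)=0$ if $G$ has a separating edge (an edge whose removal disconnects $G$); (iii) IHX: for an edge $e\in F$, contract $e$ to get a $4$-valent vertex; the three ways of splitting the four half-edges at this vertex into two pairs give three re-expansions into trivalent graphs with a new edge inserted; the new edge takes the place of $e$ in the forest and in the ordering. The sum of the three resulting oriented forested graphs (one of which is $(G,F)$) is $0$. It is graded by the number of components of $F$. The boundary is $\partial(G,F)=\sum_e (G,F\cup e)$, over all edges $e$ of $G-F$ with $F\cup e$ still a forest, with $e$ placed first in the ordering. **The space $c\mathcal G'$.** It is spanned by isomorphism classes of oriented connected graphs all of whose vertices have odd valence, modulo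 $(\Gamma,-or)=-(\Gamma,or)$ and modulo graphs with a separating edge. An orientation is an ordering of the half-edges at each vertex; a reordering multiplies by the product of the signs of the permutations. (A graph with a loop is $0$.) The projection onto the span of $\Theta$ is along the span of all graphs not isomorphic to $\Theta$. **The graphical trace.** $\operatorname{Tr}^{\mathcal G}(G,F)=0$ unless $F$ is a disjoint union of linear trees (paths) $T_1,\dots,T_m$, each with an even number of edges, and for each $i$ there is an edge $e_i$ of $G-F$ joining the two ends of $T_i$. In that case $\operatorname{Tr}^{\mathcal G}(G,F)$ is $(-2)^m$ times the graph obtained by collapsing each cycle $T_i\cup e_i$ to a point, oriented as follows: choose a direction along each $T_i$; if the edges of $F$ are ordered by listing the edges of $T_1$ in order along $T_1$, then those of $T_2$ in order along $T_2$, etc., then the half-edges at the vertex coming from $T_i$ are ordered as they occur along $T_i$. (If several choices of $e_i$ exist, the result contains a loop, hence is $0$.) This is well defined and $\operatorname{Tr}^{\mathcal G}\circ\partial=0$. *)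

theory Defs
  imports "HOL-Library.Poly_Mapping" "HOL-Combinatorics.Permutations" Complex_Main
begin

section \<open>Finite graphs with loops and multiple edges\<close>

text \<open>
  A graph is given by its half-edges (named by natural numbers), the involution exchanging the two
  halves of every edge, and the map sending a half-edge to the vertex at which it sits. The vertices
  are the values of that map, so that no vertex is isolated; the graphs below only have
  vertices of odd valence. The values of the two functions outside the half-edges are irrelevant.
\<close>

record graph =
  halves :: "nat set"
  opp :: "nat \<Rightarrow> nat"
  vert :: "nat \<Rightarrow> nat"

definition is_graph :: "graph \<Rightarrow> bool" where
  "is_graph G \<longleftrightarrow> finite (halves G) \<and>
     (\<forall>h\<in>halves G. opp G h \<in> halves G \<and> opp G h \<noteq> h \<and> opp G (opp G h) = h)"

definition verts :: "graph \<Rightarrow> nat set" where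
  "verts G = vert G ` halves G"

definition star :: "graph \<Rightarrow> nat \<Rightarrow> nat set" where
  "star G v = {h \<in> halves G. vert G h = v}"

definition valence :: "graph \<Rightarrow> nat \<Rightarrow> nat" where
  "valence G v = card (star G v)"

definition edge :: "graph \<Rightarrow> nat \<Rightarrow> nat set" where
  "edge G h = {h, opp G h}"

definition edges :: "graph \<Rightarrow> nat set set" where
  "edges G = edge G ` halves G"

definition adjacent :: "graph \<Rightarrow> nat set set \<Rightarrow> nat \<Rightarrow> nat \<Rightarrow> bool" where
  "adjacent G E u v \<longleftrightarrow> (\<exists>h\<in>halves G. edge G h \<in> E \<and> vert G h = u \<and> vert G (opp G h) = v)"

text \<open>Connectedness of the subgraph formed by all vertices of \<open>G\<close> and the edges in \<open>E\<close>.\<close>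

definition connected_by :: "graph \<Rightarrow> nat set set \<Rightarrow> bool" where
  "connected_by G E \<longleftrightarrow> (\<forall>u\<in>verts G. \<forall>v\<in>verts G. (adjacent G E)\<^sup>*\<^sup>* u v)"

definition connected_graph :: "graph \<Rightarrow> bool" where
  "connected_graph G \<longleftrightarrow> halves G \<noteq> {} \<and> connected_by G (edges G)"

definition has_separating_edge :: "graph \<Rightarrow> bool" where
  "has_separating_edge G \<longleftrightarrow> (\<exists>e\<in>edges G. \<not> connected_by G (edges G - {e}))"

text \<open>No closed walk (of positive length) traverses pairwise distinct edges of \<open>F\<close>.\<close>

definition acyclic_edges :: "graph \<Rightarrow> nat set set \<Rightarrow> bool" where
  "acyclic_edges G F \<longleftrightarrow>
     \<not> (\<exists>hs. hs \<noteq> [] \<and> set hs \<subseteq> halves G \<and> distinct (map (edge G) hs) \<and> edge G ` set hs \<subseteq> F \<and>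
          (\<forall>i<length hs. vert G (opp G (hs ! i)) = vert G (hs ! (Suc i mod length hs))))"

definition graph_iso :: "(nat \<Rightarrow> nat) \<Rightarrow> graph \<Rightarrow> graph \<Rightarrow> bool" where
  "graph_iso \<phi> G H \<longleftrightarrow> bij_betw \<phi> (halves G) (halves H) \<and>
     (\<forall>h\<in>halves G. \<phi> (opp G h) = opp H (\<phi> h)) \<and>
     (\<forall>h\<in>halves G. \<forall>k\<in>halves G. vert G h = vert G k \<longleftrightarrow> vert H (\<phi> h) = vert H (\<phi> k))"

section \<open>Oriented forested graphs and oriented odd graphs\<close>

text \<open>
  A forest contains all vertices of the graph, so it is given by its edges. An oriented
  forested graph is a graph with a list enumerating the edges of the forest without repetition.
  That orderings differing by a permutation are identified up to its sign is imposed in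
  the relations, also for forests with at most one edge, whose ordering is unique.
\<close>

definition is_forested_graph :: "graph \<times> nat set list \<Rightarrow> bool" where
  "is_forested_graph = (\<lambda>(G, es). is_graph G \<and> connected_graph G \<and>
     (\<forall>v\<in>verts G. valence G v = 3) \<and>
     distinct es \<and> set es \<subseteq> edges G \<and> acyclic_edges G (set es))"

text \<open>An oriented odd graph carries an enumeration of the half-edges at each of its vertices.\<close>

definition is_odd_graph :: "graph \<times> (nat \<Rightarrow> nat list) \<Rightarrow> bool" where
  "is_odd_graph = (\<lambda>(G, ord). is_graph G \<and> connected_graph G \<and>
     (\<forall>v\<in>verts G. odd (valence G v) \<and> distinct (ord v) \<and> set (ord v) = star G v))"

definition theta_graph :: graph where
  "theta_graph = \<lparr>halves = {0..<6}, opp = (\<lambda>h. if even h then h + 1 else h - 1),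
                  vert = (\<lambda>h. h mod 2)\<rparr>"

lemma theta_halves: "halves theta_graph = {0,1,2,3,4,5}"
  by (auto simp: theta_graph_def)

lemma theta_is_graph: "is_graph theta_graph"
  by (auto simp: is_graph_def theta_halves) (auto simp: theta_graph_def)

lemma theta_verts: "verts theta_graph = {0, 1}"
  unfolding verts_def theta_halves by (auto simp: theta_graph_def)

lemma theta_star: "star theta_graph 0 = {0,2,4}" "star theta_graph 1 = {1,3,5}"
  unfolding star_def theta_halves by (auto simp: theta_graph_def)

lemma theta_connected: "connected_graph theta_graph"
proof -
  have *: "adjacent theta_graph (edges theta_graph) (vert theta_graph h) (vert theta_graph (opp theta_graph h))"
    if "h \<in> halves theta_graph" for h
    using that by (auto simp: adjacent_def edges_def)
  have "adjacent theta_graph (edges theta_graph) 0 1" "adjacent theta_graph (edges theta_graph) 1 0"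
    using *[of 0] *[of 1] by (auto simp: theta_graph_def)
  then show ?thesis
    by (auto simp: connected_graph_def connected_by_def theta_verts theta_halves)
qed

typedef forested_graph = "{X. is_forested_graph X}"
proof
  show "(theta_graph, []) \<in> {X. is_forested_graph X}"
    using theta_is_graph theta_connected
    by (auto simp: is_forested_graph_def theta_verts valence_def theta_star[simplified]
        acyclic_edges_def)
qed

typedef odd_graph = "{X. is_odd_graph X}"
proof
  show "(theta_graph, \<lambda>v. if v = 0 then [0,2,4] else [1,3,5]) \<in> {X. is_odd_graph X}"
    using theta_is_graph theta_connected
    by (auto simp: is_odd_graph_def theta_verts valence_def theta_star[simplified])
qed

abbreviation fgraph :: "forested_graph \<Rightarrow> graph" where
  "fgraph x \<equiv> fst (Rep_forested_graph x)"

abbreviation forest :: "forested_graph \<Rightarrow> nat set list" where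
  "forest x \<equiv> snd (Rep_forested_graph x)"

abbreviation ograph :: "odd_graph \<Rightarrow> graph" where
  "ograph x \<equiv> fst (Rep_odd_graph x)"

abbreviation ordering :: "odd_graph \<Rightarrow> nat \<Rightarrow> nat list" where
  "ordering x \<equiv> snd (Rep_odd_graph x)"

section \<open>Free rational vector spaces\<close>

definition free_scale :: "rat \<Rightarrow> ('a \<Rightarrow>\<^sub>0 rat) \<Rightarrow> ('a \<Rightarrow>\<^sub>0 rat)" where
  "free_scale c = Poly_Mapping.map ((*) c)"

lemma lookup_free_scale: "Poly_Mapping.lookup (free_scale c x) k = c * Poly_Mapping.lookup x k"
  by (simp add: free_scale_def Poly_Mapping.map.rep_eq when_def)

interpretation free: vector_space free_scale
  by unfold_locales
    (auto intro!: poly_mapping_eqI simp: lookup_free_scale lookup_add algebra_simps)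

abbreviation gen :: "'a \<Rightarrow> ('a \<Rightarrow>\<^sub>0 rat)" where
  "gen x \<equiv> Poly_Mapping.single x 1"

lemma free_diff_add:
  assumes "x - x' \<in> free.span R" "y - y' \<in> free.span R"
  shows "(x + y) - (x' + y') \<in> free.span R"
proof -
  have "(x + y) - (x' + y') = (x - x') + (y - y')" by simp
  then show ?thesis using free.span_add[OF assms] by (simp only:)
qed

lemma free_diff_minus:
  assumes "x - x' \<in> free.span R"
  shows "(- x) - (- x') \<in> free.span R"
proof -
  have "(- x) - (- x') = - (x - x')" by simp
  then show ?thesis using free.span_neg[OF assms] by (simp only:)
qed

lemma free_diff_diff:
  assumes "x - x' \<in> free.span R" "y - y' \<in> free.span R"
  shows "(x - y) - (x' - y') \<in> free.span R"
  using free_diff_add[OF assms(1) free_diff_minus[OF assms(2)]] by simp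

lemma free_diff_scale:
  assumes "x - x' \<in> free.span R"
  shows "free_scale c x - free_scale c x' \<in> free.span R"
  using free.span_scale[OF assms] by (simp add: free.scale_right_diff_distrib)

lemma free_diff_eq: "x = y \<Longrightarrow> x - y \<in> free.span R"
  by (simp add: free.span_zero)

lemma equivp_span: "equivp (\<lambda>x y. x - y \<in> free.span R)"
proof (rule equivpI)
  show "reflp (\<lambda>x y. x - y \<in> free.span R)"
    by (rule reflpI) (rule free_diff_eq, rule refl)
  show "symp (\<lambda>x y. x - y \<in> free.span R)"
  proof (rule sympI)
    fix x y :: "'a \<Rightarrow>\<^sub>0 rat"
    assume "x - y \<in> free.span R"
    from free.span_neg[OF this] show "y - x \<in> free.span R" by simp
  qed
  show "transp (\<lambda>x y. x - y \<in> free.span R)"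
  proof (rule transpI)
    fix x y z :: "'a \<Rightarrow>\<^sub>0 rat"
    assume "x - y \<in> free.span R" "y - z \<in> free.span R"
    from free.span_add[OF this] show "x - z \<in> free.span R" by simp
  qed
qed

section \<open>The space of forested graphs\<close>

definition forested_iso :: "forested_graph \<Rightarrow> forested_graph \<Rightarrow> bool" where
  "forested_iso x y \<longleftrightarrow>
     (\<exists>\<phi>. graph_iso \<phi> (fgraph x) (fgraph y) \<and> forest y = map ((`) \<phi>) (forest x))"

text \<open>The half-edges \<open>h\<close> and \<open>k\<close> exchange the vertices at which they sit.\<close>

definition exchange :: "nat \<Rightarrow> nat \<Rightarrow> graph \<Rightarrow> graph" where
  "exchange h k G = G\<lparr>vert := (vert G)(h := vert G k, k := vert G h)\<rparr>"

text \<open>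
  Let the forest edge \<open>{h, opp h}\<close> separate the half-edges \<open>{a, b}\<close> from \<open>{c, d}\<close>. The other two
  expansions of the \<open>4\<close>-valent vertex obtained by contracting it arise by
  exchanging \<open>b\<close> with \<open>c\<close>, respectively with \<open>d\<close>. The new edges consist of the half-edges
  of the old one, so the list of forest edges is literally the same.
\<close>

definition ihx_triple :: "forested_graph \<Rightarrow> forested_graph \<Rightarrow> forested_graph \<Rightarrow> bool" where
  "ihx_triple x y z \<longleftrightarrow>
     (\<exists>h\<in>halves (fgraph x). \<exists>a b c d. edge (fgraph x) h \<in> set (forest x) \<and>
        star (fgraph x) (vert (fgraph x) h) = {h, a, b} \<and>
        star (fgraph x) (vert (fgraph x) (opp (fgraph x) h)) = {opp (fgraph x) h, c, d} \<and>
        Rep_forested_graph y = (exchange b c (fgraph x), forest x) \<and>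
        Rep_forested_graph z = (exchange b d (fgraph x), forest x))"

definition forested_relations :: "(forested_graph \<Rightarrow>\<^sub>0 rat) set" where
  "forested_relations =
     {gen x - gen y | x y. forested_iso x y} \<union>
     {gen y - free_scale (of_int (sign p)) (gen x) | x y p.
        fgraph y = fgraph x \<and> p permutes {..<length (forest x)} \<and>
        forest y = permute_list p (forest x)} \<union>
     {gen x | x. has_separating_edge (fgraph x)} \<union>
     {gen x + gen y + gen z | x y z. ihx_triple x y z}"

quotient_type fG = "forested_graph \<Rightarrow>\<^sub>0 rat" / "\<lambda>x y. x - y \<in> free.span forested_relations"
  by (rule equivp_span)

instantiation fG :: ab_group_add
begin

lift_definition zero_fG :: fG is 0 .

lift_definition plus_fG :: "fG \<Rightarrow> fG \<Rightarrow> fG" is "(+)"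
  by (rule free_diff_add)

lift_definition uminus_fG :: "fG \<Rightarrow> fG" is uminus
  by (rule free_diff_minus)

lift_definition minus_fG :: "fG \<Rightarrow> fG \<Rightarrow> fG" is "(-)"
  by (rule free_diff_diff)

instance
  by standard (transfer, rule free_diff_eq, simp)+

end

lift_definition fscale :: "rat \<Rightarrow> fG \<Rightarrow> fG" is free_scale
  by (rule free_diff_scale)

lift_definition fclass :: "forested_graph \<Rightarrow> fG" is gen .

interpretation fG: vector_space fscale
  by unfold_locales
    (transfer, rule free_diff_eq, simp add: free.scale_right_distrib free.scale_left_distrib)+

text \<open>
  The boundary of a generator. As the classes of the generators span, a linear map out of
  the space of forested graphs is a cocycle iff it vanishes on these boundaries.
\<close>

definition boundary :: "forested_graph \<Rightarrow> fG" where
  "boundary x =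
     (\<Sum>e | e \<in> edges (fgraph x) - set (forest x) \<and>
            acyclic_edges (fgraph x) (insert e (set (forest x))).
        fclass (Abs_forested_graph (fgraph x, e # forest x)))"

definition cocycle :: "(fG \<Rightarrow> rat) \<Rightarrow> bool" where
  "cocycle \<mu> \<longleftrightarrow> Vector_Spaces.linear fscale (*) \<mu> \<and> (\<forall>x. \<mu> (boundary x) = 0)"

section \<open>The space of odd graphs\<close>

definition odd_iso :: "odd_graph \<Rightarrow> odd_graph \<Rightarrow> bool" where
  "odd_iso x y \<longleftrightarrow>
     (\<exists>\<phi>. graph_iso \<phi> (ograph x) (ograph y) \<and>
        (\<forall>h\<in>halves (ograph x).
           ordering y (vert (ograph y) (\<phi> h)) = map \<phi> (ordering x (vert (ograph x) h))))"

definition odd_relations :: "(odd_graph \<Rightarrow>\<^sub>0 rat) set" where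
  "odd_relations =
     {gen x - gen y | x y. odd_iso x y} \<union>
     {gen y - free_scale (of_int (\<Prod>v\<in>verts (ograph x). sign (p v))) (gen x) | x y p.
        ograph y = ograph x \<and>
        (\<forall>v\<in>verts (ograph x). p v permutes {..<length (ordering x v)} \<and>
           ordering y v = permute_list (p v) (ordering x v))} \<union>
     {gen x | x. has_separating_edge (ograph x)}"

quotient_type cG = "odd_graph \<Rightarrow>\<^sub>0 rat" / "\<lambda>x y. x - y \<in> free.span odd_relations"
  by (rule equivp_span)

instantiation cG :: ab_group_add
begin

lift_definition zero_cG :: cG is 0 .

lift_definition plus_cG :: "cG \<Rightarrow> cG \<Rightarrow> cG" is "(+)"
  by (rule free_diff_add)

lift_definition uminus_cG :: "cG \<Rightarrow> cG" is uminus
  by (rule free_diff_minus)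

lift_definition minus_cG :: "cG \<Rightarrow> cG \<Rightarrow> cG" is "(-)"
  by (rule free_diff_diff)

instance
  by standard (transfer, rule free_diff_eq, simp)+

end

lift_definition cscale :: "rat \<Rightarrow> cG \<Rightarrow> cG" is free_scale
  by (rule free_diff_scale)

lift_definition cclass :: "odd_graph \<Rightarrow> cG" is gen .

interpretation cG: vector_space cscale
  by unfold_locales
    (transfer, rule free_diff_eq, simp add: free.scale_right_distrib free.scale_left_distrib)+

text \<open>
  For a graph \<open>\<Theta>\<close> with non-zero class, the projection onto its span along the span of the graphs
  that are not isomorphic to it (orientations disregarded), where the span of \<open>\<Theta>\<close>
  is identified with the rationals by sending \<open>\<Theta>\<close> to \<open>1\<close>.
\<close>

definition projection :: "odd_graph \<Rightarrow> cG \<Rightarrow> rat" where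
  "projection \<Theta> = (THE \<pi>. Vector_Spaces.linear cscale (*) \<pi> \<and> \<pi> (cclass \<Theta>) = 1 \<and>
     (\<forall>\<Gamma>. (\<nexists>\<phi>. graph_iso \<phi> (ograph \<Gamma>) (ograph \<Theta>)) \<longrightarrow> \<pi> (cclass \<Gamma>) = 0))"

section \<open>The graphical trace\<close>

text \<open>
  A choice of directions of the linear trees \<open>T\<^sub>1, \<dots>, T\<^sub>m\<close>, of their order and of the closing edges
  \<open>e\<^sub>i\<close> is encoded by a list of \<open>m\<close> lists of half-edges: if \<open>T\<^sub>i\<close> passes through the vertices
  \<open>v\<^sub>0, \<dots>, v\<^sub>n\<close> (\<open>n\<close> even), then the \<open>i\<close>-th list is \<open>[d\<^sub>0, \<dots>, d\<^sub>n]\<close>, where \<open>d\<^sub>j\<close> for \<open>j < n\<close> is the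
  half at \<open>v\<^sub>j\<close> of the edge from \<open>v\<^sub>j\<close> to \<open>v\<^sub>j\<^sub>+\<^sub>1\<close> of \<open>T\<^sub>i\<close>, and \<open>d\<^sub>n\<close> is the half at \<open>v\<^sub>n\<close> of
  the edge \<open>e\<^sub>i\<close> from \<open>v\<^sub>n\<close> to \<open>v\<^sub>0\<close>. The permutation \<open>p\<close> takes the given ordering of the forest to
  the one along \<open>T\<^sub>1, \<dots>, T\<^sub>m\<close>.
\<close>

definition closed_path :: "graph \<Rightarrow> nat list \<Rightarrow> bool" where
  "closed_path G ds \<longleftrightarrow> ds \<noteq> [] \<and> set ds \<subseteq> halves G \<and>
     (\<forall>j. Suc j < length ds \<longrightarrow> vert G (opp G (ds ! j)) = vert G (ds ! Suc j)) \<and>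
     vert G (opp G (last ds)) = vert G (hd ds)"

definition trace_data :: "forested_graph \<Rightarrow> nat list list \<Rightarrow> (nat \<Rightarrow> nat) \<Rightarrow> bool" where
  "trace_data x dss p \<longleftrightarrow>
     (\<forall>ds\<in>set dss. closed_path (fgraph x) ds \<and> odd (length ds) \<and>
        edge (fgraph x) (last ds) \<notin> set (forest x)) \<and>
     distinct (map (vert (fgraph x)) (concat dss)) \<and>
     vert (fgraph x) ` set (concat dss) = verts (fgraph x) \<and>
     p permutes {..<length (forest x)} \<and>
     permute_list p (forest x) = concat (map (\<lambda>ds. map (edge (fgraph x)) (butlast ds)) dss)"

definition cycle_halves :: "graph \<Rightarrow> nat list list \<Rightarrow> nat set" where
  "cycle_halves G dss = (\<Union>d\<in>set (concat dss). edge G d)"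

text \<open>The half-edge that does not lie on the cycles, at the vertex of the half-edge \<open>d\<close>.\<close>

definition spoke :: "graph \<Rightarrow> nat list list \<Rightarrow> nat \<Rightarrow> nat" where
  "spoke G dss d = (THE h. h \<in> star G (vert G d) - cycle_halves G dss)"

text \<open>The vertex coming from the \<open>i\<close>-th cycle is named \<open>i\<close>.\<close>

definition collapse :: "graph \<Rightarrow> nat list list \<Rightarrow> graph \<times> (nat \<Rightarrow> nat list)" where
  "collapse G dss =
     (\<lparr>halves = halves G - cycle_halves G dss, opp = opp G,
       vert = (\<lambda>h. THE i. i < length dss \<and> vert G h \<in> vert G ` set (dss ! i))\<rparr>,
      \<lambda>i. map (spoke G dss) (dss ! i))"

text \<open>
  The linear map with the prescribed values on generators, for all choices simultaneously. It is
  unique since the classes of the generators span; that it exists says that the trace is well defined.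
\<close>

definition graphical_trace :: "fG \<Rightarrow> cG" where
  "graphical_trace = (THE T. Vector_Spaces.linear fscale cscale T \<and>
     (\<forall>x. (\<forall>dss p. trace_data x dss p \<longrightarrow>
             T (fclass x) = cscale (of_int (sign p) * (- 2) ^ length dss)
                              (cclass (Abs_odd_graph (collapse (fgraph x) dss)))) \<and>
          ((\<nexists>dss p. trace_data x dss p) \<longrightarrow> T (fclass x) = 0)))"

definition \<mu> :: "odd_graph \<Rightarrow> fG \<Rightarrow> rat" where
  "\<mu> \<Theta> = projection \<Theta> \<circ> graphical_trace"

end

theory Submission
  imports Defs
begin

text \<open>
  The trace of \<open>(G, F)\<close> is read off from the systems of disjoint odd cycles covering all vertices of \<open>G\<close>
  that become \<open>F\<close> on deleting one edge from each cycle. Two different such systems force a loop in both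
  collapsed graphs, so that the value is then \<open>0\<close>; for a single system the signs of reversing
  a path cancel. In an IHX relation a cycle through \<open>e\<close> uses two of the four adjacent half-edges and
  survives in exactly the two expansions in which these are separated by \<open>e\<close>, with the two spokes
  exchanged: the values cancel. In the boundary the edge added to a path and the closing edge of its cycle
  can trade places, which cancels the terms in pairs. Finally, replacing every vertex of \<open>\<Theta>\<close>
  by a cycle, with all edges but one of it in the forest, gives a forested graph with trace
  \<open>(-2)\<^sup>m \<Theta>\<close>, where \<open>m\<close> is the number of vertices.
\<close>

section \<open>Signs of reorderings\<close>

text \<open>Both \<open>graphical_trace\<close> and \<open>projection\<close> are definite
  descriptions, so no value is available before existence and uniqueness are proved; for the trace
  this means that its values respect every relation. They are therefore recorded by a relation
  \<open>has_value G es C v\<close> that keeps the half-edge set \<open>C\<close> of the cycles. For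
  equal \<open>C\<close> only the numbering and the directions of the cycles are free, and the value
  is the same. For different \<open>C\<close> it is 0: a half-edge in only one of the sets belongs
  to a closing edge, which becomes a loop after the other collapse, and swapping the halves of a
  loop is an odd automorphism. The obstacle in an IHX relation is that two expansions cancel while
  the third may have a value of its own; carried back to one of the first two, it gives a second
  \<open>C\<close> there and so vanishes. The same dichotomy makes the partner of an edge in the
  boundary unique. Parity enters three times: trees with evenly many edges can be permuted freely,
  reversing 2k edges has the sign of reversing 2k + 1 vertices, and rotating a cycle of odd length
  is even.\<close>

definition srel :: "'a list \<Rightarrow> 'a list \<Rightarrow> int \<Rightarrow> bool" where
  "srel xs ys s \<longleftrightarrow> (\<exists>p. p permutes {..<length xs} \<and> ys = permute_list p xs \<and> s = sign p)"

lemma srelI: "p permutes {..<length xs} \<Longrightarrow> permute_list p xs = ys \<Longrightarrow> sign p = s \<Longrightarrow> srel xs ys s"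
  unfolding srel_def by blast

lemma srelE:
  assumes "srel xs ys s"
  obtains p where "p permutes {..<length xs}" "permute_list p xs = ys" "sign p = s"
  using assms unfolding srel_def by blast

lemma srel_length: "srel xs ys s \<Longrightarrow> length ys = length xs"
  by (auto simp: srel_def)

lemma srel_set: "srel xs ys s \<Longrightarrow> set ys = set xs"
  by (auto simp: srel_def)

lemma srel_distinct: "srel xs ys s \<Longrightarrow> distinct ys = distinct xs"
  by (auto simp: srel_def)

lemma srel_sign: "srel xs ys s \<Longrightarrow> s = 1 \<or> s = -1"
  unfolding srel_def using sign_cases by metis

lemma srel_square: "srel xs ys s \<Longrightarrow> s * s = 1"
  using srel_sign by fastforce

lemma srel_refl: "srel xs xs 1"
  by (rule srelI[of id]) (auto simp: permutes_id)

lemma srel_trans: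
  assumes "srel xs ys s" "srel ys zs t"
  shows "srel xs zs (s * t)"
proof -
  obtain p where p: "p permutes {..<length xs}" "permute_list p xs = ys" "sign p = s"
    using assms(1) by (rule srelE)
  obtain q where q: "q permutes {..<length ys}" "permute_list q ys = zs" "sign q = t"
    using assms(2) by (rule srelE)
  have q': "q permutes {..<length xs}" using q(1) srel_length[OF assms(1)] by simp
  have perm: "permutation p" "permutation q"
    using p(1) q' by (auto intro: permutes_imp_permutation[OF finite_lessThan])
  show ?thesis
  proof (rule srelI[of "p \<circ> q"])
    show "p \<circ> q permutes {..<length xs}" using p(1) q' by (rule permutes_compose[rotated])
    show "permute_list (p \<circ> q) xs = zs" using permute_list_compose[OF q', of p] p q by simp
    show "sign (p \<circ> q) = s * t" using sign_compose[OF perm] p q by simp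
  qed
qed

lemma srel_sym:
  assumes "srel xs ys s" shows "srel ys xs s"
proof -
  obtain p where p: "p permutes {..<length xs}" "permute_list p xs = ys" "sign p = s"
    using assms by (rule srelE)
  have ip: "inv p permutes {..<length xs}" using p(1) by (rule permutes_inv)
  show ?thesis
  proof (rule srelI[of "inv p"])
    show "inv p permutes {..<length ys}" using ip srel_length[OF assms] by simp
    show "permute_list (inv p) ys = xs"
      using permute_list_compose[OF ip, of p] p(2) permutes_inv_o[OF p(1)] by simp
    show "sign (inv p) = s"
      using p sign_inverse[OF permutes_imp_permutation[OF finite_lessThan p(1)]] by simp
  qed
qed

lemma srel_map: "srel xs ys s \<Longrightarrow> srel (map f xs) (map f ys) s"
  by (auto simp: srel_def permute_list_map)

lemma srel_transpose:
  assumes "i < length xs" "j < length xs" "i \<noteq> j"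
  shows "srel xs (permute_list (transpose i j) xs) (-1)"
  using assms by (intro srelI[of "transpose i j"]) (auto simp: permutes_swap_id sign_swap_id)

text \<open>Prepending shifts every index by one. Instead of conjugating an arbitrary permutation
  with \<open>Suc\<close>, the proof builds it from transpositions, for which the shifted
  permutation is again an explicit transposition.\<close>

lemma srel_Cons:
  assumes "srel xs ys s"
  shows "srel (x # xs) (x # ys) s"
proof -
  obtain p where p: "p permutes {..<length xs}" "permute_list p xs = ys" "sign p = s"
    using assms by (rule srelE)
  have "srel (x # xs) (x # permute_list p xs) (sign p)"
    using finite_lessThan p(1)
  proof (induction p rule: permutes_rev_induct)
    case id
    then show ?case using srel_refl by (simp add: numeral_2_eq_2)
  next
    case (swap a b p)
    have ab: "transpose a b permutes {..<length xs}" using swap by (simp add: permutes_swap_id)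
    have 1: "permute_list (p \<circ> transpose a b) xs = permute_list (transpose a b) (permute_list p xs)"
      using permute_list_compose[OF ab] .
    define zs where "zs = permute_list p xs"
    have len: "length zs = length xs" by (simp add: zs_def)
    have t: "transpose (Suc a) (Suc b) (Suc k) = Suc (transpose a b k)"
      "transpose (Suc a) (Suc b) 0 = 0" for k
      by (simp_all add: transpose_def)
    have "x # permute_list (transpose a b) zs = permute_list (transpose (Suc a) (Suc b)) (x # zs)"
    proof (rule nth_equalityI)
      fix i assume i: "i < length (x # permute_list (transpose a b) zs)"
      show "(x # permute_list (transpose a b) zs) ! i = permute_list (transpose (Suc a) (Suc b)) (x # zs) ! i"
      proof (cases i)
        case 0
        then show ?thesis by (simp add: permute_list_def t del: upt_Suc)
      next
        case (Suc k)
        with i have "k < length zs" by simp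
        then show ?thesis unfolding Suc by (simp add: permute_list_def t del: upt_Suc)
      qed
    qed simp
    then have "srel (x # zs) (x # permute_list (transpose a b) zs) (-1)"
      using srel_transpose[of "Suc a" "x # zs" "Suc b"] swap(1-3) len by simp
    from srel_trans[OF swap(5)[folded zs_def] this]
    have "srel (x # xs) (x # permute_list (p \<circ> transpose a b) xs) (sign p * (-1))"
      unfolding 1 zs_def .
    moreover have "sign (p \<circ> transpose a b) = sign p * (-1)"
      using sign_compose[OF permutes_imp_permutation[OF finite_lessThan swap(4)]
          permutation_swap_id[of a b]] swap(3) by (simp add: sign_swap_id)
    ultimately show ?case by (simp only:)
  qed
  then show ?thesis using p by simp
qed

lemma srel_append_left: "srel xs ys s \<Longrightarrow> srel (zs @ xs) (zs @ ys) s"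
  by (induction zs) (auto intro: srel_Cons)

text \<open>Appending leaves the indices of \<open>xs\<close> alone, so the very same permutation
  serves, unlike in \<open>srel_Cons\<close>.\<close>

lemma srel_append_right:
  assumes "srel xs ys s"
  shows "srel (xs @ zs) (ys @ zs) s"
proof -
  obtain p where p: "p permutes {..<length xs}" "permute_list p xs = ys" "sign p = s"
    using assms by (rule srelE)
  show ?thesis
  proof (rule srelI[of p])
    show "p permutes {..<length (xs @ zs)}" using p(1) by (rule permutes_subset) auto
    show "permute_list p (xs @ zs) = ys @ zs"
    proof (rule nth_equalityI)
      fix i assume i: "i < length (permute_list p (xs @ zs))"
      show "permute_list p (xs @ zs) ! i = (ys @ zs) ! i"
      proof (cases "i < length xs")
        case True
        then have "p i < length xs" using permutes_in_image[OF p(1)] by auto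
        then show ?thesis using True p(2) by (auto simp: permute_list_def nth_append)
      next
        case False
        then have "p i = i" using p(1) by (simp add: permutes_not_in)
        then show ?thesis using False i p(2) by (auto simp: permute_list_def nth_append)
      qed
    qed (use srel_length[OF assms] in simp)
  qed (rule p(3))
qed

lemma srel_append:
  assumes "srel xs ys s" "srel xs' ys' t"
  shows "srel (xs @ xs') (ys @ ys') (s * t)"
  using srel_trans[OF srel_append_right[OF assms(1)] srel_append_left[OF assms(2)]] .

lemma nth_permute_list: "i < length xs \<Longrightarrow> permute_list f xs ! i = xs ! f i"
  by (simp add: permute_list_def)

lemma srel_Cons_Cons: "srel (x # y # zs) (y # x # zs) (-1)"
proof -
  have "permute_list (transpose 0 1) (x # y # zs) = y # x # zs"
  proof (rule nth_equalityI)
    fix i assume "i < length (permute_list (transpose 0 1) (x # y # zs))"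
    moreover consider "i = 0" | "i = 1" | k where "i = Suc (Suc k)" by (metis One_nat_def not0_implies_Suc)
    ultimately show "permute_list (transpose 0 1) (x # y # zs) ! i = (y # x # zs) ! i"
      by cases (simp_all add: nth_permute_list transpose_def)
  qed simp
  with srel_transpose[of 0 "x # y # zs" 1] show ?thesis by simp
qed

lemma srel_move: "srel (x # ys) (ys @ [x]) ((-1) ^ length ys)"
proof (induction ys)
  case Nil
  then show ?case using srel_refl by (simp add: numeral_2_eq_2)
next
  case (Cons y ys)
  from srel_trans[OF srel_Cons_Cons srel_Cons[OF Cons]] show ?case by simp
qed

lemma srel_swap: "srel (xs @ ys) (ys @ xs) ((-1) ^ (length xs * length ys))"
proof (induction xs)
  case Nil
  then show ?case using srel_refl by (simp add: numeral_2_eq_2)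
next
  case (Cons x xs)
  have "srel (x # ys @ xs) (ys @ x # xs) ((-1) ^ length ys)"
    using srel_append_right[OF srel_move[of x ys], of xs] by simp
  from srel_trans[OF srel_Cons[OF Cons] this] show ?case by (simp add: power_add mult.commute)
qed

text \<open>Reversal inverts every pair of positions, hence the binomial coefficient; in the
  induction the head passes over the whole reversed tail.\<close>

lemma srel_rev: "srel xs (rev xs) ((-1) ^ (length xs choose 2))"
proof (induction xs)
  case Nil
  then show ?case using srel_refl by (simp add: numeral_2_eq_2)
next
  case (Cons x xs)
  have e: "(length xs choose 2) + length xs = (length (x # xs) choose 2)"
    by (simp add: numeral_2_eq_2)
  have "srel (x # xs) (rev (x # xs)) ((-1) ^ (length xs choose 2) * (-1) ^ length xs)"
    using srel_trans[OF srel_Cons[OF Cons, of x] srel_move[of x "rev xs"]] by simp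
  then show ?case unfolding power_add[symmetric] e .
qed

text \<open>Only the identity fixes a list without repetitions. With a repetition both signs are
  possible, which is why \<open>srel\<close> is a relation and not a function.\<close>

lemma srel_unique:
  assumes "srel xs ys s" "srel xs ys t" "distinct xs"
  shows "s = t"
proof -
  have "srel xs xs (s * t)" using srel_trans[OF assms(1) srel_sym[OF assms(2)]] .
  then obtain p where p: "p permutes {..<length xs}" "permute_list p xs = xs" "sign p = s * t"
    by (rule srelE)
  have "p i = i" for i
  proof (cases "i < length xs")
    case True
    have "p i < length xs" using permutes_in_image[OF p(1)] True by auto
    moreover have "xs ! p i = xs ! i" using True p(2) by (metis permute_list_nth[OF p(1)])
    ultimately show ?thesis using True assms(3) nth_eq_iff_index_eq by blast
  qed (use p(1) in \<open>simp add: permutes_not_in\<close>)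
  then have "p = id" by auto
  then have "s * t = 1" using p(3) by simp
  then show ?thesis using srel_sign[OF assms(1)] srel_sign[OF assms(2)] by auto
qed

lemma srel_exists:
  assumes "distinct xs" "distinct ys" "set xs = set ys"
  obtains s where "srel xs ys s"
proof -
  have "mset ys = mset xs" using assms by (simp add: set_eq_iff_mset_eq_distinct)
  then obtain p where "p permutes {..<length xs}" "permute_list p xs = ys"
    by (rule mset_eq_permutation)
  then show thesis using that srelI by blast
qed

lemma srel_concat:
  assumes "\<And>i. i < length xss \<Longrightarrow> srel (xss ! i) (yss ! i) (s i)" "length yss = length xss"
  shows "srel (concat xss) (concat yss) (\<Prod>i<length xss. s i)"
  using assms
proof (induction xss arbitrary: yss s)
  case Nil
  then show ?case using srel_refl by (simp add: numeral_2_eq_2)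
next
  case (Cons xs xss)
  obtain ys yss' where yss: "yss = ys # yss'" using Cons.prems(2) by (cases yss) auto
  have "srel (concat xss) (concat yss') (\<Prod>i<length xss. s (Suc i))"
    using Cons.prems yss by (intro Cons.IH) force+
  moreover have "srel xs ys (s 0)" using Cons.prems(1)[of 0] yss by simp
  ultimately have "srel (xs @ concat xss) (ys @ concat yss') (s 0 * (\<Prod>i<length xss. s (Suc i)))"
    by (rule srel_append[rotated])
  then have "srel (xs @ concat xss) (ys @ concat yss') (prod s {..<Suc (length xss)})"
    unfolding prod.lessThan_Suc_shift[of s] .
  then show ?case unfolding yss by (simp only: concat.simps list.size add_Suc_right add_0_right)
qed

text \<open>A block of even length passes over any list with an even number of transpositions.
  Applied to the trees, this makes the sign independent of their order.\<close>

lemma srel_concat_even_blocks: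
  assumes "mset xss = mset yss" "\<And>xs. xs \<in> set xss \<Longrightarrow> even (length xs)"
  shows "srel (concat xss) (concat yss) 1"
  using assms
proof (induction xss arbitrary: yss)
  case Nil
  then show ?case using srel_refl by (simp add: numeral_2_eq_2)
next
  case (Cons xs xss)
  have "xs \<in> set yss" using Cons.prems(1) by (metis list.set_intros(1) mset_eq_setD)
  then obtain as bs where yss: "yss = as @ xs # bs" by (meson split_list)
  have "srel (concat xss) (concat (as @ bs)) 1" using Cons yss by (intro Cons.IH) auto
  from srel_append_left[OF this, of xs]
  have "srel (xs @ concat xss) (xs @ concat as @ concat bs) 1" by simp
  moreover have "srel (xs @ concat as @ concat bs) (concat as @ xs @ concat bs) 1"
    using srel_append_right[OF srel_swap[of xs "concat as"], of "concat bs"] Cons.prems(2)[of xs]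
    by (simp add: uminus_power_if)
  ultimately show ?case using srel_trans[of _ _ 1 _ 1] yss by simp
qed

section \<open>Free spaces and their quotients\<close>

lemma linearI:
  assumes "vector_space s" "vector_space t" "\<And>x y. f (x + y) = f x + f y" "\<And>c x. f (s c x) = t c (f x)"
  shows "Vector_Spaces.linear s t f"
  using assms by (simp add: Vector_Spaces.linear_iff)

definition lin_ext :: "(rat \<Rightarrow> 'b \<Rightarrow> 'b) \<Rightarrow> ('c \<Rightarrow> 'b) \<Rightarrow> ('c \<Rightarrow>\<^sub>0 rat) \<Rightarrow> 'b::comm_monoid_add" where
  "lin_ext scale g X = (\<Sum>k\<in>Poly_Mapping.keys X. scale (Poly_Mapping.lookup X k) (g k))"

context
  fixes scale :: "rat \<Rightarrow> 'b::ab_group_add \<Rightarrow> 'b"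
  assumes vs: "vector_space scale"
begin

interpretation V: vector_space scale by (rule vs)

text \<open>The support varies with \<open>X\<close>; over a common finite index set linearity
  becomes a termwise statement.\<close>

lemma lin_ext_superset:
  assumes "finite A" "Poly_Mapping.keys X \<subseteq> A"
  shows "lin_ext scale g X = (\<Sum>k\<in>A. scale (Poly_Mapping.lookup X k) (g k))"
  unfolding lin_ext_def using assms
  by (intro sum.mono_neutral_left) (auto simp: in_keys_iff)

lemma lin_ext_single: "lin_ext scale g (Poly_Mapping.single k c) = scale c (g k)"
  by (simp add: lin_ext_def)

lemma lin_ext_add: "lin_ext scale g (X + Y) = lin_ext scale g X + lin_ext scale g Y"
proof -
  let ?A = "Poly_Mapping.keys X \<union> Poly_Mapping.keys Y"
  have "Poly_Mapping.keys (X + Y) \<subseteq> ?A" by (rule Poly_Mapping.keys_add)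
  then show ?thesis
    by (simp add: lin_ext_superset[of ?A] lookup_add V.scale_left_distrib sum.distrib)
qed

lemma lin_ext_linear: "Vector_Spaces.linear free_scale scale (lin_ext scale g)"
proof (rule linearI[OF free.vector_space_axioms vs])
  fix c :: rat and X :: "'a \<Rightarrow>\<^sub>0 rat"
  have "Poly_Mapping.keys (free_scale c X) \<subseteq> Poly_Mapping.keys X"
    by (auto simp: in_keys_iff lookup_free_scale)
  then show "lin_ext scale g (free_scale c X) = scale c (lin_ext scale g X)"
    by (simp add: lin_ext_superset[of "Poly_Mapping.keys X"] lookup_free_scale V.scale_sum_right)
qed (rule lin_ext_add)

lemma linear_eq_lin_ext:
  assumes "Vector_Spaces.linear free_scale scale f"
  shows "f X = lin_ext scale (\<lambda>k. f (gen k)) X"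
proof -
  interpret L: Vector_Spaces.linear free_scale scale f by fact
  have *: "f (Poly_Mapping.single k c) = scale c (f (gen k))" for k c
  proof -
    have "Poly_Mapping.single k c = free_scale c (gen k)"
      by (intro poly_mapping_eqI) (auto simp: lookup_free_scale lookup_single when_def)
    then show ?thesis by (simp add: L.scale)
  qed
  have "f X = f (\<Sum>k\<in>Poly_Mapping.keys X. Poly_Mapping.single k (Poly_Mapping.lookup X k))"
  proof (rule arg_cong[where f=f], rule poly_mapping_eqI)
    fix k
    have "(\<Sum>j\<in>Poly_Mapping.keys X. Poly_Mapping.lookup (Poly_Mapping.single j (Poly_Mapping.lookup X j)) k)
        = (\<Sum>j\<in>Poly_Mapping.keys X. if j = k then Poly_Mapping.lookup X j else 0)"
      by (rule sum.cong) (auto simp: lookup_single when_def)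
    also have "\<dots> = Poly_Mapping.lookup X k"
      by (subst sum.delta) (auto simp: in_keys_iff)
    finally show "Poly_Mapping.lookup X k = Poly_Mapping.lookup
        (\<Sum>j\<in>Poly_Mapping.keys X. Poly_Mapping.single j (Poly_Mapping.lookup X j)) k"
      by (simp only: lookup_sum)
  qed
  also have "\<dots> = lin_ext scale (\<lambda>k. f (gen k)) X" 
    unfolding lin_ext_def L.sum by (intro sum.cong refl *)
  finally show ?thesis .
qed

lemma linear_eq_on_span:
  assumes "Vector_Spaces.linear free_scale scale f"
    and "\<And>r. r \<in> R \<Longrightarrow> f r = 0" and "X - Y \<in> free.span R"
  shows "f X = f Y"
proof -
  interpret L: Vector_Spaces.linear free_scale scale f by fact
  have "f (X - Y) = 0"
    using assms(3) by (induction rule: free.span_induct_alt) (auto simp: L.add L.scale L.zero assms(2))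
  then show ?thesis by (simp add: L.diff)
qed

end

section \<open>Linear maps out of the quotient of a free space by the span of relations, once for
  both spaces\<close>

context
  fixes R :: "('a \<Rightarrow>\<^sub>0 rat) set" and absq :: "('a \<Rightarrow>\<^sub>0 rat) \<Rightarrow> 'q::ab_group_add"
    and repq :: "'q \<Rightarrow> 'a \<Rightarrow>\<^sub>0 rat" and qscale :: "rat \<Rightarrow> 'q \<Rightarrow> 'q"
    and scale :: "rat \<Rightarrow> 'b::ab_group_add \<Rightarrow> 'b"
  assumes Q: "Quotient3 (\<lambda>x y. x - y \<in> free.span R) absq repq"
    and add: "\<And>X Y. absq X + absq Y = absq (X + Y)"
    and scl: "\<And>c X. qscale c (absq X) = absq (free_scale c X)"
    and vsq: "vector_space qscale" and vs: "vector_space scale"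
begin

text \<open>A linear map that kills the relations kills their span, so it can be computed on any
  representative; \<open>repq\<close> merely picks one.\<close>

lemma quotient_linear_exists:
  assumes zero: "\<And>r. r \<in> R \<Longrightarrow> lin_ext scale g r = 0"
  obtains T where "Vector_Spaces.linear qscale scale T" "\<And>x. T (absq (gen x)) = g x"
proof -
  define T where "T q = lin_ext scale g (repq q)" for q
  have T: "T (absq X) = lin_ext scale g X" for X
    unfolding T_def
    by (rule linear_eq_on_span[OF vs lin_ext_linear[OF vs] zero])
      (use rep_abs_rsp_left[OF Q, of X X] in \<open>auto simp: free.span_zero\<close>)
  interpret vector_space scale by (rule vs)
  interpret L: Vector_Spaces.linear free_scale scale "lin_ext scale g" by (rule lin_ext_linear[OF vs])
  show thesis
  proof (rule that[of T])
    show "Vector_Spaces.linear qscale scale T"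
    proof (rule linearI[OF vsq vs])
      fix c q r
      obtain X Y where XY: "q = absq X" "r = absq Y" by (metis Quotient3_abs_rep[OF Q])
      show "T (q + r) = T q + T r" unfolding XY by (simp add: add T L.add)
      show "T (qscale c q) = scale c (T q)" unfolding XY by (simp add: scl T L.scale)
    qed
    show "T (absq (gen x)) = g x" for x by (simp add: T lin_ext_single[OF vs])
  qed
qed

lemma quotient_linear_unique:
  assumes T: "Vector_Spaces.linear qscale scale T" "Vector_Spaces.linear qscale scale T'"
    and eq: "\<And>x. T (absq (gen x)) = T' (absq (gen x))"
  shows "T = T'"
proof
  fix q
  obtain X where X: "q = absq X" by (metis Quotient3_abs_rep[OF Q])
  have lin: "Vector_Spaces.linear free_scale scale (\<lambda>X. S (absq X))"
    if "Vector_Spaces.linear qscale scale S" for S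
  proof -
    interpret S: Vector_Spaces.linear qscale scale S by fact
    show ?thesis
      by (rule linearI[OF free.vector_space_axioms vs]) (simp_all add: add[symmetric] scl[symmetric] S.add S.scale)
  qed
  show "T q = T' q"
    unfolding X using linear_eq_lin_ext[OF vs lin[OF T(1)], of X] linear_eq_lin_ext[OF vs lin[OF T(2)], of X]
    by (simp add: eq)
qed

end

lemmas fG_linear_exists = quotient_linear_exists[OF Quotient3_fG plus_fG.abs_eq fscale.abs_eq
    fG.vector_space_axioms, folded fclass.abs_eq]

lemmas fG_linear_unique = quotient_linear_unique[OF Quotient3_fG plus_fG.abs_eq fscale.abs_eq
    fG.vector_space_axioms, folded fclass.abs_eq]

lemmas cG_linear_exists = quotient_linear_exists[OF Quotient3_cG plus_cG.abs_eq cscale.abs_eq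
    cG.vector_space_axioms, folded cclass.abs_eq]

lemmas cG_linear_unique = quotient_linear_unique[OF Quotient3_cG plus_cG.abs_eq cscale.abs_eq
    cG.vector_space_axioms, folded cclass.abs_eq]

section \<open>Isomorphisms and classes of odd graphs\<close>

lemma graph_iso_id: "graph_iso id G G"
  by (auto simp: graph_iso_def)

lemma is_graphD:
  assumes "is_graph G"
  shows "finite (halves G)" "h \<in> halves G \<Longrightarrow> opp G h \<in> halves G"
    "h \<in> halves G \<Longrightarrow> opp G h \<noteq> h" "h \<in> halves G \<Longrightarrow> opp G (opp G h) = h"
  using assms by (auto simp: is_graph_def)

text \<open>Serves the two automorphism-like maps of the proof that swap the halves of one edge: at
  a loop, and at a forest edge whose ends are interchanged.\<close>

lemma opp_transpose:
  assumes "is_graph G" "h \<in> halves G" "k \<in> halves G"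
  shows "transpose h (opp G h) (opp G k) = opp G (transpose h (opp G h) k)"
proof -
  have "opp G k = h \<longleftrightarrow> k = opp G h" "opp G k = opp G h \<longleftrightarrow> k = h"
    using is_graphD(4)[OF assms(1)] assms(2,3) by metis+
  then show ?thesis using is_graphD(4)[OF assms(1,2)] by (auto simp: transpose_def)
qed

lemma graph_iso_comp:
  assumes "graph_iso \<phi> G H" "graph_iso \<psi> H K"
  shows "graph_iso (\<psi> \<circ> \<phi>) G K"
proof -
  have mem: "\<phi> h \<in> halves H" if "h \<in> halves G" for h
    using assms(1) that by (auto simp: graph_iso_def bij_betw_def)
  show ?thesis
    using assms mem unfolding graph_iso_def by (auto intro: bij_betw_trans)
qed

lemma graph_iso_sym:
  assumes iso: "graph_iso \<phi> G H" and G: "is_graph G"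
  shows "graph_iso (inv_into (halves G) \<phi>) H G"
proof -
  let ?\<psi> = "inv_into (halves G) \<phi>"
  have bij: "bij_betw \<phi> (halves G) (halves H)" using iso by (simp add: graph_iso_def)
  have mem: "?\<psi> k \<in> halves G" "\<phi> (?\<psi> k) = k" if "k \<in> halves H" for k
    using that bij by (auto simp: bij_betw_def inv_into_into f_inv_into_f)
  have "?\<psi> (opp H k) = opp G (?\<psi> k)" if k: "k \<in> halves H" for k
  proof -
    have "opp H k = \<phi> (opp G (?\<psi> k))" using iso mem[OF k] by (metis graph_iso_def)
    then show ?thesis
      using mem[OF k] bij is_graphD[OF G] by (simp add: bij_betw_def inv_into_f_f)
  qed
  moreover have "vert H h = vert H k \<longleftrightarrow> vert G (?\<psi> h) = vert G (?\<psi> k)"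
    if "h \<in> halves H" "k \<in> halves H" for h k
    using iso mem[OF that(1)] mem[OF that(2)] unfolding graph_iso_def by metis
  ultimately show ?thesis
    using bij_betw_inv_into[OF bij] unfolding graph_iso_def by blast
qed

lemma graph_iso_star:
  assumes "graph_iso \<phi> G H" "h \<in> halves G"
  shows "star H (vert H (\<phi> h)) = \<phi> ` star G (vert G h)"
proof -
  have H: "halves H = \<phi> ` halves G" using assms by (simp add: graph_iso_def bij_betw_def)
  show ?thesis
    using assms(2) assms(1)[unfolded graph_iso_def] unfolding star_def H by auto
qed

text \<open>Classes of raw pairs, so that collapsed graphs need not be wrapped at every occurrence;
  it is meaningful only where \<open>is_odd_graph\<close> holds.\<close>

definition oclass :: "graph \<times> (nat \<Rightarrow> nat list) \<Rightarrow> cG" where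
  "oclass X = cclass (Abs_odd_graph X)"

lemma oclass_Rep: "oclass (Rep_odd_graph x) = cclass x"
  by (simp add: oclass_def Rep_odd_graph_inverse)

lemma is_odd_graph_Rep: "is_odd_graph (ograph x, ordering x)"
  using Rep_odd_graph[of x] by simp

lemma is_graph_ograph: "is_graph (ograph x)"
  using Rep_odd_graph[of x] by (auto simp: is_odd_graph_def split: prod.splits)

lemma Rep_Abs_odd: "is_odd_graph X \<Longrightarrow> Rep_odd_graph (Abs_odd_graph X) = X"
  by (simp add: Abs_odd_graph_inverse)

lemma abs_cG_eqI: "X - Y \<in> odd_relations \<Longrightarrow> abs_cG X = abs_cG Y"
  by (simp add: cG.abs_eq_iff free.span_base)

lemma cclass_odd_iso: "odd_iso x y \<Longrightarrow> cclass x = cclass y"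
  unfolding cclass.abs_eq by (rule abs_cG_eqI) (auto simp: odd_relations_def)

lemma cclass_reorder:
  assumes "ograph y = ograph x"
    "\<And>v. v \<in> verts (ograph x) \<Longrightarrow> srel (ordering x v) (ordering y v) (s v)"
  shows "cclass y = cscale (of_int (\<Prod>v\<in>verts (ograph x). s v)) (cclass x)"
proof -
  have "\<forall>v\<in>verts (ograph x). \<exists>p. p permutes {..<length (ordering x v)} \<and>
      ordering y v = permute_list p (ordering x v) \<and> sign p = s v"
    using assms(2) srelE by metis
  then obtain p where p: "\<And>v. v \<in> verts (ograph x) \<Longrightarrow> p v permutes {..<length (ordering x v)} \<and>
      ordering y v = permute_list (p v) (ordering x v) \<and> sign (p v) = s v"
    by metis
  have "gen y - free_scale (of_int (\<Prod>v\<in>verts (ograph x). sign (p v))) (gen x) \<in> odd_relations"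
    unfolding odd_relations_def using assms(1) p by blast
  from abs_cG_eqI[OF this] have "cclass y = cscale (of_int (\<Prod>v\<in>verts (ograph x). sign (p v))) (cclass x)"
    by (simp add: cclass.abs_eq cscale.abs_eq)
  moreover have "(\<Prod>v\<in>verts (ograph x). sign (p v)) = (\<Prod>v\<in>verts (ograph x). s v)"
    using p by (intro prod.cong) auto
  ultimately show ?thesis by simp
qed

lemma oclass_separating:
  assumes "is_odd_graph (G, od)" "has_separating_edge G"
  shows "oclass (G, od) = 0"
proof -
  have "gen (Abs_odd_graph (G, od)) - 0 \<in> odd_relations"
    using assms by (auto simp: odd_relations_def Rep_Abs_odd)
  from abs_cG_eqI[OF this] show ?thesis
    by (simp add: oclass_def cclass.abs_eq zero_cG.abs_eq)
qed

text \<open>An isomorphism acts on half-edges only, so a vertex \<open>w\<close> of \<open>B\<close>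
  is reached through a chosen half-edge \<open>h w\<close> above it. The transported orientation
  \<open>oc\<close> represents the class of \<open>(A, oa)\<close> without a sign; comparing
  \<open>oc\<close> with \<open>ob\<close> on the same graph contributes one sign per
  vertex.\<close>

lemma oclass_iso:
  assumes A: "is_odd_graph (A, oa)" and B: "is_odd_graph (B, ob)" and iso: "graph_iso \<phi> A B"
    and s: "\<And>h. h \<in> halves A \<Longrightarrow> srel (map \<phi> (oa (vert A h))) (ob (vert B (\<phi> h))) (s (vert A h))"
  shows "oclass (B, ob) = cscale (of_int (\<Prod>v\<in>verts A. s v)) (oclass (A, oa))"
proof -
  define h where "h w = (SOME h. h \<in> halves A \<and> vert B (\<phi> h) = w)" for w
  define oc where "oc w = map \<phi> (oa (vert A (h w)))" for w
  have bij: "bij_betw \<phi> (halves A) (halves B)" using iso by (simp add: graph_iso_def)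
  have h: "h w \<in> halves A \<and> vert B (\<phi> (h w)) = w" if "w \<in> verts B" for w
  proof -
    have "\<exists>k. k \<in> halves A \<and> vert B (\<phi> k) = w"
      using that bij[THEN bij_betw_imp_surj_on, symmetric] by (auto simp: verts_def)
    then show ?thesis unfolding h_def by (rule someI_ex)
  qed
  have vert: "vert A k = vert A l \<longleftrightarrow> vert B (\<phi> k) = vert B (\<phi> l)"
    if "k \<in> halves A" "l \<in> halves A" for k l
    using iso that by (auto simp: graph_iso_def)
  have vB: "vert B (\<phi> k) \<in> verts B" if "k \<in> halves A" for k
    using that bij by (auto simp: verts_def bij_betw_def)
  have oc: "oc (vert B (\<phi> k)) = map \<phi> (oa (vert A k))" if "k \<in> halves A" for k
  proof -
    have "vert A (h (vert B (\<phi> k))) = vert A k" using h[OF vB[OF that]] vert[OF _ that] by blast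
    then show ?thesis by (simp add: oc_def)
  qed
  have "distinct (oc w) \<and> set (oc w) = star B w" if w: "w \<in> verts B" for w
  proof -
    have v: "vert A (h w) \<in> verts A" using h[OF w] by (simp add: verts_def)
    have "set (oa (vert A (h w))) = star A (vert A (h w))" "distinct (oa (vert A (h w)))"
      using A v by (auto simp: is_odd_graph_def)
    moreover have "inj_on \<phi> (star A (vert A (h w)))"
      using bij by (auto simp: bij_betw_def star_def intro: inj_on_subset)
    moreover have "star B w = \<phi> ` star A (vert A (h w))"
      using graph_iso_star[OF iso, of "h w"] h[OF w] by simp
    ultimately show ?thesis by (simp add: oc_def distinct_map)
  qed
  with B have C: "is_odd_graph (B, oc)" by (auto simp: is_odd_graph_def)
  have "odd_iso (Abs_odd_graph (A, oa)) (Abs_odd_graph (B, oc))"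
    unfolding odd_iso_def using iso oc by (auto simp: Rep_Abs_odd A C)
  then have 1: "oclass (A, oa) = oclass (B, oc)" unfolding oclass_def by (rule cclass_odd_iso)
  have "srel (oc w) (ob w) (s (vert A (h w)))" if "w \<in> verts B" for w
    using s[of "h w"] h[OF that] by (simp add: oc_def)
  then have 2: "oclass (B, ob) = cscale (of_int (\<Prod>w\<in>verts B. s (vert A (h w)))) (oclass (B, oc))"
    unfolding oclass_def
    using cclass_reorder[of "Abs_odd_graph (B, ob)" "Abs_odd_graph (B, oc)" "\<lambda>w. s (vert A (h w))"]
    by (simp add: Rep_Abs_odd[OF B] Rep_Abs_odd[OF C])
  \<comment> \<open>The signs were collected over the vertices of \<open>B\<close>; this bijection
    turns their product into one over the vertices of \<open>A\<close>.\<close>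
  have "bij_betw (\<lambda>w. vert A (h w)) (verts B) (verts A)"
  proof (rule bij_betw_imageI)
    show "inj_on (\<lambda>w. vert A (h w)) (verts B)"
    proof (rule inj_onI)
      fix w w' assume w: "w \<in> verts B" "w' \<in> verts B" "vert A (h w) = vert A (h w')"
      then have "vert B (\<phi> (h w)) = vert B (\<phi> (h w'))" using vert h by blast
      then show "w = w'" using h w by simp
    qed
    show "(\<lambda>w. vert A (h w)) ` verts B = verts A"
    proof
      show "(\<lambda>w. vert A (h w)) ` verts B \<subseteq> verts A" using h by (auto simp: verts_def)
      show "verts A \<subseteq> (\<lambda>w. vert A (h w)) ` verts B"
      proof
        fix v assume "v \<in> verts A"
        then obtain k where k: "k \<in> halves A" "v = vert A k" by (auto simp: verts_def)
        then have "vert A (h (vert B (\<phi> k))) = v" using h[OF vB[OF k(1)]] vert[OF _ k(1)] by blast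
        then show "v \<in> (\<lambda>w. vert A (h w)) ` verts B" using vB[OF k(1)] by force
      qed
    qed
  qed
  from prod.reindex_bij_betw[OF this, of s] show ?thesis using 1 2 by simp
qed

text \<open>Characteristic 0 enters here. The minus sign has the shape in which
  \<open>oclass_iso\<close> delivers it.\<close>

lemma cG_self_neg_zero:
  assumes "x = cscale (of_int (-1)) x"
  shows "x = 0"
proof -
  have "cscale (of_int (-1)) x = - x" by simp
  with assms have "x = - x" by (rule trans)
  then have "x + x = 0" by (rule eq_neg_iff_add_eq_0[THEN iffD1])
  moreover have "cscale 2 x = cscale 1 x + cscale 1 x"
    unfolding cG.scale_left_distrib[symmetric] by simp
  ultimately show ?thesis by simp
qed

lemma srel_map_transpose:
  assumes "distinct xs" "a \<in> set xs" "b \<in> set xs" "a \<noteq> b"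
  shows "srel xs (map (transpose a b) xs) (-1)"
proof -
  obtain i j where ij: "i < length xs" "xs ! i = a" "j < length xs" "xs ! j = b"
    using assms by (metis in_set_conv_nth)
  have "permute_list (transpose i j) xs = map (transpose a b) xs"
  proof (rule nth_equalityI)
    fix k assume k: "k < length (permute_list (transpose i j) xs)"
    have "xs ! k = a \<longleftrightarrow> k = i" "xs ! k = b \<longleftrightarrow> k = j"
      using k ij assms(1) by (auto simp: nth_eq_iff_index_eq)
    then show "permute_list (transpose i j) xs ! k = map (transpose a b) xs ! k"
      using k ij by (auto simp: permute_list_def transpose_def)
  qed simp
  moreover have "i \<noteq> j" using ij assms by auto
  ultimately show ?thesis using srel_transpose[of i xs j] ij by metis
qed

text \<open>Loops are not among the relations. The class vanishes because swapping the two halves of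
  the loop is an automorphism that transposes two entries of the ordering at one vertex and fixes
  the orderings at all others.\<close>

lemma oclass_loop:
  assumes A: "is_odd_graph (A, oa)" and h: "h \<in> halves A" "vert A h = vert A (opp A h)"
  shows "oclass (A, oa) = 0"
proof -
  let ?\<phi> = "transpose h (opp A h)" and ?v = "vert A h"
  have G: "is_graph A" using A by (simp add: is_odd_graph_def)
  note D = is_graphD[OF G]
  have ne: "h \<noteq> opp A h" and oh: "opp A h \<in> halves A" using D h by metis+
  have iso: "graph_iso ?\<phi> A A"
  proof -
    have "bij_betw ?\<phi> (halves A) (halves A)"
      using h oh by (intro permutes_imp_bij permutes_swap_id) auto
    moreover have "vert A (?\<phi> k) = vert A k" for k using h by (auto simp: transpose_def)
    ultimately show ?thesis using opp_transpose[OF G h(1)] by (simp add: graph_iso_def)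
  qed
  have vert: "vert A (?\<phi> k) = vert A k" for k using h by (auto simp: transpose_def)
  have fin: "finite (verts A)" and v: "?v \<in> verts A" using D h by (auto simp: verts_def)
  have "srel (map ?\<phi> (oa (vert A k))) (oa (vert A (?\<phi> k))) (if vert A k = ?v then -1 else 1)"
    if k: "k \<in> halves A" for k
  proof -
    have oa: "set (oa (vert A k)) = star A (vert A k)" "distinct (oa (vert A k))"
      using A k by (auto simp: is_odd_graph_def verts_def)
    show ?thesis
    proof (cases "vert A k = ?v")
      case True
      have "srel (oa ?v) (map ?\<phi> (oa ?v)) (-1)"
        using oa True h oh ne by (intro srel_map_transpose) (auto simp: star_def)
      then show ?thesis using True vert by (simp add: srel_sym)
    next
      case False
      then have "map ?\<phi> (oa (vert A k)) = oa (vert A k)"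
        using oa h by (intro map_idI) (auto simp: star_def transpose_def)
      then show ?thesis using False vert by (simp add: srel_refl)
    qed
  qed
  from oclass_iso[OF A A iso this]
  have "oclass (A, oa) = cscale (of_int (\<Prod>v\<in>verts A. if v = ?v then -1 else 1)) (oclass (A, oa))"
    by simp
  also have "(\<Prod>v\<in>verts A. if v = ?v then -1 else 1 :: int) = -1"
    using fin v by (simp add: prod.delta)
  finally show ?thesis by (rule cG_self_neg_zero)
qed

text \<open>Two orientations differ by one sign at each vertex. Hence the classes of all graphs
  isomorphic to a given one lie on a single line, and the two conditions in
  \<open>projection\<close> cover all generators.\<close>

lemma oclass_iso_multiple:
  assumes A: "is_odd_graph (A, oa)" and B: "is_odd_graph (B, ob)" and iso: "graph_iso \<phi> A B"
  obtains e :: rat where "oclass (B, ob) = cscale e (oclass (A, oa))"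
proof -
  have bij: "bij_betw \<phi> (halves A) (halves B)" using iso by (simp add: graph_iso_def)
  have "\<exists>t. \<forall>h\<in>halves A. vert A h = v \<longrightarrow> srel (map \<phi> (oa v)) (ob (vert B (\<phi> h))) t" for v
  proof (cases "\<exists>k\<in>halves A. vert A k = v")
    case True
    then obtain k where k: "k \<in> halves A" "vert A k = v" by blast
    have oa: "set (oa v) = star A v" "distinct (oa v)"
      using A k by (auto simp: is_odd_graph_def verts_def)
    have "vert B (\<phi> k) \<in> verts B" using k bij by (auto simp: verts_def bij_betw_def)
    then have ob: "set (ob (vert B (\<phi> k))) = star B (vert B (\<phi> k))" "distinct (ob (vert B (\<phi> k)))"
      using B by (auto simp: is_odd_graph_def)
    have "inj_on \<phi> (star A v)"
      using bij by (auto simp: bij_betw_def star_def intro: inj_on_subset)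
    then obtain t where "srel (map \<phi> (oa v)) (ob (vert B (\<phi> k))) t"
      using srel_exists[of "map \<phi> (oa v)" "ob (vert B (\<phi> k))"] oa ob graph_iso_star[OF iso k(1)] k
      by (auto simp: distinct_map)
    moreover have "vert B (\<phi> h) = vert B (\<phi> k)" if "h \<in> halves A" "vert A h = v" for h
      using iso that k by (auto simp: graph_iso_def)
    ultimately show ?thesis by metis
  qed auto
  then obtain s where "\<And>v h. h \<in> halves A \<Longrightarrow> vert A h = v \<Longrightarrow> srel (map \<phi> (oa v)) (ob (vert B (\<phi> h))) (s v)"
    by metis
  then show thesis using that oclass_iso[OF A B iso, of s] by blast
qed

lemma lin_ext_gen_diff:
  assumes "vector_space scale"
  shows "lin_ext scale g (gen x - free_scale c (gen y)) = g x - scale c (g y)"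
    and "lin_ext scale g (gen x - gen y) = g x - g y"
    and "lin_ext scale g (gen x) = g x"
proof -
  interpret L: Vector_Spaces.linear free_scale scale "lin_ext scale g"
    by (rule lin_ext_linear[OF assms])
  show "lin_ext scale g (gen x - free_scale c (gen y)) = g x - scale c (g y)"
    "lin_ext scale g (gen x - gen y) = g x - g y" "lin_ext scale g (gen x) = g x"
    by (simp_all add: L.diff L.scale lin_ext_single[OF assms])
qed

lemma vector_space_rat: "vector_space ((*) :: rat \<Rightarrow> rat \<Rightarrow> rat)"
  by unfold_locales (auto simp: algebra_simps)

section \<open>The projection onto the span of one graph\<close>

definition is_projection :: "odd_graph \<Rightarrow> (cG \<Rightarrow> rat) \<Rightarrow> bool" where
  "is_projection \<Theta> \<pi> \<longleftrightarrow> Vector_Spaces.linear cscale (*) \<pi> \<and> \<pi> (cclass \<Theta>) = 1 \<and>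
     (\<forall>\<Gamma>. (\<nexists>\<phi>. graph_iso \<phi> (ograph \<Gamma>) (ograph \<Theta>)) \<longrightarrow> \<pi> (cclass \<Gamma>) = 0)"

lemma cclass_iso_multiple:
  assumes "graph_iso \<phi> (ograph \<Gamma>) (ograph \<Theta>)"
  obtains e where "cclass \<Gamma> = cscale e (cclass \<Theta>)"
proof -
  have G: "is_graph (ograph \<Gamma>)" by (rule is_graph_ograph)
  show thesis
  proof (rule oclass_iso_multiple[OF is_odd_graph_Rep is_odd_graph_Rep graph_iso_sym[OF assms G]])
    fix e assume "oclass (ograph \<Gamma>, ordering \<Gamma>) = cscale e (oclass (ograph \<Theta>, ordering \<Theta>))"
    then show thesis by (intro that[of e]) (simp add: oclass_Rep)
  qed
qed

lemma is_projection_unique: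
  assumes "is_projection \<Theta> \<pi>" "is_projection \<Theta> \<pi>'"
  shows "\<pi> = \<pi>'"
proof (rule cG_linear_unique[OF vector_space_rat])
  show L: "Vector_Spaces.linear cscale (*) \<pi>" "Vector_Spaces.linear cscale (*) \<pi>'"
    using assms by (auto simp: is_projection_def)
  fix \<Gamma>
  interpret L: Vector_Spaces.linear cscale "(*)" \<pi> by fact
  interpret L': Vector_Spaces.linear cscale "(*)" \<pi>' by fact
  show "\<pi> (cclass \<Gamma>) = \<pi>' (cclass \<Gamma>)"
  proof (cases "\<exists>\<phi>. graph_iso \<phi> (ograph \<Gamma>) (ograph \<Theta>)")
    case True
    then obtain e where "cclass \<Gamma> = cscale e (cclass \<Theta>)" using cclass_iso_multiple by blast
    then show ?thesis using assms by (simp add: L.scale L'.scale is_projection_def)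
  qed (use assms in \<open>auto simp: is_projection_def\<close>)
qed

text \<open>The coefficient \<open>f\<close> is read off from an equation in \<open>cG\<close>
  itself. As \<open>cclass \<Theta>\<close> is not 0, this coefficient is unique, so every equation
  between classes passes to \<open>f\<close>; and no relation mixes graphs isomorphic to
  \<open>\<Theta>\<close> with others, for which \<open>f\<close> is set to 0.\<close>

lemma is_projection_projection:
  assumes "cclass \<Theta> \<noteq> 0"
  shows "is_projection \<Theta> (projection \<Theta>)"
proof -
  define P where "P \<Gamma> \<longleftrightarrow> (\<exists>\<phi>. graph_iso \<phi> (ograph \<Gamma>) (ograph \<Theta>))" for \<Gamma>
  define f where "f \<Gamma> = (if P \<Gamma> then SOME e. cclass \<Gamma> = cscale e (cclass \<Theta>) else 0)" for \<Gamma>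
  have f: "cclass \<Gamma> = cscale (f \<Gamma>) (cclass \<Theta>)" if "P \<Gamma>" for \<Gamma>
  proof -
    obtain \<phi> where "graph_iso \<phi> (ograph \<Gamma>) (ograph \<Theta>)" using \<open>P \<Gamma>\<close> unfolding P_def by blast
    then have "\<exists>e. cclass \<Gamma> = cscale e (cclass \<Theta>)" by (blast elim: cclass_iso_multiple)
    from someI_ex[OF this] show ?thesis using \<open>P \<Gamma>\<close> by (simp only: f_def if_True)
  qed
  have f_eq: "f \<Gamma> = e" if "P \<Gamma>" "cclass \<Gamma> = cscale e (cclass \<Theta>)" for \<Gamma> e
    using that(2) f[OF that(1)] assms cG.scale_cancel_right by metis
  have f0: "f \<Gamma> = 0" if "\<not> P \<Gamma>" for \<Gamma> using that by (simp add: f_def)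
  have "lin_ext (*) f r = 0" if r: "r \<in> odd_relations" for r
  proof -
    note [simp] = lin_ext_gen_diff[OF vector_space_rat]
    consider (iso) x y where "r = gen x - gen y" "odd_iso x y"
      | (sign) x y p where "r = gen y - free_scale (of_int (\<Prod>v\<in>verts (ograph x). sign (p v))) (gen x)"
         "ograph y = ograph x" "\<forall>v\<in>verts (ograph x). p v permutes {..<length (ordering x v)} \<and>
           ordering y v = permute_list (p v) (ordering x v)"
      | (sep) x where "r = gen x" "has_separating_edge (ograph x)"
      using r unfolding odd_relations_def by blast
    then show ?thesis
    proof cases
      case iso
      then obtain \<phi> where \<phi>: "graph_iso \<phi> (ograph x) (ograph y)" by (auto simp: odd_iso_def)
      have "is_graph (ograph x)" by (rule is_graph_ograph)
      then have P: "P y \<longleftrightarrow> P x"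
        using \<phi> graph_iso_sym[OF \<phi>] graph_iso_comp unfolding P_def by metis
      have "f x = f y"
      proof (cases "P x")
        case True
        have "cclass y = cscale (f x) (cclass \<Theta>)" using f[OF True] cclass_odd_iso[OF iso(2)] by simp
        then show ?thesis using f_eq[of y "f x"] P True by simp
      qed (simp add: f0 P)
      then show ?thesis by (simp add: iso(1))
    next
      case sign
      have P: "P y \<longleftrightarrow> P x" using sign by (simp add: P_def)
      have "cclass y = cscale (of_int (\<Prod>v\<in>verts (ograph x). sign (p v))) (cclass x)"
        using sign by (intro cclass_reorder) (auto intro: srelI)
      note y = this
      let ?s = "of_int (\<Prod>v\<in>verts (ograph x). sign (p v)) :: rat"
      have "f y = ?s * f x"
      proof (cases "P x")
        case True
        have "cclass y = cscale (?s * f x) (cclass \<Theta>)" using f[OF True] y by (simp only: cG.scale_scale)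
        then show ?thesis using f_eq[of y "?s * f x"] P True by simp
      qed (simp add: f0 P)
      then show ?thesis by (simp add: sign(1))
    next
      case sep
      have "cclass x = 0"
        using oclass_separating[OF is_odd_graph_Rep sep(2)] by (simp add: oclass_Rep)
      then have "f x = 0" using f_eq[of x 0] f0[of x] by (cases "P x") simp_all
      then show ?thesis using sep by simp
    qed
  qed
  then obtain \<pi> where \<pi>: "Vector_Spaces.linear cscale (*) \<pi>" "\<And>x. \<pi> (cclass x) = f x"
    using cG_linear_exists[OF vector_space_rat] by blast
  have "P \<Theta>" unfolding P_def using graph_iso_id by blast
  then have "is_projection \<Theta> \<pi>"
    unfolding is_projection_def using \<pi> f0 f_eq[of \<Theta> 1] by (auto simp: P_def)
  moreover have "projection \<Theta> = (THE \<pi>. is_projection \<Theta> \<pi>)"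
    by (simp add: projection_def is_projection_def)
  ultimately show ?thesis using is_projection_unique theI by metis
qed

section \<open>Cycle systems in cubic graphs\<close>

definition cubic :: "graph \<Rightarrow> bool" where
  "cubic G \<longleftrightarrow> is_graph G \<and> connected_graph G \<and> (\<forall>v\<in>verts G. valence G v = 3)"

text \<open>The conditions of \<open>trace_data\<close> that do not mention the forest. They depend
  on the cycles alone, which makes it possible to move spokes or to change closing edges
  separately.\<close>

definition cyc_sys :: "graph \<Rightarrow> nat list list \<Rightarrow> bool" where
  "cyc_sys G dss \<longleftrightarrow> (\<forall>ds\<in>set dss. closed_path G ds \<and> odd (length ds)) \<and>
     distinct (map (vert G) (concat dss)) \<and> vert G ` set (concat dss) = verts G"

definition path_edges :: "graph \<Rightarrow> nat list list \<Rightarrow> nat set list" where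
  "path_edges G dss = concat (map (\<lambda>ds. map (edge G) (butlast ds)) dss)"

lemma edge_opp: "is_graph G \<Longrightarrow> h \<in> halves G \<Longrightarrow> edge G (opp G h) = edge G h"
  by (auto simp: edge_def is_graph_def)

lemma edge_eq_iff: "is_graph G \<Longrightarrow> h \<in> halves G \<Longrightarrow> edge G h = edge G k \<longleftrightarrow> k = h \<or> k = opp G h"
  by (auto simp: edge_def is_graph_def doubleton_eq_iff)

lemma symp_adjacent: "is_graph G \<Longrightarrow> symp (adjacent G E)"
  unfolding adjacent_def symp_def
  by (metis edge_opp is_graphD(2) is_graphD(4))

text \<open>Cyclic indices treat the closing edge like all others, as rotations and successor
  arguments require.\<close>

lemma closed_path_iff:
  "closed_path G ds \<longleftrightarrow> ds \<noteq> [] \<and> set ds \<subseteq> halves G \<and>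
     (\<forall>j<length ds. vert G (opp G (ds ! j)) = vert G (ds ! (Suc j mod length ds)))"
proof (cases "ds = []")
  case False
  then have n: "length ds > 0" by simp
  have "(\<forall>j<length ds. vert G (opp G (ds ! j)) = vert G (ds ! (Suc j mod length ds))) \<longleftrightarrow>
     (\<forall>j. Suc j < length ds \<longrightarrow> vert G (opp G (ds ! j)) = vert G (ds ! Suc j)) \<and>
     vert G (opp G (last ds)) = vert G (hd ds)" (is "?L \<longleftrightarrow> ?R")
  proof
    assume L: ?L
    have "vert G (opp G (ds ! j)) = vert G (ds ! Suc j)" if "Suc j < length ds" for j
      using L[rule_format, of j] that by simp
    moreover have "vert G (opp G (last ds)) = vert G (hd ds)"
      using L[rule_format, of "length ds - 1"] n False by (simp add: last_conv_nth hd_conv_nth)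
    ultimately show ?R by blast
  next
    assume R: ?R
    show ?L
    proof (intro allI impI)
      fix j assume j: "j < length ds"
      show "vert G (opp G (ds ! j)) = vert G (ds ! (Suc j mod length ds))"
      proof (cases "Suc j < length ds")
        case False
        then have "j = length ds - 1" using j by simp
        then show ?thesis using R n \<open>ds \<noteq> []\<close> by (simp add: last_conv_nth hd_conv_nth)
      qed (use R in simp)
    qed
  qed
  then show ?thesis by (simp add: closed_path_def)
qed (simp add: closed_path_def)

section \<open>Half-edges and vertices of a system of disjoint odd cycles\<close>

locale cycle_system =
  fixes G :: graph and dss :: "nat list list"
  assumes cubic: "cubic G" and cyc: "cyc_sys G dss"
begin

text \<open>The outgoing half-edges: by \<open>vert_D\<close> and \<open>inj_vert_D\<close> there is
  exactly one at every vertex of \<open>G\<close>, so \<open>D\<close> serves as a copy of the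
  vertex set.\<close>

definition D :: "nat set" where "D = set (concat dss)"

definition C :: "nat set" where "C = cycle_halves G dss"

lemma is_graph: "is_graph G"
  using cubic by (simp add: cubic_def)

lemmas graphD = is_graphD[OF is_graph]

lemma closed: "ds \<in> set dss \<Longrightarrow> closed_path G ds"
  and odd_length: "ds \<in> set dss \<Longrightarrow> odd (length ds)"
  using cyc by (auto simp: cyc_sys_def)

lemma nonempty: "ds \<in> set dss \<Longrightarrow> ds \<noteq> []"
  using closed by (auto simp: closed_path_def)

lemma D_I: "ds \<in> set dss \<Longrightarrow> d \<in> set ds \<Longrightarrow> d \<in> D"
  by (auto simp: D_def)

lemma D_nth: "ds \<in> set dss \<Longrightarrow> j < length ds \<Longrightarrow> ds ! j \<in> D"
  by (rule D_I[OF _ nth_mem])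

lemma D_cases:
  assumes "d \<in> D"
  obtains ds where "ds \<in> set dss" "d \<in> set ds"
  using assms by (auto simp: D_def)

lemma D_E:
  assumes "d \<in> D"
  obtains ds j where "ds \<in> set dss" "j < length ds" "d = ds ! j"
  using assms by (auto simp: D_def in_set_conv_nth)

lemma D_halves: "d \<in> D \<Longrightarrow> d \<in> halves G"
  using closed by (auto simp: D_def closed_path_def)

lemma finite_D: "finite D"
  by (simp add: D_def)

lemma vert_D: "vert G ` D = verts G"
  using cyc by (simp add: cyc_sys_def D_def)

lemma vertE:
  assumes "h \<in> halves G"
  obtains d where "d \<in> D" "vert G d = vert G h"
  using assms vert_D by (force simp: verts_def)

lemma inj_vert_D: "inj_on (vert G) D"
  using cyc by (auto simp: cyc_sys_def D_def distinct_map)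

lemma vert_D_eq: "d \<in> D \<Longrightarrow> d' \<in> D \<Longrightarrow> vert G d = vert G d' \<Longrightarrow> d = d'"
  using inj_vert_D by (auto simp: inj_on_def)

lemma distinct_concat: "distinct (concat dss)"
  using cyc by (simp add: cyc_sys_def distinct_map)

lemma distinct_dss: "distinct dss" and distinct_ds: "ds \<in> set dss \<Longrightarrow> distinct ds"
  and disjoint_ds: "ds \<in> set dss \<Longrightarrow> ds' \<in> set dss \<Longrightarrow> d \<in> set ds \<Longrightarrow> d \<in> set ds' \<Longrightarrow> ds = ds'"
proof -
  have "removeAll [] dss = dss" using nonempty by (intro removeAll_id) auto
  then show "distinct dss" "ds \<in> set dss \<Longrightarrow> distinct ds"
    "ds \<in> set dss \<Longrightarrow> ds' \<in> set dss \<Longrightarrow> d \<in> set ds \<Longrightarrow> d \<in> set ds' \<Longrightarrow> ds = ds'"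
    using distinct_concat by (auto simp: distinct_concat_iff)
qed

lemma pos_unique:
  assumes "ds \<in> set dss" "ds' \<in> set dss" "j < length ds" "j' < length ds'"
    "vert G (ds ! j) = vert G (ds' ! j')"
  shows "ds = ds'" "j = j'"
proof -
  have "ds ! j = ds' ! j'" by (rule vert_D_eq[OF D_nth D_nth]) (fact assms)+
  then have "ds ! j \<in> set ds'" using assms(4) by simp
  then show "ds = ds'" by (rule disjoint_ds[OF assms(1,2) nth_mem[OF assms(3)]])
  then have "ds ! j = ds ! j'" "j' < length ds" using \<open>ds ! j = ds' ! j'\<close> assms(4) by simp_all
  then show "j = j'"
    using nth_eq_iff_index_eq[OF distinct_ds[OF assms(1)] assms(3)] by blast
qed

lemma next_vert:
  "ds \<in> set dss \<Longrightarrow> j < length ds \<Longrightarrow> vert G (opp G (ds ! j)) = vert G (ds ! (Suc j mod length ds))"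
  using closed closed_path_iff by blast

lemma prev_exists:
  assumes "ds \<in> set dss" "d \<in> set ds"
  obtains d' where "d' \<in> set ds" "vert G (opp G d') = vert G d"
proof -
  obtain j where j: "j < length ds" "d = ds ! j" using assms(2) by (auto simp: in_set_conv_nth)
  show thesis
  proof (cases j)
    case 0
    then have "vert G (opp G (ds ! (length ds - 1))) = vert G d"
      using next_vert[OF assms(1), of "length ds - 1"] j by simp
    moreover have "ds ! (length ds - 1) \<in> set ds" using j(1) by (intro nth_mem) simp
    ultimately show ?thesis by (rule that[rotated])
  next
    case (Suc k)
    then have "vert G (opp G (ds ! k)) = vert G d" using next_vert[OF assms(1), of k] j by simp
    moreover have "ds ! k \<in> set ds" using j(1) Suc by simp
    ultimately show ?thesis by (rule that[rotated])
  qed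
qed

lemma next_exists:
  assumes "ds \<in> set dss" "d \<in> set ds"
  obtains d' where "d' \<in> set ds" "vert G d' = vert G (opp G d)"
proof -
  obtain j where j: "j < length ds" "d = ds ! j" using assms(2) by (auto simp: in_set_conv_nth)
  then have "Suc j mod length ds < length ds" by (intro mod_less_divisor) auto
  then show thesis using that next_vert[OF assms(1), of j] j nth_mem by metis
qed

text \<open>By counting: every vertex is also entered by the cycle through it, so the map reaches
  all vertices, and \<open>D\<close> is finite with as many elements as there are vertices.\<close>

lemma inj_vert_opp_D: "inj_on (\<lambda>d. vert G (opp G d)) D"
proof (rule eq_card_imp_inj_on[OF finite_D])
  have "vert G ` D \<subseteq> (\<lambda>d. vert G (opp G d)) ` D"
  proof
    fix v assume "v \<in> vert G ` D"
    then obtain ds d where d: "ds \<in> set dss" "d \<in> set ds" "v = vert G d" by (auto elim: D_cases)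
    obtain d' where "d' \<in> set ds" "vert G (opp G d') = vert G d" using prev_exists d by blast
    then show "v \<in> (\<lambda>d. vert G (opp G d)) ` D" using d D_I by force
  qed
  then have "card (vert G ` D) \<le> card ((\<lambda>d. vert G (opp G d)) ` D)"
    by (intro card_mono) (auto simp: finite_D)
  moreover have "card (vert G ` D) = card D" using inj_vert_D by (rule card_image)
  ultimately show "card ((\<lambda>d. vert G (opp G d)) ` D) = card D"
    using card_image_le[OF finite_D, of "\<lambda>d. vert G (opp G d)"] by simp
qed

text \<open>A cycle running back and forth along one edge would have length 2.\<close>

lemma opp_notin_D:
  assumes "d \<in> D" shows "opp G d \<notin> D"
proof
  assume o: "opp G d \<in> D"
  obtain ds j where d: "ds \<in> set dss" "j < length ds" "d = ds ! j" using assms by (rule D_E)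
  let ?n = "length ds"
  let ?j = "Suc j mod ?n"
  have j': "?j < ?n" using d by (intro mod_less_divisor) auto
  have "opp G d = ds ! ?j"
    using next_vert[OF d(1,2)] d(3) by (intro vert_D_eq[OF o D_nth[OF d(1) j']]) simp
  \<comment> \<open>Following the cycle from \<open>opp G d\<close> leads back to the start after
    two steps, so the length can only be 1 or 2.\<close>
  then have "vert G (ds ! (Suc ?j mod ?n)) = vert G (opp G (opp G d))"
    using next_vert[OF d(1) j'] by simp
  also have "\<dots> = vert G (ds ! j)" using graphD D_halves[OF assms] d by simp
  finally have *: "vert G (ds ! (Suc ?j mod ?n)) = vert G (ds ! j)" .
  have "Suc ?j mod ?n < ?n" using d(2) by (intro mod_less_divisor) auto
  from pos_unique(2)[OF d(1) d(1) this d(2) *] have "Suc ?j mod ?n = j" .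
  \<comment> \<open>In a cycle of length 1 the only half-edge would be its own opposite.\<close>
  moreover have "?n \<noteq> 1"
  proof
    assume "?n = 1"
    then have "opp G d = d" using \<open>opp G d = ds ! ?j\<close> d by simp
    then show False using graphD D_halves[OF assms] by simp
  qed
  moreover have "?n \<noteq> 2" using odd_length[OF d(1)] by auto
  ultimately show False using d(2) by (auto simp: mod_Suc split: if_splits)
qed

lemma C_eq: "C = D \<union> opp G ` D"
  by (auto simp: C_def D_def cycle_halves_def edge_def)

lemma C_halves: "C \<subseteq> halves G"
  using D_halves graphD by (auto simp: C_eq)

lemma opp_C_iff: "h \<in> halves G \<Longrightarrow> opp G h \<in> C \<longleftrightarrow> h \<in> C"
  using graphD D_halves by (auto simp: C_eq image_iff) metis+

lemma edge_inj_D: "d \<in> D \<Longrightarrow> d' \<in> D \<Longrightarrow> edge G d = edge G d' \<Longrightarrow> d = d'"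
  using edge_eq_iff[OF is_graph D_halves] opp_notin_D by metis

lemma star_C:
  assumes "d \<in> D"
  obtains d' where "d' \<in> D" "vert G (opp G d') = vert G d" "star G (vert G d) \<inter> C = {d, opp G d'}" "d \<noteq> opp G d'"
proof -
  obtain ds where ds: "ds \<in> set dss" "d \<in> set ds" using assms by (rule D_cases)
  obtain d' where d': "d' \<in> D" "vert G (opp G d') = vert G d" using prev_exists[OF ds] D_I ds by metis
  have "star G (vert G d) \<inter> C = {d, opp G d'}"
  proof
    show "star G (vert G d) \<inter> C \<subseteq> {d, opp G d'}"
    proof
      fix h assume h: "h \<in> star G (vert G d) \<inter> C"
      then consider "h \<in> D" | e where "e \<in> D" "h = opp G e" by (auto simp: C_eq)
      then show "h \<in> {d, opp G d'}"
      proof cases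
        case 1
        then show ?thesis using h vert_D_eq[of h d] assms by (auto simp: star_def)
      next
        case 2
        then have "vert G (opp G e) = vert G (opp G d')" using h d' by (simp add: star_def)
        then have "e = d'" using inj_onD[OF inj_vert_opp_D] 2 d' by blast
        then show ?thesis using 2 by simp
      qed
    qed
    show "{d, opp G d'} \<subseteq> star G (vert G d) \<inter> C"
      using assms d' D_halves graphD by (auto simp: star_def C_eq)
  qed
  moreover have "d \<noteq> opp G d'" using opp_notin_D[OF d'(1)] assms by auto
  ultimately show thesis using that d' by blast
qed

lemma star_Diff_C:
  assumes "d \<in> D"
  obtains h where "star G (vert G d) - C = {h}"
proof -
  obtain d' where d': "star G (vert G d) \<inter> C = {d, opp G d'}" "d \<noteq> opp G d'"
    using star_C[OF assms] by metis
  have "card (star G (vert G d)) = 3"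
    using cubic assms vert_D by (auto simp: cubic_def valence_def)
  moreover have "finite (star G (vert G d))" using graphD by (simp add: star_def)
  ultimately have "card (star G (vert G d) - C) = 1"
    using d' by (simp add: card_Diff_subset_Int)
  then show thesis using that by (auto simp: card_1_singleton_iff)
qed

text \<open>The cycle through a vertex uses two of its three half-edges, so the description in
  \<open>spoke\<close> is met by exactly one half-edge.\<close>

lemma spoke: 
  assumes "d \<in> D"
  shows "spoke G dss d \<in> halves G" "vert G (spoke G dss d) = vert G d" "spoke G dss d \<notin> C"
    and spoke_eq: "h \<in> halves G \<Longrightarrow> h \<notin> C \<Longrightarrow> vert G h = vert G d \<Longrightarrow> spoke G dss d = h"
proof -
  obtain k where k: "star G (vert G d) - C = {k}" using star_Diff_C[OF assms] .
  then have s: "spoke G dss d = k" unfolding spoke_def C_def[symmetric] by simp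
  have "k \<in> star G (vert G d) - C" using k by auto
  then show "spoke G dss d \<in> halves G" "vert G (spoke G dss d) = vert G d" "spoke G dss d \<notin> C"
    by (auto simp: s star_def)
  show "spoke G dss d = h" if "h \<in> halves G" "h \<notin> C" "vert G h = vert G d"
  proof -
    have "h \<in> star G (vert G d) - C" using that by (simp add: star_def)
    then show ?thesis using k s by simp
  qed
qed

text \<open>Exactly two of the three half-edges at a vertex lie on cycles. In this form it decides,
  at an end of a forest edge, which of the other two half-edges continues the cycle.\<close>

lemma star_cases:
  assumes "h \<in> halves G" "k \<in> halves G" "l \<in> halves G" "vert G k = vert G h" "vert G l = vert G h"
    "h \<noteq> k" "h \<noteq> l" "k \<noteq> l" "h \<in> C"
  shows "k \<in> C \<longleftrightarrow> l \<notin> C"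
proof -
  obtain d where d: "d \<in> D" "vert G d = vert G h" using assms(1) by (rule vertE)
  obtain d' where d': "star G (vert G d) \<inter> C = {d, opp G d'}" using star_C[OF d(1)] by metis
  obtain m where m: "star G (vert G d) - C = {m}" using star_Diff_C[OF d(1)] .
  have S: "h \<in> star G (vert G d)" "k \<in> star G (vert G d)" "l \<in> star G (vert G d)"
    using assms d by (auto simp: star_def)
  have two: "x = d \<or> x = opp G d'" if "x \<in> star G (vert G d)" "x \<in> C" for x using that d' by blast
  have one: "x = m" if "x \<in> star G (vert G d)" "x \<notin> C" for x using that m by blast
  show ?thesis
  proof
    assume "k \<in> C"
    show "l \<notin> C"
    proof
      assume "l \<in> C"
      then show False using two[OF S(1) assms(9)] two[OF S(2) \<open>k \<in> C\<close>] two[OF S(3)] assms(6-8) by auto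
    qed
  next
    assume "l \<notin> C"
    then show "k \<in> C" using one[OF S(2)] one[OF S(3)] assms(8) by auto
  qed
qed

section \<open>The collapsed graph, its connectedness and its separating edges\<close>

definition idx :: "nat \<Rightarrow> nat" where
  "idx u = (THE i. i < length dss \<and> u \<in> vert G ` set (dss ! i))"

abbreviation "\<Gamma> \<equiv> fst (collapse G dss)"

lemma collapse_simps [simp]:
  "halves \<Gamma> = halves G - C" "opp \<Gamma> = opp G" "vert \<Gamma> h = idx (vert G h)"
  "snd (collapse G dss) i = map (spoke G dss) (dss ! i)"
  by (auto simp: collapse_def C_def idx_def)

lemma edge_collapse [simp]: "edge \<Gamma> h = edge G h"
  by (simp add: edge_def)

lemma idx_eq:
  assumes "i < length dss" "d \<in> set (dss ! i)"
  shows "idx (vert G d) = i"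
  unfolding idx_def
proof (rule the_equality)
  fix k assume k: "k < length dss \<and> vert G d \<in> vert G ` set (dss ! k)"
  then obtain d' where d': "d' \<in> set (dss ! k)" "vert G d = vert G d'" by auto
  have i: "dss ! i \<in> set dss" and k': "dss ! k \<in> set dss" using assms k by simp_all
  have "d = d'" by (rule vert_D_eq[OF D_I[OF i assms(2)] D_I[OF k' d'(1)] d'(2)])
  then have "dss ! i = dss ! k" using disjoint_ds[OF i k' assms(2)] d'(1) by blast
  then show "k = i" using nth_eq_iff_index_eq[OF distinct_dss] assms(1) k by blast
qed (use assms in auto)

lemma idx_same: "ds \<in> set dss \<Longrightarrow> d \<in> set ds \<Longrightarrow> d' \<in> set ds \<Longrightarrow> idx (vert G d) = idx (vert G d')"
proof -
  assume A: "ds \<in> set dss" "d \<in> set ds" "d' \<in> set ds"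
  then obtain i where "i < length dss" "ds = dss ! i" by (metis in_set_conv_nth)
  then show ?thesis using A idx_eq by metis
qed

lemma idx_lt:
  assumes "v \<in> verts G"
  shows "idx v < length dss" "\<exists>d\<in>set (dss ! idx v). vert G d = v"
proof -
  obtain d where d: "d \<in> D" "vert G d = v" using assms vert_D by force
  then obtain i where i: "i < length dss" "d \<in> set (dss ! i)" by (metis D_cases in_set_conv_nth)
  then show "idx v < length dss" "\<exists>d\<in>set (dss ! idx v). vert G d = v" using idx_eq[OF i] d by auto
qed

lemma idx_C:
  assumes "h \<in> C" shows "idx (vert G h) = idx (vert G (opp G h))"
proof -
  have *: "idx (vert G d) = idx (vert G (opp G d))" if d: "d \<in> D" for d
  proof -
    obtain ds where ds: "ds \<in> set dss" "d \<in> set ds" using d by (rule D_cases)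
    obtain d' where "d' \<in> set ds" "vert G d' = vert G (opp G d)" using next_exists[OF ds] .
    then show ?thesis using idx_same[OF ds] by metis
  qed
  show ?thesis using assms * graphD(4) D_halves by (auto simp: C_eq)
qed

lemma star_Gamma:
  assumes "i < length dss"
  shows "star \<Gamma> i = spoke G dss ` set (dss ! i)"
proof
  show "star \<Gamma> i \<subseteq> spoke G dss ` set (dss ! i)"
  proof
    fix h assume "h \<in> star \<Gamma> i"
    then have h: "h \<in> halves G" "h \<notin> C" "idx (vert G h) = i" by (auto simp: star_def)
    then obtain d where d: "d \<in> set (dss ! i)" "vert G d = vert G h"
      using idx_lt(2)[of "vert G h"] by (auto simp: verts_def)
    moreover have "d \<in> D" using d(1) assms by (intro D_I[of "dss ! i"]) auto
    ultimately have "spoke G dss d = h" using h by (intro spoke_eq) auto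
    then show "h \<in> spoke G dss ` set (dss ! i)" using d by auto
  qed
  show "spoke G dss ` set (dss ! i) \<subseteq> star \<Gamma> i"
  proof
    fix h assume "h \<in> spoke G dss ` set (dss ! i)"
    then obtain d where d: "d \<in> set (dss ! i)" "h = spoke G dss d" by auto
    have "d \<in> D" using d assms by (intro D_I[of "dss ! i"]) auto
    then show "h \<in> star \<Gamma> i"
      unfolding d(2) using spoke(1-3)[of d] idx_eq[OF assms d(1)] by (simp add: star_def)
  qed
qed

lemma verts_Gamma: "verts \<Gamma> = {..<length dss}"
proof
  show "verts \<Gamma> \<subseteq> {..<length dss}" using idx_lt(1) by (auto simp: verts_def)
  show "{..<length dss} \<subseteq> verts \<Gamma>"
  proof
    fix i assume "i \<in> {..<length dss}"
    then have i: "i < length dss" by simp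
    then have "dss ! i \<noteq> []" using nonempty by simp
    then have "star \<Gamma> i \<noteq> {}" using star_Gamma[OF i] by simp
    then show "i \<in> verts \<Gamma>" by (auto simp: star_def verts_def)
  qed
qed

text \<open>A walk in \<open>G\<close> projects to \<open>\<Gamma>\<close>: the steps along cycle
  edges become stationary, all others remain edges.\<close>

lemma connected_collapse:
  assumes "connected_by G E"
  shows "connected_by \<Gamma> (E \<inter> edges \<Gamma>)"
proof -
  have step: "(adjacent \<Gamma> (E \<inter> edges \<Gamma>))\<^sup>*\<^sup>* (idx u) (idx v)" if "adjacent G E u v" for u v
  proof -
    obtain h where h: "h \<in> halves G" "edge G h \<in> E" "vert G h = u" "vert G (opp G h) = v"
      using \<open>adjacent G E u v\<close> by (auto simp: adjacent_def)
    show ?thesis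
    proof (cases "h \<in> C")
      case True
      then show ?thesis using idx_C h by auto
    next
      case False
      have "h \<in> halves \<Gamma>" using False h(1) by simp
      then have "edge \<Gamma> h \<in> edges \<Gamma>" unfolding edges_def by (rule imageI)
      then have "adjacent \<Gamma> (E \<inter> edges \<Gamma>) (idx u) (idx v)"
        unfolding adjacent_def using h False by (intro bexI[of _ h]) auto
      then show ?thesis by blast
    qed
  qed
  have path: "(adjacent \<Gamma> (E \<inter> edges \<Gamma>))\<^sup>*\<^sup>* (idx u) (idx v)" if "(adjacent G E)\<^sup>*\<^sup>* u v" for u v
    using that by induction (auto dest: step)
  show ?thesis
    unfolding connected_by_def
  proof (intro ballI)
    fix i j assume "i \<in> verts \<Gamma>" "j \<in> verts \<Gamma>"
    then obtain h k where "h \<in> halves G" "k \<in> halves G" "i = idx (vert G h)" "j = idx (vert G k)"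
      by (auto simp: verts_def)
    then show "(adjacent \<Gamma> (E \<inter> edges \<Gamma>))\<^sup>*\<^sup>* i j"
      using assms path by (auto simp: connected_by_def verts_def)
  qed
qed

lemma edges_Gamma: "edges \<Gamma> \<subseteq> edges G"
  by (auto simp: edges_def)

text \<open>At the vertex coming from a cycle sit its spokes, one for each of the oddly many
  vertices of the cycle.\<close>

lemma is_odd_graph_collapse: "is_odd_graph (collapse G dss)"
proof -
  have "is_graph \<Gamma>"
    using graphD opp_C_iff by (auto simp: is_graph_def)
  moreover have "connected_graph \<Gamma>"
  proof -
    have "connected_by G (edges G)" "halves G \<noteq> {}"
      using cubic by (auto simp: cubic_def connected_graph_def)
    moreover have "edges G \<inter> edges \<Gamma> = edges \<Gamma>" using edges_Gamma by blast
    moreover have "halves \<Gamma> \<noteq> {}"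
    proof -
      obtain h where "h \<in> halves G" using \<open>halves G \<noteq> {}\<close> by blast
      then obtain d where "d \<in> D" by (rule vertE)
      then show ?thesis using spoke(1,3)[of d] by auto
    qed
    ultimately show ?thesis
      using connected_collapse[of "edges G"] by (simp add: connected_graph_def)
  qed
  moreover have "odd (valence \<Gamma> i) \<and> distinct (snd (collapse G dss) i) \<and>
      set (snd (collapse G dss) i) = star \<Gamma> i" if "i \<in> verts \<Gamma>" for i
  proof -
    have i: "i < length dss" using that verts_Gamma by simp
    have ds: "dss ! i \<in> set dss" using i by simp
    have "inj_on (spoke G dss) (set (dss ! i))"
    proof (rule inj_onI)
      fix d d' assume "d \<in> set (dss ! i)" "d' \<in> set (dss ! i)" "spoke G dss d = spoke G dss d'"
      then show "d = d'" using spoke(2) D_I[OF ds] vert_D_eq by metis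
    qed
    moreover have "distinct (dss ! i)" using distinct_ds[OF ds] .
    ultimately show ?thesis
      using odd_length[OF ds] star_Gamma[OF i]
      by (simp add: valence_def distinct_map card_image distinct_card)
  qed
  ultimately have "is_odd_graph (\<Gamma>, snd (collapse G dss))"
    unfolding is_odd_graph_def prod.case by blast
  then show ?thesis by simp
qed

text \<open>A walk in \<open>\<Gamma>\<close> lifts to \<open>G\<close> as soon as the vertices over
  one vertex of \<open>\<Gamma>\<close> are joined to each other; the first hypothesis provides
  these connecting walks.\<close>

lemma connected_uncollapse:
  assumes ds: "\<And>ds d d'. ds \<in> set dss \<Longrightarrow> d \<in> set ds \<Longrightarrow> d' \<in> set ds \<Longrightarrow>
      (adjacent G E)\<^sup>*\<^sup>* (vert G d) (vert G d')"
    and con: "connected_by \<Gamma> (E \<inter> edges \<Gamma>)"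
  shows "connected_by G E"
proof -
  have same: "(adjacent G E)\<^sup>*\<^sup>* u v" if uv: "u \<in> verts G" "v \<in> verts G" "idx u = idx v" for u v
  proof -
    obtain d d' where "d \<in> set (dss ! idx u)" "vert G d = u" "d' \<in> set (dss ! idx u)" "vert G d' = v"
      using idx_lt(2)[OF uv(1)] idx_lt(2)[OF uv(2)] uv(3) by auto
    then show ?thesis using ds[of "dss ! idx u" d d'] idx_lt(1)[OF uv(1)] by auto
  qed
  have "\<forall>w\<in>verts G. idx w = j \<longrightarrow> (adjacent G E)\<^sup>*\<^sup>* u w"
    if "(adjacent \<Gamma> (E \<inter> edges \<Gamma>))\<^sup>*\<^sup>* i j" "u \<in> verts G" "idx u = i" for i j u
    using that
  proof (induction rule: rtranclp_induct)
    case base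
    then show ?case using same by auto
  next
    case (step j k)
    then obtain h where h: "h \<in> halves G" "edge G h \<in> E" "idx (vert G h) = j" "idx (vert G (opp G h)) = k"
      by (auto simp: adjacent_def)
    have "(adjacent G E)\<^sup>*\<^sup>* u (vert G h)" using step h by (auto simp: verts_def)
    moreover have "adjacent G E (vert G h) (vert G (opp G h))" using h by (auto simp: adjacent_def)
    ultimately have 1: "(adjacent G E)\<^sup>*\<^sup>* u (vert G (opp G h))" by (rule rtranclp.rtrancl_into_rtrancl)
    show ?case
    proof (intro ballI impI)
      fix w assume "w \<in> verts G" "idx w = k"
      then have "(adjacent G E)\<^sup>*\<^sup>* (vert G (opp G h)) w"
        using h graphD(2) by (intro same) (auto simp: verts_def)
      with 1 show "(adjacent G E)\<^sup>*\<^sup>* u w" by (rule rtranclp_trans)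
    qed
  qed
  moreover have "idx u \<in> verts \<Gamma>" if "u \<in> verts G" for u
    using idx_lt(1)[OF that] verts_Gamma by simp
  ultimately show ?thesis using con unfolding connected_by_def by blast
qed

text \<open>A cycle without one of its edges is still a path through all its vertices. The walks
  start just behind the removed edge.\<close>

lemma cycle_connected:
  assumes ds: "ds \<in> set dss" and "d \<in> set ds" "d' \<in> set ds"
  shows "(adjacent G (edges G - {e}))\<^sup>*\<^sup>* (vert G d) (vert G d')"
proof -
  let ?R = "(adjacent G (edges G - {e}))\<^sup>*\<^sup>*" and ?n = "length ds"
  have n: "?n > 0" using nonempty[OF ds] by simp
  \<comment> \<open>\<open>k\<close> is the position of the removed edge, or an arbitrary position
    if that edge is not on this cycle.\<close>
  obtain k where k: "k < ?n" "\<And>j. j < ?n \<Longrightarrow> j \<noteq> k \<Longrightarrow> edge G (ds ! j) \<noteq> e"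
  proof (cases "\<exists>k<?n. edge G (ds ! k) = e")
    case True
    then obtain k where k: "k < ?n" "edge G (ds ! k) = e" by blast
    have "edge G (ds ! j) \<noteq> e" if "j < ?n" "j \<noteq> k" for j
    proof
      assume "edge G (ds ! j) = e"
      then have "ds ! j = ds ! k" using k(2) by (intro edge_inj_D[OF D_nth[OF ds that(1)] D_nth[OF ds k(1)]]) simp
      then show False using that k distinct_ds[OF ds] by (simp add: nth_eq_iff_index_eq)
    qed
    then show ?thesis using that k by blast
  qed (use that n in blast)
  have fwd: "?R (vert G (ds ! (Suc k mod ?n))) (vert G (ds ! ((Suc k + m) mod ?n)))" if "m < ?n" for m
    using that
  proof (induction m)
    case (Suc m)
    let ?j = "(Suc k + m) mod ?n"
    have j: "?j < ?n" using n by (intro mod_less_divisor)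
    \<comment> \<open>Fewer than \<open>?n\<close> forward steps are made from \<open>Suc k\<close>,
      so the edge at position \<open>k\<close> is never crossed.\<close>
    have "?j \<noteq> k"
    proof (cases "Suc k + m < ?n")
      case False
      then have "?j = Suc k + m - ?n" using Suc.prems k(1) by (simp add: mod_if)
      then show ?thesis using Suc.prems False by linarith
    qed simp
    moreover have "ds ! ?j \<in> halves G" using j ds D_halves D_I by auto
    ultimately have "adjacent G (edges G - {e}) (vert G (ds ! ?j)) (vert G (opp G (ds ! ?j)))"
      using k(2)[OF j] by (auto simp: adjacent_def edges_def)
    moreover have "vert G (opp G (ds ! ?j)) = vert G (ds ! ((Suc k + Suc m) mod ?n))"
      using next_vert[OF ds j] by (simp add: mod_Suc_eq)
    ultimately show ?case using Suc by (auto intro: rtranclp.rtrancl_into_rtrancl)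
  qed simp
  have base: "?R (vert G (ds ! (Suc k mod ?n))) (vert G c)" if c: "c \<in> set ds" for c
  proof -
    obtain j where j: "j < ?n" "c = ds ! j" using c by (auto simp: in_set_conv_nth)
    obtain m where m: "m < ?n" "(Suc k + m) mod ?n = j"
    proof (cases "Suc k \<le> j")
      case True
      show ?thesis by (rule that[of "j - Suc k"]) (use j True in auto)
    next
      case False
      have "Suc k + (j + ?n - Suc k) = j + ?n" using k(1) by simp
      then have "(Suc k + (j + ?n - Suc k)) mod ?n = j"
        using j(1) by (simp only: mod_add_self2 mod_less)
      moreover have "j + ?n - Suc k < ?n" using False k(1) by simp
      ultimately show ?thesis by (rule that[rotated])
    qed
    then show ?thesis using fwd[OF m(1)] j by simp
  qed
  have "?R (vert G d) (vert G (ds ! (Suc k mod ?n)))"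
    using base[OF assms(2)] symp_rtranclp[OF symp_adjacent[OF is_graph]] by (blast dest: sympD)
  then show ?thesis using base[OF assms(3)] by (rule rtranclp_trans)
qed

text \<open>A cycle edge never separates, so a separating edge survives the collapse, and lifting
  walks shows that it still separates. This makes the trace vanish on graphs with a separating
  edge.\<close>

lemma separating_collapse:
  assumes "has_separating_edge G"
  shows "has_separating_edge \<Gamma>"
proof -
  obtain e where e: "e \<in> edges G" "\<not> connected_by G (edges G - {e})"
    using assms by (auto simp: has_separating_edge_def)
  then have 1: "\<not> connected_by \<Gamma> ((edges G - {e}) \<inter> edges \<Gamma>)"
    using connected_uncollapse[of "edges G - {e}"] cycle_connected by blast
  have eq: "(edges G - {e}) \<inter> edges \<Gamma> = edges \<Gamma> - {e}" using edges_Gamma by blast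
  have "connected_by \<Gamma> (edges \<Gamma>)"
    using is_odd_graph_collapse by (auto simp: is_odd_graph_def connected_graph_def split: prod.splits)
  then have "e \<in> edges \<Gamma>" using 1 eq by (metis Diff_empty Diff_insert0)
  then show ?thesis using 1 eq by (auto simp: has_separating_edge_def)
qed

section \<open>The paths, that is the cycles without their closing edges, form a forest\<close>

lemma path_edgesE:
  assumes "f \<in> set (path_edges G dss)"
  obtains ds j where "ds \<in> set dss" "Suc j < length ds" "f = edge G (ds ! j)"
    "vert G (opp G (ds ! j)) = vert G (ds ! Suc j)"
proof -
  obtain ds d where d: "ds \<in> set dss" "d \<in> set (butlast ds)" "f = edge G d"
    using assms by (auto simp: path_edges_def)
  then obtain j where j: "j < length (butlast ds)" "d = butlast ds ! j" by (auto simp: in_set_conv_nth)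
  then have "Suc j < length ds" "d = ds ! j" by (auto simp: nth_butlast)
  then show thesis using that d next_vert[OF d(1), of j] by simp
qed

lemma path_edges_C: "f \<in> set (path_edges G dss) \<Longrightarrow> f \<subseteq> C"
  using D_nth by (force simp: edge_def C_eq elim!: path_edgesE)

text \<open>In a closed walk in the paths, both edges at a vertex occupying the latest position on its path
  must be the path edge that ends there.\<close>

lemma acyclic_path_edges: "acyclic_edges G (set (path_edges G dss))"
  unfolding acyclic_edges_def
proof
  let ?F = "set (path_edges G dss)"
  assume "\<exists>hs. hs \<noteq> [] \<and> set hs \<subseteq> halves G \<and> distinct (map (edge G) hs) \<and> edge G ` set hs \<subseteq> ?F \<and>
      (\<forall>i<length hs. vert G (opp G (hs ! i)) = vert G (hs ! (Suc i mod length hs)))"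
  then obtain hs where hs: "hs \<noteq> []" "set hs \<subseteq> halves G" "distinct (map (edge G) hs)" "edge G ` set hs \<subseteq> ?F"
    and walk: "\<And>i. i < length hs \<Longrightarrow> vert G (opp G (hs ! i)) = vert G (hs ! (Suc i mod length hs))"
    by blast
  \<comment> \<open>The position of a vertex on its path.\<close>
  define rk where "rk u = (THE j. \<exists>ds\<in>set dss. j < length ds \<and> vert G (ds ! j) = u)" for u
  have rk: "rk (vert G (ds ! j)) = j" if "ds \<in> set dss" "j < length ds" for ds j
    unfolding rk_def using that pos_unique by (intro the_equality) blast+
  have key: "\<exists>ds\<in>set dss. \<exists>j. Suc j < length ds \<and> vert G (ds ! Suc j) = vert G h \<and> edge G h = edge G (ds ! j)"
    if h: "h \<in> halves G" "edge G h \<in> ?F" "rk (vert G (opp G h)) \<le> rk (vert G h)" for h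
  proof -
    obtain ds j where ds: "ds \<in> set dss" "Suc j < length ds" "edge G h = edge G (ds ! j)"
      "vert G (opp G (ds ! j)) = vert G (ds ! Suc j)"
      using h(2) by (rule path_edgesE)
    have "ds ! j = h \<or> ds ! j = opp G h" using ds(3) edge_eq_iff[OF is_graph h(1)] by blast
    then show ?thesis
    proof
      assume "ds ! j = h"
      then have False using h(3) ds rk[OF ds(1), of j] rk[OF ds(1), of "Suc j"] by simp
      then show ?thesis ..
    next
      assume "ds ! j = opp G h"
      then have "vert G (ds ! Suc j) = vert G h" using ds(4) graphD h(1) by simp
      then show ?thesis using ds by blast
    qed
  qed
  define n where "n = length hs"
  have n: "n > 0" using hs by (simp add: n_def)
  \<comment> \<open>At a latest position both the step of the walk that arrives and the step that
    departs have their other end at a position no later, so \<open>key\<close> applies to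
    both.\<close>
  obtain i where i: "i < n" "\<And>k. k < n \<Longrightarrow> rk (vert G (hs ! k)) \<le> rk (vert G (hs ! i))"
  proof -
    let ?S = "(\<lambda>k. rk (vert G (hs ! k))) ` {..<n}"
    have "Max ?S \<in> ?S" using n by (intro Max_in) auto
    then obtain i where "i < n" "rk (vert G (hs ! i)) = Max ?S" by auto
    then show thesis using that[of i] by simp
  qed
  define p where "p = (if i = 0 then n - 1 else i - 1)"
  have p: "p < n" "Suc p mod n = i" using i n by (auto simp: p_def)
  have in_h: "hs ! k \<in> halves G" "edge G (hs ! k) \<in> ?F" if "k < n" for k
    using hs that by (auto simp: n_def)
  have vp: "vert G (opp G (hs ! p)) = vert G (hs ! i)" using walk[of p] p by (simp add: n_def)
  have vi: "rk (vert G (opp G (hs ! i))) \<le> rk (vert G (hs ! i))"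
    using walk[of i] i n by (simp add: n_def)
  have opp: "edge G (opp G (hs ! p)) = edge G (hs ! p)" "opp G (hs ! p) \<in> halves G"
    "opp G (opp G (hs ! p)) = hs ! p"
    using edge_opp[OF is_graph] graphD in_h(1)[OF p(1)] by auto
  obtain ds j where A: "ds \<in> set dss" "Suc j < length ds" "vert G (ds ! Suc j) = vert G (hs ! i)"
      "edge G (hs ! i) = edge G (ds ! j)"
    using key[OF in_h[OF i(1)] vi] by blast
  obtain ds' j' where B: "ds' \<in> set dss" "Suc j' < length ds'" "vert G (ds' ! Suc j') = vert G (hs ! i)"
      "edge G (hs ! p) = edge G (ds' ! j')"
    using key[of "opp G (hs ! p)"] opp in_h[OF p(1)] i(2)[OF p(1)] vp by auto
  have "ds = ds'" "Suc j = Suc j'" using pos_unique[OF A(1) B(1) A(2) B(2)] A(3) B(3) by auto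
  then have "edge G (hs ! i) = edge G (hs ! p)" using A B by simp
  \<comment> \<open>As the edges of the walk are distinct, it has length 1 and is a loop; but a path
    edge joins two different positions.\<close>
  then have "i = p" using nth_eq_iff_index_eq[OF hs(3), of i p] i(1) p(1) by (simp add: n_def)
  then have "vert G (opp G (hs ! i)) = vert G (hs ! i)" using vp by simp
  moreover have "hs ! i = ds ! j \<or> hs ! i = opp G (ds ! j)"
    using A(4) edge_eq_iff[OF is_graph D_halves[OF D_I[OF A(1)]], of "ds ! j" "hs ! i"] A(2) by auto
  moreover have "opp G (opp G (ds ! j)) = ds ! j"
    using graphD(4) D_halves D_I[OF A(1)] A(2) by simp
  ultimately have "vert G (opp G (ds ! j)) = vert G (ds ! j)" by auto
  then have "vert G (ds ! Suc j) = vert G (ds ! j)" using next_vert[OF A(1), of j] A(2) by simp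
  then show False using pos_unique(2)[OF A(1) A(1) A(2), of j] A(2) by simp
qed

lemma distinct_path_edges: "distinct (path_edges G dss)"
proof -
  have "inj_on (edge G) D" using edge_inj_D by (rule inj_onI)
  then have "distinct (map (edge G) (concat dss))"
    using distinct_concat by (simp add: distinct_map D_def)
  moreover have "path_edges G dss = map (edge G) (concat (map butlast dss))"
    by (simp add: path_edges_def map_concat comp_def)
  moreover have "distinct (concat (map butlast dss))" "set (concat (map butlast dss)) \<subseteq> D"
  proof -
    have "set (concat (map butlast dss)) \<subseteq> set (concat dss) \<and> (distinct (concat dss) \<longrightarrow> distinct (concat (map butlast dss)))" for dss :: "nat list list"
      by (induction dss) (auto dest: in_set_butlastD simp: distinct_butlast)
    then show "distinct (concat (map butlast dss))" "set (concat (map butlast dss)) \<subseteq> D"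
      using distinct_concat by (auto simp: D_def)
  qed
  ultimately show ?thesis
    using \<open>inj_on (edge G) D\<close> by (auto simp: distinct_map intro: inj_on_subset)
qed

lemma path_edges_edges: "set (path_edges G dss) \<subseteq> edges G"
proof
  fix f assume "f \<in> set (path_edges G dss)"
  then obtain ds j where "ds \<in> set dss" "Suc j < length ds" "f = edge G (ds ! j)" by (rule path_edgesE)
  then show "f \<in> edges G" using D_halves D_I by (auto simp: edges_def)
qed

end

section \<open>The value of the trace on a cycle system\<close>

text \<open>Keeps only the sign of the permutation in \<open>trace_data\<close>, on which alone the
  value depends, and thereby makes the calculus of \<open>srel\<close> applicable.\<close>

definition forest_data :: "graph \<Rightarrow> nat set list \<Rightarrow> nat list list \<Rightarrow> int \<Rightarrow> bool" where
  "forest_data G es dss s \<longleftrightarrow> cyc_sys G dss \<and> (\<forall>ds\<in>set dss. edge G (last ds) \<notin> set es) \<and>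
     srel es (path_edges G dss) s"

definition trace_value :: "graph \<Rightarrow> nat list list \<Rightarrow> int \<Rightarrow> cG" where
  "trace_value G dss s = cscale (of_int s * (-2) ^ length dss) (oclass (collapse G dss))"

definition has_value :: "graph \<Rightarrow> nat set list \<Rightarrow> nat set \<Rightarrow> cG \<Rightarrow> bool" where
  "has_value G es C v \<longleftrightarrow>
     (\<exists>dss s. forest_data G es dss s \<and> cycle_halves G dss = C \<and> v = trace_value G dss s)"

lemma forest_data_cycle_system: "cubic G \<Longrightarrow> forest_data G es dss s \<Longrightarrow> cycle_system G dss"
  by (simp add: cycle_system_def forest_data_def)

lemma forest_data_set: "forest_data G es dss s \<Longrightarrow> set es = set (path_edges G dss)"
  by (auto simp: forest_data_def dest: srel_set)

lemma forest_data_distinct: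
  assumes "cubic G" "forest_data G es dss s"
  shows "distinct es"
proof -
  interpret cycle_system G dss using assms by (rule forest_data_cycle_system)
  show ?thesis using assms distinct_path_edges srel_distinct by (auto simp: forest_data_def)
qed

lemma has_value_reorder:
  assumes "has_value G es C v" "srel es es' t"
  shows "has_value G es' C (cscale (of_int t) v)"
proof -
  obtain dss s where d: "forest_data G es dss s" "cycle_halves G dss = C" "v = trace_value G dss s"
    using assms(1) by (auto simp: has_value_def)
  have "forest_data G es' dss (t * s)"
    using d(1) srel_trans[OF srel_sym[OF assms(2)]] srel_set[OF assms(2)] by (auto simp: forest_data_def)
  moreover have "cscale (of_int t) v = trace_value G dss (t * s)"
    by (simp add: d(3) trace_value_def mult.assoc)
  ultimately show ?thesis using d(2) unfolding has_value_def by blast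
qed

text \<open>The next half-edge when walking along a cycle: cross the edge, then leave by the other
  half-edge of \<open>C\<close> at the new vertex. It depends on the system only through
  \<open>C\<close>, so two systems with the same \<open>C\<close> are followed by the same
  map.\<close>

definition nxt :: "graph \<Rightarrow> nat set \<Rightarrow> nat \<Rightarrow> nat" where
  "nxt G C d = (THE k. k \<in> C \<and> vert G k = vert G (opp G d) \<and> k \<noteq> opp G d)"

text \<open>The tree walked in the other direction. The edges of the tree come in reverse order
  through their other halves, while the closing edge stays last.\<close>

definition revp :: "graph \<Rightarrow> nat list \<Rightarrow> nat list" where
  "revp G ds = rev (map (opp G) (butlast ds)) @ [opp G (last ds)]"

text \<open>Both lists are the orbit of \<open>x\<close> under \<open>N\<close> up to the first
  return to \<open>x\<close>: a longer list would meet \<open>x\<close> before its end and repeat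
  it.\<close>

lemma iterate_list_unique:
  assumes L: "\<And>j. j < length L \<Longrightarrow> L ! j = (N ^^ Suc j) x" "distinct L" "L \<noteq> []" "last L = x"
    and M: "\<And>j. j < length M \<Longrightarrow> M ! j = (N ^^ Suc j) x" "distinct M" "M \<noteq> []" "last M = x"
  shows "L = M"
proof -
  have le: "length M \<le> length L"
    if L: "\<And>j. j < length L \<Longrightarrow> L ! j = (N ^^ Suc j) x" "L \<noteq> []" "last L = x"
      and M: "\<And>j. j < length M \<Longrightarrow> M ! j = (N ^^ Suc j) x" "distinct M" "M \<noteq> []" "last M = x"
    for L M :: "'a list"
  proof (rule ccontr)
    assume "\<not> length M \<le> length L"
    then have lt: "length L < length M" by simp
    have n: "length L - 1 < length L" using L(2) by simp
    have "L ! (length L - 1) = x" using L(2,3) by (simp add: last_conv_nth)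
    then have "(N ^^ Suc (length L - 1)) x = x" by (rule trans[OF sym[OF L(1)[OF n]]])
    then have "M ! (length L - 1) = x" using M(1)[of "length L - 1"] lt n by simp
    also have "x = M ! (length M - 1)" using M(3,4) by (simp add: last_conv_nth)
    finally have "length L - 1 = length M - 1"
      using nth_eq_iff_index_eq[OF M(2), of "length L - 1" "length M - 1"] lt n by simp
    then show False using lt n by linarith
  qed
  have "length L = length M" using le[OF L(1,3,4) M] le[OF M(1,3,4) L] by simp
  then show ?thesis using L(1) M(1) by (intro nth_equalityI) auto
qed

lemma revp_nth:
  assumes "Suc j < length ds"
  shows "revp G ds ! j = opp G (ds ! (length ds - 2 - j))"
proof -
  have j: "j < length (butlast ds)" using assms by simp
  have "length (butlast ds) - Suc j = length ds - 2 - j" "length ds - 2 - j < length (butlast ds)"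
    using assms by simp_all
  then show ?thesis using j by (simp add: revp_def nth_append rev_nth nth_butlast del: length_butlast)
qed

text \<open>After reversal each vertex is left through the edge by which it was entered before. The
  half-edge list is therefore not a plain reversal, but the list of vertices is.\<close>

lemma closed_path_map_vert_revp:
  assumes "closed_path G ds"
  shows "map (vert G) (revp G ds) = rev (map (vert G) ds)"
proof -
  have ne: "ds \<noteq> []" using assms by (simp add: closed_path_def)
  have "map (\<lambda>d. vert G (opp G d)) (butlast ds) = map (vert G) (tl ds)"
    using assms by (intro nth_equalityI) (auto simp: closed_path_def nth_butlast nth_tl)
  then have "map (vert G) (map (opp G) (butlast ds)) = map (vert G) (tl ds)" by (simp add: comp_def)
  moreover have "vert G (opp G (last ds)) = vert G (hd ds)" using assms by (simp add: closed_path_def)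
  moreover have "rev (map (vert G) (tl ds)) @ [vert G (hd ds)] = rev (map (vert G) ds)"
    using ne by (cases ds) auto
  ultimately show ?thesis by (simp add: revp_def rev_map[symmetric])
qed

lemma map_edge_butlast_revp:
  assumes "is_graph G" "set ds \<subseteq> halves G"
  shows "map (edge G) (butlast (revp G ds)) = rev (map (edge G) (butlast ds))"
proof -
  have "map (edge G) (map (opp G) (butlast ds)) = map (edge G) (butlast ds)"
    using assms edge_opp in_set_butlastD by fastforce
  then show ?thesis by (simp add: revp_def rev_map[symmetric])
qed

section \<open>The value is determined by the half-edge set of the cycles and vanishes if that set
  is not unique\<close>

context cycle_system begin

lemma nxt_eq:
  assumes "d \<in> C" "k \<in> C" "vert G k = vert G (opp G d)" "k \<noteq> opp G d"
  shows "nxt G C d = k"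
  unfolding nxt_def
proof (rule the_equality)
  fix l assume l: "l \<in> C \<and> vert G l = vert G (opp G d) \<and> l \<noteq> opp G d"
  have o: "opp G d \<in> halves G" "opp G d \<in> C" using assms(1) C_halves opp_C_iff graphD(2) by blast+
  show "l = k"
  proof (rule ccontr)
    assume "l \<noteq> k"
    with star_cases[OF o(1), of l k] show False using l assms o C_halves by auto
  qed
qed (use assms in auto)

lemma nxt_nth:
  assumes "ds \<in> set dss" "j < length ds"
  shows "nxt G C (ds ! j) = ds ! (Suc j mod length ds)"
proof -
  have j: "Suc j mod length ds < length ds" using assms by (intro mod_less_divisor) auto
  have "ds ! (Suc j mod length ds) \<noteq> opp G (ds ! j)"
    using opp_notin_D[OF D_nth[OF assms]] D_nth[OF assms(1) j] by metis
  then show ?thesis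
    using next_vert[OF assms] D_nth[OF assms] D_nth[OF assms(1) j] by (intro nxt_eq) (auto simp: C_eq)
qed

text \<open>The same rule leads backwards when started from the opposite halves, so
  \<open>nxt\<close> keeps whatever direction the first half-edge has.\<close>

lemma nxt_opp_nth:
  assumes "ds \<in> set dss" "j < length ds"
  shows "nxt G C (opp G (ds ! (Suc j mod length ds))) = opp G (ds ! j)"
proof -
  let ?k = "Suc j mod length ds"
  have k: "?k < length ds" using assms by (intro mod_less_divisor) auto
  have oo: "opp G (opp G (ds ! ?k)) = ds ! ?k" using graphD(4) D_halves[OF D_nth[OF assms(1) k]] .
  have "opp G (ds ! j) \<noteq> ds ! ?k"
    using opp_notin_D[OF D_nth[OF assms]] D_nth[OF assms(1) k] by metis
  then show ?thesis
    using next_vert[OF assms] D_nth[OF assms] D_nth[OF assms(1) k]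
    by (intro nxt_eq) (auto simp: C_eq oo)
qed

lemma nxt_iterate:
  assumes ds: "ds \<in> set dss" and j: "j < length ds"
  shows "ds ! j = (nxt G C ^^ Suc j) (last ds)"
  using j
proof (induction j)
  case 0
  then show ?case using nxt_nth[OF ds, of "length ds - 1"] by (simp add: last_conv_nth)
next
  case (Suc j)
  then show ?case using nxt_nth[OF ds, of j] by simp
qed

lemma length_revp: "ds \<in> set dss \<Longrightarrow> length (revp G ds) = length ds"
  using nonempty by (simp add: revp_def)

lemma nxt_iterate_revp:
  assumes ds: "ds \<in> set dss" and j: "j < length ds"
  shows "revp G ds ! j = (nxt G C ^^ Suc j) (last (revp G ds))"
  using j
proof (induction j)
  case 0
  show ?case
  \<comment> \<open>A path with one vertex consists of its closing edge only, so
    \<open>revp_nth\<close> says nothing about it.\<close>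
  proof (cases "length ds = 1")
    case True
    then obtain d where d: "ds = [d]" by (auto simp: length_Suc_conv)
    show ?thesis using nxt_opp_nth[OF ds, of 0] by (simp add: d revp_def)
  next
    case False
    let ?j = "length ds - 2"
    have n: "length ds \<ge> 2" using False 0 by linarith
    then have "revp G ds ! 0 = opp G (ds ! ?j)"
      using revp_nth[of 0 ds G] by simp
    moreover have "Suc ?j mod length ds = length ds - 1" "?j < length ds" using n by auto
    ultimately show ?thesis
      using nxt_opp_nth[OF ds, of ?j] nonempty[OF ds] by (simp add: revp_def last_conv_nth)
  qed
next
  case (Suc j)
  have A: "revp G ds ! j = opp G (ds ! (length ds - 2 - j))" 
    using Suc.prems by (intro revp_nth)
  have step: "nxt G C (revp G ds ! j) = revp G ds ! Suc j"
  proof (cases "Suc (Suc j) < length ds")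
    case True
    let ?k = "length ds - 2 - Suc j"
    have "revp G ds ! Suc j = opp G (ds ! ?k)"
      using True by (intro revp_nth)
    moreover have "Suc ?k mod length ds = length ds - 2 - j" "?k < length ds" using True by auto
    ultimately show ?thesis using nxt_opp_nth[OF ds, of ?k] A by simp
  next
    case False
    then have n: "length ds = Suc (Suc j)" using Suc.prems by simp
    then have "revp G ds ! Suc j = opp G (ds ! Suc j)"
      using nonempty[OF ds] by (simp add: revp_def nth_append last_conv_nth)
    then show ?thesis using nxt_opp_nth[OF ds, of "Suc j"] A n by simp
  qed
  then show ?case using Suc by simp
qed

lemma distinct_revp:
  assumes ds: "ds \<in> set dss"
  shows "distinct (revp G ds)"
proof -
  have "distinct (map (vert G) ds)"
    using distinct_ds[OF ds] inj_vert_D D_I[OF ds] by (auto simp: distinct_map intro: inj_on_subset)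
  then have "distinct (map (vert G) (revp G ds))"
    by (simp add: closed_path_map_vert_revp[OF closed[OF ds]])
  then show ?thesis by (simp add: distinct_map)
qed

text \<open>An edge of a cycle lies in the forest or closes a path. Hence \<open>C\<close> and the
  forest determine the closing edges.\<close>

lemma closing_edge:
  assumes "forest_data G es dss s" "h \<in> C" "edge G h \<notin> set es"
  obtains ds where "ds \<in> set dss" "edge G (last ds) = edge G h"
proof -
  obtain d where d: "d \<in> D" "edge G d = edge G h"
    using assms(2) edge_opp[OF is_graph] D_halves by (auto simp: C_eq)
  obtain ds where ds: "ds \<in> set dss" "d \<in> set ds" using d(1) by (rule D_cases)
  have "d \<notin> set (butlast ds)"
  proof
    assume "d \<in> set (butlast ds)"
    then have "edge G d \<in> set (path_edges G dss)" using ds by (auto simp: path_edges_def)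
    then show False using assms forest_data_set d by metis
  qed
  moreover have "set ds = set (butlast ds) \<union> {last ds}"
    using append_butlast_last_id[OF nonempty[OF ds(1)]]
    by (metis Un_insert_right list.set(1) list.simps(15) set_append sup_bot.right_neutral)
  ultimately have "d = last ds" using ds(2) by auto
  then show thesis using that ds d by blast
qed

lemma last_C: "ds \<in> set dss \<Longrightarrow> last ds \<in> C"
  using D_I nonempty by (auto simp: C_eq)

lemma last_edge_unique:
  assumes "ds \<in> set dss" "ds' \<in> set dss" "edge G (last ds) = edge G (last ds')"
  shows "ds = ds'"
proof -
  have "last ds \<in> set ds" "last ds' \<in> set ds'" using assms nonempty by auto
  moreover from this have "last ds = last ds'" using assms by (intro edge_inj_D[OF D_I D_I]) auto
  ultimately show ?thesis using disjoint_ds[OF assms(1,2)] by metis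
qed

lemma spoke_cong:
  assumes "cycle_halves G dss' = C" "vert G d = vert G d'"
  shows "spoke G dss' d' = spoke G dss d"
  using assms by (simp add: spoke_def C_def)

text \<open>With \<open>C\<close> fixed the collapsed graph is the same, and a spoke is determined
  by its vertex; so reordering the vertices along a cycle reorders the spokes with the same
  sign.\<close>

lemma oclass_collapse_reorder:
  assumes C': "cycle_system G dss'" "cycle_halves G dss' = C" and len: "length dss' = length dss"
    and s: "\<And>i. i < length dss \<Longrightarrow> srel (map (vert G) (dss ! i)) (map (vert G) (dss' ! i)) (s i)"
  shows "oclass (collapse G dss') = cscale (of_int (\<Prod>i<length dss. s i)) (oclass (collapse G dss))"
proof -
  interpret B: cycle_system G dss' by fact
  have BC: "B.C = C" using C'(2) by (simp add: B.C_def)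
  have sets: "vert G ` set (dss' ! i) = vert G ` set (dss ! i)" if "i < length dss" for i
    using srel_set[OF s[OF that]] by simp
  have idx: "B.idx (vert G h) = idx (vert G h)" if "h \<in> halves G" for h
  proof -
    have v: "vert G h \<in> verts G" using that by (auto simp: verts_def)
    obtain d where d: "d \<in> set (dss ! idx (vert G h))" "vert G d = vert G h" using idx_lt(2)[OF v] by blast
    then obtain d' where d': "d' \<in> set (dss' ! idx (vert G h))" "vert G d' = vert G h"
      using sets[OF idx_lt(1)[OF v]] by (metis image_iff)
    then show ?thesis using B.idx_eq[of "idx (vert G h)" d'] idx_lt(1)[OF v] len by simp
  qed
  \<comment> \<open>The spoke as a function of the vertex, common to both systems; it carries the
    reorderings of vertices over to spokes.\<close>
  define f where "f v = (THE h. h \<in> star G v - C)" for v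
  have f: "spoke G dss = (\<lambda>d. f (vert G d))" "spoke G dss' = (\<lambda>d. f (vert G d))"
    using C'(2) by (simp_all add: spoke_def f_def C_def fun_eq_iff)
  have iso: "graph_iso id \<Gamma> B.\<Gamma>"
    using idx by (auto simp: graph_iso_def BC)
  have "srel (map id (snd (collapse G dss) (vert \<Gamma> h))) (snd (collapse G dss') (vert B.\<Gamma> (id h))) (s (vert \<Gamma> h))"
    if "h \<in> halves \<Gamma>" for h
  proof -
    have h: "h \<in> halves G" using that by simp
    have "idx (vert G h) < length dss" using h by (intro idx_lt(1)) (auto simp: verts_def)
    from srel_map[OF s[OF this], of f] show ?thesis using idx[OF h] by (simp add: f comp_def)
  qed
  from oclass_iso[of "\<Gamma>" "snd (collapse G dss)" "B.\<Gamma>" "snd (collapse G dss')", OF _ _ iso this]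
  show ?thesis
    using is_odd_graph_collapse B.is_odd_graph_collapse verts_Gamma
    by (simp only: prod.collapse)
qed

text \<open>Renumbering the cycles only renames the vertices of the collapsed graph; the ordering at
  each vertex stays the same, so no sign arises.\<close>

lemma oclass_collapse_perm:
  assumes "cycle_system G dss'" "mset dss' = mset dss"
  shows "oclass (collapse G dss') = oclass (collapse G dss)"
proof -
  interpret B: cycle_system G dss' by fact
  have set: "set dss' = set dss" using assms(2) by (rule mset_eq_setD)
  then have CC: "cycle_halves G dss' = C" by (simp add: C_def cycle_halves_def)
  then have BC: "B.C = C" by (simp add: B.C_def)
  have nth: "dss' ! B.idx (vert G h) = dss ! idx (vert G h)" if "h \<in> halves G" for h
  proof -
    have v: "vert G h \<in> verts G" using that by (auto simp: verts_def)
    obtain d where d: "d \<in> set (dss ! idx (vert G h))" "vert G d = vert G h" using idx_lt(2)[OF v] by blast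
    obtain d' where d': "d' \<in> set (dss' ! B.idx (vert G h))" "vert G d' = vert G h" using B.idx_lt(2)[OF v] by blast
    have A: "dss' ! B.idx (vert G h) \<in> set dss" using B.idx_lt(1)[OF v] set nth_mem by blast
    have B: "dss ! idx (vert G h) \<in> set dss" using idx_lt(1)[OF v] by simp
    have "d = d'" using d(2) d'(2) by (intro vert_D_eq[OF D_I[OF B d(1)] D_I[OF A d'(1)]]) simp
    then show ?thesis using disjoint_ds[OF A B d'(1)] d(1) by blast
  qed
  have inj: "idx (vert G h) = idx (vert G k) \<longleftrightarrow> B.idx (vert G h) = B.idx (vert G k)"
    if "h \<in> halves G" "k \<in> halves G" for h k
  proof -
    have v: "vert G h \<in> verts G" "vert G k \<in> verts G" using that by (auto simp: verts_def)
    have "idx (vert G h) = idx (vert G k) \<longleftrightarrow> dss ! idx (vert G h) = dss ! idx (vert G k)"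
      using nth_eq_iff_index_eq[OF distinct_dss idx_lt(1)[OF v(1)] idx_lt(1)[OF v(2)]] by blast
    also have "\<dots> \<longleftrightarrow> dss' ! B.idx (vert G h) = dss' ! B.idx (vert G k)"
      using nth that by simp
    also have "\<dots> \<longleftrightarrow> B.idx (vert G h) = B.idx (vert G k)"
      using nth_eq_iff_index_eq[OF B.distinct_dss B.idx_lt(1)[OF v(1)] B.idx_lt(1)[OF v(2)]] by blast
    finally show ?thesis .
  qed
  have iso: "graph_iso id \<Gamma> B.\<Gamma>"
    using inj by (auto simp: graph_iso_def BC)
  have sp: "spoke G dss' = spoke G dss" using spoke_cong[OF CC] by blast
  have "srel (map id (snd (collapse G dss) (vert \<Gamma> h))) (snd (collapse G dss') (vert B.\<Gamma> (id h))) 1"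
    if "h \<in> halves \<Gamma>" for h
    using that nth[of h] sp by (simp add: srel_refl)
  from oclass_iso[of "\<Gamma>" "snd (collapse G dss)" "B.\<Gamma>" "snd (collapse G dss')" id "\<lambda>_. 1", OF _ _ iso this]
  have "oclass (collapse G dss') = cscale (of_int (\<Prod>v\<in>verts \<Gamma>. 1)) (oclass (collapse G dss))"
    using is_odd_graph_collapse B.is_odd_graph_collapse by (simp only: prod.collapse)
  then show ?thesis by simp
qed

lemma cycle_system_perm:
  assumes "mset dss' = mset dss"
  shows "cycle_system G dss'"
proof -
  have "mset (concat xss) = \<Sum>\<^sub># (image_mset mset (mset xss))" for xss :: "nat list list"
    by (induction xss) auto
  then have "mset (concat dss') = mset (concat dss)" using assms by (simp only:)
  then have "mset (map (vert G) (concat dss')) = mset (map (vert G) (concat dss))" by simp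
  then have "distinct (map (vert G) (concat dss'))"
    using cyc mset_eq_imp_distinct_iff[of "map (vert G) (concat dss')" "map (vert G) (concat dss)"]
    unfolding cyc_sys_def by simp
  moreover have "set dss' = set dss" using assms by (rule mset_eq_setD)
  ultimately have "cyc_sys G dss'" using cyc by (simp add: cyc_sys_def)
  then show ?thesis using cubic by (simp add: cycle_system_def)
qed

text \<open>A path with its closing edge is recovered from the closing edge by following the cycle
  in one of the two directions. Reversing a path of even length changes the ordering of its edges
  and that of its vertices by the same sign.\<close>

lemma trace_value_unique:
  assumes F: "forest_data G es dss s" and F': "forest_data G es dss' s'" and C': "cycle_halves G dss' = C"
  shows "trace_value G dss' s' = trace_value G dss s"
proof -
  interpret B: cycle_system G dss' using cubic F' by (rule forest_data_cycle_system)
  have BC: "B.C = C" using C' by (simp add: B.C_def)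
  have match: "ds' = ds \<or> ds' = revp G ds"
    if ds: "ds \<in> set dss" "ds' \<in> set dss'" "edge G (last ds') = edge G (last ds)" for ds ds'
  proof -
    have h: "last ds \<in> halves G" using last_C[OF ds(1)] C_halves by blast
    then consider "last ds' = last ds" | "last ds' = opp G (last ds)"
      using edge_eq_iff[OF is_graph h] ds(3) by metis
    then show ?thesis
    proof cases
      case 1
      have "ds' = ds"
        using B.nxt_iterate[OF ds(2)] nxt_iterate[OF ds(1)] 1 BC
        by (intro iterate_list_unique[of ds' "nxt G C" "last ds" ds])
          (use nonempty[OF ds(1)] B.nonempty[OF ds(2)] distinct_ds[OF ds(1)] B.distinct_ds[OF ds(2)] in simp_all)
      then show ?thesis ..
    next
      case 2
      then have l: "last (revp G ds) = last ds'" by (simp add: revp_def)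
      have "ds' = revp G ds"
        using B.nxt_iterate[OF ds(2)] nxt_iterate_revp[OF ds(1)] l BC
        by (intro iterate_list_unique[of ds' "nxt G C" "last ds'" "revp G ds"])
          (use B.nonempty[OF ds(2)] distinct_revp[OF ds(1)] B.distinct_ds[OF ds(2)] length_revp[OF ds(1)]
            in \<open>simp_all add: revp_def\<close>)
      then show ?thesis ..
    qed
  qed
  have ex: "\<exists>ds'. ds' \<in> set dss' \<and> edge G (last ds') = edge G (last ds)" if ds: "ds \<in> set dss" for ds
  proof -
    have "last ds \<in> B.C" using last_C[OF ds] BC by simp
    moreover have "edge G (last ds) \<notin> set es" using F ds by (simp add: forest_data_def)
    ultimately obtain ds' where "ds' \<in> set dss'" "edge G (last ds') = edge G (last ds)"
      by (rule B.closing_edge[OF F'])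
    then show ?thesis by blast
  qed
  have ex': "\<exists>ds\<in>set dss. edge G (last ds) = edge G (last ds')" if ds': "ds' \<in> set dss'" for ds'
  proof -
    have "last ds' \<in> C" using B.last_C[OF ds'] BC by simp
    moreover have "edge G (last ds') \<notin> set es" using F' ds' by (simp add: forest_data_def)
    ultimately obtain ds where "ds \<in> set dss" "edge G (last ds) = edge G (last ds')"
      by (rule closing_edge[OF F])
    then show ?thesis by blast
  qed
  \<comment> \<open>Matches every cycle with the cycle of the second system that has the same
    closing edge.\<close>
  define g where "g ds = (SOME ds'. ds' \<in> set dss' \<and> edge G (last ds') = edge G (last ds))" for ds
  have g: "g ds \<in> set dss'" "edge G (last (g ds)) = edge G (last ds)" if "ds \<in> set dss" for ds
    using someI_ex[OF ex[OF that]] by (simp_all only: g_def)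
  have "inj_on g (set dss)"
  proof (rule inj_onI)
    fix ds ds' assume "ds \<in> set dss" "ds' \<in> set dss" "g ds = g ds'"
    then show "ds = ds'" using g(2) last_edge_unique by metis
  qed
  then have dist: "distinct (map g dss)" using distinct_dss by (simp add: distinct_map)
  have "set (map g dss) = set dss'"
  proof
    show "set (map g dss) \<subseteq> set dss'" using g(1) by auto
    show "set dss' \<subseteq> set (map g dss)"
    proof
      fix ds' assume ds': "ds' \<in> set dss'"
      then obtain ds where ds: "ds \<in> set dss" "edge G (last ds) = edge G (last ds')" using ex' by blast
      then have "g ds = ds'" using g[OF ds(1)] by (intro B.last_edge_unique[OF _ ds']) auto
      then show "ds' \<in> set (map g dss)" using ds(1) by force
    qed
  qed
  then have ms: "mset (map g dss) = mset dss'"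
    using dist B.distinct_dss by (simp only: set_eq_iff_mset_eq_distinct)
  let ?E = "map g dss"
  \<comment> \<open>\<open>?E\<close> has the cycles of \<open>dss'\<close> in the order of
    \<open>dss\<close>. It splits the comparison into reversals of single cycles, from
    \<open>dss\<close> to \<open>?E\<close>, and a permutation of whole cycles, from
    \<open>?E\<close> to \<open>dss'\<close>.\<close>
  have sysE: "cycle_system G ?E" using B.cycle_system_perm ms by blast
  have CE: "cycle_halves G ?E = C"
    using mset_eq_setD[OF ms] C' by (simp add: cycle_halves_def)
  define t :: "nat \<Rightarrow> int" where
    "t i = (if g (dss ! i) = dss ! i then 1 else (-1) ^ (length (dss ! i) choose 2))" for i
  have alt: "g (dss ! i) = dss ! i \<or> g (dss ! i) = revp G (dss ! i)" if "i < length dss" for i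
    using match[of "dss ! i" "g (dss ! i)"] g[of "dss ! i"] that by simp
  have t1: "srel (map (vert G) (dss ! i)) (map (vert G) (?E ! i)) (t i)" if i: "i < length dss" for i
  proof (cases "g (dss ! i) = dss ! i")
    case True
    then show ?thesis using i by (simp add: t_def srel_refl)
  next
    case False
    then have "?E ! i = revp G (dss ! i)" using alt[OF i] i by simp
    then have "map (vert G) (?E ! i) = rev (map (vert G) (dss ! i))"
      using closed_path_map_vert_revp closed i by simp
    then show ?thesis
      using False srel_rev[of "map (vert G) (dss ! i)"] by (simp only: t_def if_False length_map)
  qed
  have t2: "srel (map (edge G) (butlast (dss ! i))) (map (edge G) (butlast (?E ! i))) (t i)"
    if i: "i < length dss" for i
  proof (cases "g (dss ! i) = dss ! i")
    case True
    then show ?thesis using i by (simp add: t_def srel_refl)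
  next
    case False
    let ?n = "length (dss ! i)"
    have ds: "dss ! i \<in> set dss" using i by simp
    have "set (dss ! i) \<subseteq> halves G" using D_halves D_I[OF ds] by blast
    have "?E ! i = revp G (dss ! i)" using False alt[OF i] i by simp
    then have "map (edge G) (butlast (?E ! i)) = rev (map (edge G) (butlast (dss ! i)))"
      using map_edge_butlast_revp[OF is_graph \<open>set (dss ! i) \<subseteq> halves G\<close>] by simp
    then have "srel (map (edge G) (butlast (dss ! i))) (map (edge G) (butlast (?E ! i))) ((-1) ^ ((?n - 1) choose 2))"
      using srel_rev[of "map (edge G) (butlast (dss ! i))"] by simp
    moreover have "(-1 :: int) ^ ((?n - 1) choose 2) = (-1) ^ (?n choose 2)"
    proof -
      obtain k where k: "?n = Suc (2 * k)" using odd_length[OF ds] by (auto elim: oddE)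
      then have "?n choose 2 = 2 * k + (?n - 1 choose 2)" by (simp add: numeral_2_eq_2)
      then show ?thesis by (simp add: power_add)
    qed
    ultimately show ?thesis using False by (simp only: t_def if_False)
  qed
  let ?t = "\<Prod>i<length dss. t i"
  have 1: "oclass (collapse G dss') = cscale (of_int ?t) (oclass (collapse G dss))"
  proof -
    have "oclass (collapse G ?E) = oclass (collapse G dss')"
      using B.oclass_collapse_perm[OF sysE ms] .
    moreover have "oclass (collapse G ?E) = cscale (of_int ?t) (oclass (collapse G dss))"
      using t1 by (intro oclass_collapse_reorder[OF sysE CE]) auto
    ultimately show ?thesis by simp
  qed
  have p1: "srel (path_edges G dss) (path_edges G ?E) ?t"
    unfolding path_edges_def using srel_concat[of "map (\<lambda>ds. map (edge G) (butlast ds)) dss"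
        "map (\<lambda>ds. map (edge G) (butlast ds)) ?E" t] t2 by simp
  have p2: "srel (path_edges G ?E) (path_edges G dss') 1"
    unfolding path_edges_def
  proof (rule srel_concat_even_blocks)
    show "mset (map (\<lambda>ds. map (edge G) (butlast ds)) ?E) = mset (map (\<lambda>ds. map (edge G) (butlast ds)) dss')"
      using arg_cong[OF ms, of "image_mset (\<lambda>ds. map (edge G) (butlast ds))"] by (simp only: mset_map)
    fix xs assume "xs \<in> set (map (\<lambda>ds. map (edge G) (butlast ds)) ?E)"
    then obtain ds where "ds \<in> set dss'" "xs = map (edge G) (butlast ds)" using g(1) by auto
    then show "even (length xs)" using B.odd_length by simp
  qed
  have p3: "srel (path_edges G dss) (path_edges G dss') ?t"
    using srel_trans[OF p1 p2] by (simp only: mult_1_right)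
  have "srel es (path_edges G dss) s" using F by (simp add: forest_data_def)
  from srel_trans[OF this p3] have "srel es (path_edges G dss') (s * ?t)" .
  moreover have "srel es (path_edges G dss') s'" using F' by (simp add: forest_data_def)
  \<comment> \<open>The sign of the reversals occurs once in the ordering of the forest and once in
    the orientation of the collapsed graph, so it enters the value as a square.\<close>
  ultimately have s': "s' = s * ?t" using srel_unique forest_data_distinct[OF cubic F] by blast
  have "?t * ?t = 1" using srel_square[OF p3] .
  then have tt: "of_int ?t * of_int ?t = (1 :: rat)" by (metis of_int_1 of_int_mult)
  have "length dss' = length dss" using arg_cong[OF ms, of size] by simp
  then have "trace_value G dss' s' =
      cscale ((of_int s * of_int ?t) * (-2) ^ length dss * of_int ?t) (oclass (collapse G dss))"
    by (simp only: trace_value_def s' 1 of_int_mult cG.scale_scale)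
  also have "(of_int s * of_int ?t) * (-2) ^ length dss * of_int ?t =
      (of_int s * (-2) ^ length dss) * (of_int ?t * of_int ?t :: rat)"
    by (simp only: ac_simps)
  also have "\<dots> = of_int s * (-2) ^ length dss" by (simp only: tt mult_1_right)
  finally show ?thesis by (simp only: trace_value_def)
qed

text \<open>Two half-edges at every vertex. As all systems of \<open>G\<close> thus have equally
  large half-edge sets, different ones are not contained in each other.\<close>

lemma card_C: "card C = 2 * card (verts G)"
proof -
  have "card D = card (verts G)" using card_image[OF inj_vert_D] vert_D by simp
  moreover have "inj_on (opp G) D"
    using graphD(4) D_halves by (metis inj_onI)
  then have "card (opp G ` D) = card D" by (rule card_image)
  moreover have "D \<inter> opp G ` D = {}" using opp_notin_D by auto
  ultimately show ?thesis using finite_D by (simp add: C_eq card_Un_disjoint)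
qed

text \<open>If the closing edges are not unique, another choice of closing edge becomes a loop.\<close>

lemma oclass_collapse_zero:
  assumes F: "forest_data G es dss s" and F': "forest_data G es dss' s'" and C': "cycle_halves G dss' \<noteq> C"
  shows "oclass (collapse G dss) = 0"
proof -
  interpret B: cycle_system G dss' using cubic F' by (rule forest_data_cycle_system)
  have es: "set es = set (path_edges G dss)" "set es = set (path_edges G dss')"
    using forest_data_set F F' by blast+
  have "finite C" using C_halves graphD(1) finite_subset by blast
  have "\<not> B.C \<subseteq> C"
  proof
    assume "B.C \<subseteq> C"
    then have "B.C = C" using card_subset_eq[OF \<open>finite C\<close>] card_C B.card_C by simp
    then show False using C' by (simp add: B.C_def)
  qed
  then obtain h where h: "h \<in> B.C" "h \<notin> C" by blast
  \<comment> \<open>The forest lies inside both half-edge sets, so an edge outside \<open>C\<close>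
    can occur in the second system only as a closing edge.\<close>
  have "edge G h \<notin> set es" using path_edges_C es(1) h(2) by (auto simp: edge_def)
  then obtain ds where ds: "ds \<in> set dss'" "edge G (last ds) = edge G h"
    using B.closing_edge[OF F' h(1)] by blast
  have hh: "h \<in> halves G" using h(1) B.C_halves by blast
  have "last ds = h \<or> last ds = opp G h" using edge_eq_iff[OF is_graph hh, of "last ds"] ds(2) by metis
  then have l: "last ds \<notin> C" "last ds \<in> halves G" using h opp_C_iff[OF hh] hh graphD(2) by auto
  \<comment> \<open>The other edges of the cycle that it closes are in the forest, hence on cycles
    of the first system; so the whole path collapses to a single vertex.\<close>
  have const: "idx (vert G (ds ! j)) = idx (vert G (ds ! 0))" if "j < length ds" for j
    using that
  proof (induction j)
    case (Suc j)
    have "ds ! j \<in> set (butlast ds)"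
      using Suc.prems nth_mem[of j "butlast ds"] by (simp add: nth_butlast)
    then have "edge G (ds ! j) \<in> set (path_edges G dss')" using ds(1) by (auto simp: path_edges_def)
    then have "ds ! j \<in> C" using path_edges_C es by (auto simp: edge_def)
    then have "idx (vert G (ds ! j)) = idx (vert G (opp G (ds ! j)))" by (rule idx_C)
    then show ?case using Suc B.next_vert[OF ds(1), of j] by simp
  qed simp
  have ne: "ds \<noteq> []" using B.nonempty[OF ds(1)] .
  have "vert G (opp G (last ds)) = vert G (ds ! 0)"
    using B.closed[OF ds(1)] ne by (simp add: closed_path_def hd_conv_nth)
  moreover have "idx (vert G (last ds)) = idx (vert G (ds ! 0))"
    using const[of "length ds - 1"] ne by (simp add: last_conv_nth)
  ultimately have "vert \<Gamma> (last ds) = vert \<Gamma> (opp \<Gamma> (last ds))" by simp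
  moreover have "is_odd_graph (\<Gamma>, snd (collapse G dss))" using is_odd_graph_collapse by (simp only: prod.collapse)
  ultimately have "oclass (\<Gamma>, snd (collapse G dss)) = 0"
    using l by (intro oclass_loop[of _ _ "last ds"]) auto
  then show ?thesis by (simp only: prod.collapse)
qed

end

text \<open>The dichotomy on which the later cancellations rest. For different half-edge sets both
  values are 0, so they agree in this case too.\<close>

lemma has_value_unique:
  assumes "cubic G" "has_value G es C v" "has_value G es C' v'"
  shows "v = v'" and "C \<noteq> C' \<Longrightarrow> v = 0"
proof -
  obtain dss s where d: "forest_data G es dss s" "cycle_halves G dss = C" "v = trace_value G dss s"
    using assms(2) by (auto simp: has_value_def)
  obtain dss' s' where d': "forest_data G es dss' s'" "cycle_halves G dss' = C'" "v' = trace_value G dss' s'"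
    using assms(3) by (auto simp: has_value_def)
  interpret A: cycle_system G dss using assms(1) d(1) by (rule forest_data_cycle_system)
  interpret B: cycle_system G dss' using assms(1) d'(1) by (rule forest_data_cycle_system)
  have zero: "v = 0" "v' = 0" if "C \<noteq> C'"
    using A.oclass_collapse_zero[OF d(1) d'(1)] B.oclass_collapse_zero[OF d'(1) d(1)] that d(2) d'(2)
    by (simp_all add: A.C_def B.C_def d(3) d'(3) trace_value_def)
  show "v = 0" if "C \<noteq> C'" using zero that by blast
  show "v = v'"
    using zero A.trace_value_unique[OF d(1) d'(1)] d d' by (cases "C = C'") (auto simp: A.C_def)
qed

section \<open>Invariance under isomorphisms\<close>

lemma edge_iso:
  assumes "graph_iso \<phi> G H" "h \<in> halves G"
  shows "edge H (\<phi> h) = \<phi> ` edge G h"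
  using assms by (auto simp: graph_iso_def edge_def)

text \<open>Needed for an exchange that is not itself a member of the IHX triple but only isomorphic
  to one, and so is not known to come from a forested graph.\<close>

lemma cubic_iso:
  assumes iso: "graph_iso \<phi> G H" and G: "cubic G" and H: "is_graph H"
  shows "cubic H"
proof -
  have hH: "halves H = \<phi> ` halves G" using iso by (auto simp: graph_iso_def bij_betw_def)
  have inj: "inj_on \<phi> (halves G)" using iso by (auto simp: graph_iso_def bij_betw_def)
  have opp: "opp H (\<phi> h) = \<phi> (opp G h)" if "h \<in> halves G" for h
    using iso that by (simp add: graph_iso_def)
  have vert: "vert H (\<phi> h) = vert H (\<phi> k) \<longleftrightarrow> vert G h = vert G k"
    if "h \<in> halves G" "k \<in> halves G" for h k
    using iso that by (simp add: graph_iso_def)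
  have GG: "is_graph G" using G by (simp add: cubic_def)
  have path: "\<forall>k\<in>halves G. vert G k = w \<longrightarrow> (adjacent H (edges H))\<^sup>*\<^sup>* (vert H (\<phi> h)) (vert H (\<phi> k))"
    if "(adjacent G (edges G))\<^sup>*\<^sup>* (vert G h) w" "h \<in> halves G" for h w
    using that
  proof (induction rule: rtranclp_induct)
    case base
    then show ?case using vert[of h] by (metis rtranclp.rtrancl_refl)
  next
    case (step w x)
    then obtain l where l: "l \<in> halves G" "vert G l = w" "vert G (opp G l) = x" by (auto simp: adjacent_def)
    have ol: "opp G l \<in> halves G" using is_graphD(2)[OF GG l(1)] .
    have "(adjacent H (edges H))\<^sup>*\<^sup>* (vert H (\<phi> h)) (vert H (\<phi> l))" using step l by blast
    moreover have "adjacent H (edges H) (vert H (\<phi> l)) (vert H (\<phi> (opp G l)))"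
      unfolding adjacent_def using l(1) opp[OF l(1)] by (intro bexI[of _ "\<phi> l"]) (auto simp: hH edges_def)
    ultimately have 1: "(adjacent H (edges H))\<^sup>*\<^sup>* (vert H (\<phi> h)) (vert H (\<phi> (opp G l)))"
      by (rule rtranclp.rtrancl_into_rtrancl)
    show ?case
    proof (intro ballI impI)
      fix k assume k: "k \<in> halves G" "vert G k = x"
      then have "vert H (\<phi> k) = vert H (\<phi> (opp G l))" using vert[OF k(1) ol] l(3) by simp
      then show "(adjacent H (edges H))\<^sup>*\<^sup>* (vert H (\<phi> h)) (vert H (\<phi> k))" using 1 by simp
    qed
  qed
  have "connected_by H (edges H)"
    unfolding connected_by_def
  proof (intro ballI)
    fix u w assume "u \<in> verts H" "w \<in> verts H"
    then obtain h k where hk: "h \<in> halves G" "k \<in> halves G" "u = vert H (\<phi> h)" "w = vert H (\<phi> k)"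
      by (auto simp: verts_def hH)
    have "(adjacent G (edges G))\<^sup>*\<^sup>* (vert G h) (vert G k)"
      using G hk(1,2) by (simp add: cubic_def connected_graph_def connected_by_def verts_def)
    from path[OF this hk(1)] show "(adjacent H (edges H))\<^sup>*\<^sup>* u w" using hk by blast
  qed
  then have "connected_graph H"
    using G by (simp add: cubic_def connected_graph_def hH)
  moreover have "valence H v = 3" if "v \<in> verts H" for v
  proof -
    obtain h where h: "h \<in> halves G" "v = vert H (\<phi> h)" using \<open>v \<in> verts H\<close> by (auto simp: verts_def hH)
    have "card (\<phi> ` star G (vert G h)) = card (star G (vert G h))"
      by (intro card_image inj_on_subset[OF inj]) (auto simp: star_def)
    then show ?thesis
      using G h graph_iso_star[OF iso h(1)] by (simp add: cubic_def valence_def verts_def)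
  qed
  ultimately show ?thesis using H by (simp add: cubic_def)
qed

text \<open>Cycles and spokes are mapped entrywise, so all orderings correspond literally and no
  sign arises. The image of \<open>C\<close> is recorded because the comparison of values depends on
  it.\<close>

lemma has_value_iso:
  assumes G: "cubic G" and H: "cubic H" and iso: "graph_iso \<phi> G H" and v: "has_value G es C v"
  shows "has_value H (map ((`) \<phi>) es) (\<phi> ` C) v"
proof -
  obtain dss s where F: "forest_data G es dss s" and C: "cycle_halves G dss = C" and v: "v = trace_value G dss s"
    using v by (auto simp: has_value_def)
  interpret A: cycle_system G dss using G F by (rule forest_data_cycle_system)
  have AC: "A.C = C" using C by (simp add: A.C_def)
  have hH: "halves H = \<phi> ` halves G" using iso by (auto simp: graph_iso_def bij_betw_def)
  have inj: "inj_on \<phi> (halves G)" using iso by (auto simp: graph_iso_def bij_betw_def)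
  have opp: "opp H (\<phi> h) = \<phi> (opp G h)" if "h \<in> halves G" for h
    using iso that by (simp add: graph_iso_def)
  have vert: "vert H (\<phi> h) = vert H (\<phi> k) \<longleftrightarrow> vert G h = vert G k"
    if "h \<in> halves G" "k \<in> halves G" for h k
    using iso that by (simp add: graph_iso_def)
  let ?dss = "map (map \<phi>) dss"
  have sub: "set ds \<subseteq> halves G" if "ds \<in> set dss" for ds
    using A.D_halves A.D_I[OF that] by blast
  have closed: "closed_path H (map \<phi> ds)" if ds: "ds \<in> set dss" for ds
  proof -
    have "vert H (opp H (map \<phi> ds ! j)) = vert H (map \<phi> ds ! (Suc j mod length ds))" if j: "j < length ds" for j
    proof -
      have k: "Suc j mod length ds < length ds" using j by (intro mod_less_divisor) auto
      have d: "ds ! j \<in> halves G" "ds ! (Suc j mod length ds) \<in> halves G"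
        using sub[OF ds] nth_mem[OF j] nth_mem[OF k] by blast+
      show ?thesis
        using A.next_vert[OF ds j] vert[OF A.graphD(2)[OF d(1)] d(2)] opp[OF d(1)] j k by simp
    qed
    then show ?thesis using A.nonempty[OF ds] sub[OF ds] by (auto simp: closed_path_iff hH)
  qed
  have conc: "concat ?dss = map \<phi> (concat dss)" by (simp add: map_concat)
  have Dh: "set (concat dss) \<subseteq> halves G" using A.D_halves by (auto simp: A.D_def)
  have "distinct (map (vert H) (concat ?dss))"
  proof -
    have "inj_on (\<lambda>d. vert H (\<phi> d)) (set (concat dss))"
    proof (rule inj_onI)
      fix d d' assume d: "d \<in> set (concat dss)" "d' \<in> set (concat dss)" "vert H (\<phi> d) = vert H (\<phi> d')"
      then have "vert G d = vert G d'" using vert[of d d'] Dh by blast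
      then show "d = d'" using A.vert_D_eq d(1,2) unfolding A.D_def by blast
    qed
    then show ?thesis using A.distinct_concat by (simp add: conc distinct_map comp_def del: set_concat)
  qed
  moreover have "vert H ` set (concat ?dss) = verts H"
  proof
    show "vert H ` set (concat ?dss) \<subseteq> verts H" using Dh unfolding conc verts_def hH by auto
    show "verts H \<subseteq> vert H ` set (concat ?dss)"
    proof
      fix w assume "w \<in> verts H"
      then obtain h where h: "h \<in> halves G" "w = vert H (\<phi> h)" by (auto simp: verts_def hH)
      obtain d where d: "d \<in> A.D" "vert G d = vert G h" using h(1) by (rule A.vertE)
      then have "w = vert H (\<phi> d)" using vert[OF A.D_halves[OF d(1)] h(1)] h(2) by simp
      then show "w \<in> vert H ` set (concat ?dss)" unfolding conc using d(1) by (auto simp: A.D_def)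
    qed
  qed
  ultimately have cyc: "cyc_sys H ?dss" using closed A.odd_length by (auto simp: cyc_sys_def)
  then interpret B: cycle_system H ?dss using H by (simp add: cycle_system_def)
  have pe: "path_edges H ?dss = map ((`) \<phi>) (path_edges G dss)"
  proof -
    have "map (edge H) (butlast (map \<phi> ds)) = map ((`) \<phi>) (map (edge G) (butlast ds))" if "ds \<in> set dss" for ds
      using sub[OF that] by (auto simp: map_butlast[symmetric] edge_iso[OF iso] dest!: in_set_butlastD)
    then show ?thesis by (simp add: path_edges_def map_concat comp_def cong: map_cong)
  qed
  have ed: "f \<subseteq> halves G" if "f \<in> set es" for f
    using that forest_data_set[OF F] A.path_edges_C A.C_halves by blast
  have "edge H (last ds') \<notin> set (map ((`) \<phi>) es)" if ds': "ds' \<in> set ?dss" for ds'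
  proof
    assume a: "edge H (last ds') \<in> set (map ((`) \<phi>) es)"
    obtain ds where ds: "ds \<in> set dss" "ds' = map \<phi> ds" using ds' by auto
    have l: "last ds \<in> halves G" "last ds' = \<phi> (last ds)"
      using A.nonempty[OF ds(1)] sub[OF ds(1)] ds(2) by (auto simp: last_map)
    obtain f where f: "f \<in> set es" "\<phi> ` edge G (last ds) = \<phi> ` f"
      using a l edge_iso[OF iso l(1)] by auto
    have "edge G (last ds) \<subseteq> halves G" using l(1) A.graphD(2) by (auto simp: edge_def)
    then have "edge G (last ds) = f" using inj_on_image_eq_iff[OF inj _ ed[OF f(1)]] f(2) by blast
    then show False using F ds(1) f(1) by (auto simp: forest_data_def)
  qed
  then have F': "forest_data H (map ((`) \<phi>) es) ?dss s"
    unfolding forest_data_def pe using cyc F srel_map[of es "path_edges G dss" s] by (auto simp: forest_data_def)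
  have C': "cycle_halves H ?dss = \<phi> ` C"
  proof -
    have "edge H (\<phi> d) = \<phi> ` edge G d" if "d \<in> set (concat dss)" for d
      using edge_iso[OF iso] Dh that by blast
    then show ?thesis unfolding C[symmetric] cycle_halves_def conc image_UN by auto
  qed
  then have BC: "B.C = \<phi> ` A.C" using AC by (simp add: B.C_def)
  have idx: "B.idx (vert H (\<phi> h)) = A.idx (vert G h)" if h: "h \<in> halves G" for h
  proof -
    have v: "vert G h \<in> verts G" using h by (auto simp: verts_def)
    obtain d where d: "d \<in> set (dss ! A.idx (vert G h))" "vert G d = vert G h" using A.idx_lt(2)[OF v] by blast
    have i: "A.idx (vert G h) < length dss" by (rule A.idx_lt(1)[OF v])
    have "d \<in> halves G" using sub[OF nth_mem[OF i]] d(1) by blast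
    then have "vert H (\<phi> d) = vert H (\<phi> h)" using vert h d(2) by blast
    then show ?thesis using B.idx_eq[of "A.idx (vert G h)" "\<phi> d"] i d(1) by simp
  qed
  have iso': "graph_iso \<phi> A.\<Gamma> B.\<Gamma>"
  proof -
    have "bij_betw \<phi> (halves G - A.C) (halves H - \<phi> ` A.C)"
    proof (rule bij_betw_imageI)
      show "inj_on \<phi> (halves G - A.C)" by (rule inj_on_subset[OF inj]) auto
      show "\<phi> ` (halves G - A.C) = halves H - \<phi> ` A.C"
        unfolding hH by (rule inj_on_image_set_diff[OF inj]) (use A.C_halves in auto)
    qed
    moreover have "A.idx (vert G h) = A.idx (vert G k) \<longleftrightarrow> B.idx (vert H (\<phi> h)) = B.idx (vert H (\<phi> k))"
      if "h \<in> halves G" "k \<in> halves G" for h k using idx that by simp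
    ultimately show ?thesis unfolding graph_iso_def by (simp add: BC opp)
  qed
  have "srel (map \<phi> (snd (collapse G dss) (vert A.\<Gamma> h))) (snd (collapse H ?dss) (vert B.\<Gamma> (\<phi> h))) 1"
    if h: "h \<in> halves A.\<Gamma>" for h
  proof -
    have hh: "h \<in> halves G" using h by simp
    let ?i = "A.idx (vert G h)"
    have i: "?i < length dss" using hh by (intro A.idx_lt(1)) (auto simp: verts_def)
    have "spoke H ?dss (\<phi> d) = \<phi> (spoke G dss d)" if d: "d \<in> set (dss ! ?i)" for d
    proof -
      have dD: "d \<in> A.D" using A.D_I[OF nth_mem[OF i] d] .
      have "\<phi> d \<in> B.D" using dD by (auto simp: B.D_def A.D_def)
      moreover have "\<phi> (spoke G dss d) \<in> halves H" using A.spoke(1)[OF dD] hH by blast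
      moreover have "\<phi> (spoke G dss d) \<notin> B.C"
        unfolding BC using A.spoke(1,3)[OF dD] inj A.C_halves by (auto dest!: inj_onD)
      moreover have "vert H (\<phi> (spoke G dss d)) = vert H (\<phi> d)"
        using vert[OF A.spoke(1)[OF dD] A.D_halves[OF dD]] A.spoke(2)[OF dD] by blast
      ultimately show ?thesis by (intro B.spoke_eq)
    qed
    then have "map \<phi> (map (spoke G dss) (dss ! ?i)) = map (spoke H ?dss) (?dss ! ?i)" using i by simp
    then show ?thesis using idx[OF hh] by (simp add: srel_refl)
  qed
  from oclass_iso[of "A.\<Gamma>" "snd (collapse G dss)" "B.\<Gamma>" "snd (collapse H ?dss)" \<phi> "\<lambda>_. 1", OF _ _ iso' this]
  have "oclass (collapse H ?dss) = cscale (of_int (\<Prod>v\<in>verts A.\<Gamma>. 1)) (oclass (collapse G dss))"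
    using A.is_odd_graph_collapse B.is_odd_graph_collapse by (simp only: prod.collapse)
  then have "v = trace_value H ?dss s" by (simp add: v trace_value_def)
  then show ?thesis using F' C' by (auto simp: has_value_def)
qed

section \<open>Exchanging half-edges across a forest edge\<close>

lemma exchange_simps [simp]:
  "halves (exchange a c G) = halves G" "opp (exchange a c G) = opp G" "edge (exchange a c G) = edge G"
  "vert (exchange a c G) k = (if k = c then vert G a else if k = a then vert G c else vert G k)"
  by (auto simp: exchange_def edge_def fun_eq_iff)

lemma is_graph_exchange: "is_graph G \<Longrightarrow> is_graph (exchange a c G)"
  by (simp add: is_graph_def)

context cycle_system begin

text \<open>\<open>a\<close> and \<open>c\<close> are the spokes at the two ends of a cycle edge.
  Exchanging them leaves the cycles untouched, and the collapsed graph as well, since both ends lie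
  on one cycle; but the two spokes trade places in the ordering at that vertex, whence the
  sign.\<close>

lemma exchange_spokes:
  assumes G': "cubic (exchange a c G)" and h: "h \<in> C" "vert G h \<noteq> vert G (opp G h)"
    and a: "a \<in> halves G" "a \<notin> C" "vert G a = vert G h"
    and c: "c \<in> halves G" "c \<notin> C" "vert G c = vert G (opp G h)"
  shows "cyc_sys (exchange a c G) dss"
    "oclass (collapse (exchange a c G) dss) = cscale (of_int (-1)) (oclass (collapse G dss))"
proof -
  let ?G = "exchange a c G"
  have ac: "a \<noteq> c" using a c h by auto
  have vC: "vert ?G k = vert G k" if "k \<in> C" for k using that a c by auto
  have vD: "vert ?G ` set ds = vert G ` set ds" if "ds \<in> set dss" for ds
    using vC D_I[OF that] by (intro image_cong) (auto simp: C_eq)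
  have closed': "closed_path ?G ds" if ds: "ds \<in> set dss" for ds
  proof -
    have "vert ?G (opp ?G (ds ! j)) = vert ?G (ds ! (Suc j mod length ds))" if j: "j < length ds" for j
    proof -
      have "Suc j mod length ds < length ds" using j by (intro mod_less_divisor) auto
      then have "ds ! (Suc j mod length ds) \<in> C" "opp G (ds ! j) \<in> C"
        using D_nth[OF ds] j by (auto simp: C_eq)
      then show ?thesis using vC next_vert[OF ds j] by (metis exchange_simps(2))
    qed
    then show ?thesis using closed[OF ds] by (simp add: closed_path_iff)
  qed
  have DC: "D \<subseteq> C" by (auto simp: C_eq)
  have map: "map (vert ?G) (concat dss) = map (vert G) (concat dss)"
    using vC DC unfolding D_def by (intro map_cong) blast+
  have verts: "verts ?G = verts G"
  proof
    have "vert G k \<in> verts G" if "k \<in> halves G" for k using that unfolding verts_def by (rule imageI)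
    then show "verts ?G \<subseteq> verts G" using a(1) c(1) unfolding verts_def[of ?G] by auto
    show "verts G \<subseteq> verts ?G"
    proof
      fix v assume "v \<in> verts G"
      then obtain d where d: "d \<in> D" "vert G d = v" using vert_D by force
      then have "vert ?G d = v" using vC DC by blast
      then show "v \<in> verts ?G" using D_halves[OF d(1)] unfolding verts_def by (metis exchange_simps(1) imageI)
    qed
  qed
  have "vert ?G ` set (concat dss) = vert G ` set (concat dss)"
    using map by (metis set_map)
  then show "cyc_sys ?G dss"
    unfolding cyc_sys_def map verts using closed' cyc by (auto simp: cyc_sys_def)
  then interpret B: cycle_system ?G dss using G' by (simp add: cycle_system_def)
  have BC: "B.C = C" by (simp add: B.C_def C_def cycle_halves_def)
  have BD: "B.D = D" by (simp add: B.D_def D_def)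
  have bidx: "B.idx u = idx u" for u
  proof -
    have "(\<lambda>i. i < length dss \<and> u \<in> vert ?G ` set (dss ! i)) = (\<lambda>i. i < length dss \<and> u \<in> vert G ` set (dss ! i))"
    proof (rule ext)
      fix i show "(i < length dss \<and> u \<in> vert ?G ` set (dss ! i)) = (i < length dss \<and> u \<in> vert G ` set (dss ! i))"
        using vD[of "dss ! i"] by (cases "i < length dss") simp_all
    qed
    then show ?thesis unfolding B.idx_def idx_def by (rule arg_cong)
  qed
  have hidx: "idx (vert G (opp G h)) = idx (vert G h)" using idx_C[OF h(1)] by simp
  have idx: "B.idx (vert ?G k) = idx (vert G k)" for k
    unfolding bidx using hidx a(3) c(3) by simp
  have iso: "graph_iso id \<Gamma> B.\<Gamma>"
    unfolding graph_iso_def B.collapse_simps collapse_simps idx BC by simp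
  have spoke': "spoke ?G dss d = transpose a c (spoke G dss d)" if d: "d \<in> D" for d
  proof (rule B.spoke_eq)
    show "d \<in> B.D" using d BD by simp
    show "transpose a c (spoke G dss d) \<in> halves ?G"
      using spoke(1)[OF d] a c by (auto simp: transpose_def)
    show "transpose a c (spoke G dss d) \<notin> B.C"
      using spoke(3)[OF d] a c BC by (auto simp: transpose_def)
    have "vert ?G d = vert G d" using vC DC d by blast
    then show "vert ?G (transpose a c (spoke G dss d)) = vert ?G d"
      using spoke(2)[OF d] ac by (auto simp: transpose_def)
  qed
  let ?s = "\<lambda>i. if i = idx (vert G h) then -1 else 1 :: int"
  have "srel (map id (snd (collapse G dss) (vert \<Gamma> k))) (snd (collapse ?G dss) (vert B.\<Gamma> (id k))) (?s (vert \<Gamma> k))"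
    if k: "k \<in> halves \<Gamma>" for k
  proof -
    let ?i = "idx (vert G k)"
    let ?xs = "map (spoke G dss) (dss ! ?i)"
    have i: "?i < length dss" using k by (intro idx_lt(1)) (auto simp: verts_def)
    have eq: "map (spoke ?G dss) (dss ! ?i) = map (transpose a c) ?xs"
      using spoke' D_I[OF nth_mem[OF i]] by simp
    have st: "set ?xs = star \<Gamma> ?i" using star_Gamma[OF i] by simp
    have "?i \<in> verts \<Gamma>" using i verts_Gamma by simp
    moreover have "is_odd_graph (\<Gamma>, snd (collapse G dss))" using is_odd_graph_collapse by (simp only: prod.collapse)
    ultimately have "distinct (snd (collapse G dss) ?i)" unfolding is_odd_graph_def prod.case by blast
    then have dist: "distinct ?xs" by simp
    have "srel ?xs (map (transpose a c) ?xs) (?s ?i)"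
    proof (cases "?i = idx (vert G h)")
      case True
      then have "a \<in> set ?xs" "c \<in> set ?xs" unfolding st using a c hidx by (auto simp: star_def)
      then show ?thesis using True srel_map_transpose[OF dist _ _ ac] by simp
    next
      case False
      then have "a \<notin> set ?xs" "c \<notin> set ?xs" unfolding st using a c hidx by (auto simp: star_def)
      then have "map (transpose a c) ?xs = ?xs" by (intro map_idI) (auto simp: transpose_def)
      then show ?thesis using False by (simp only: if_False srel_refl)
    qed
    then show ?thesis
      unfolding collapse_simps B.collapse_simps id_apply idx eq[symmetric] by (simp only: list.map_ident)
  qed
  from oclass_iso[of "\<Gamma>" "snd (collapse G dss)" "B.\<Gamma>" "snd (collapse ?G dss)" id ?s, OF _ _ iso this]
  have 1: "oclass (collapse ?G dss) = cscale (of_int (\<Prod>i\<in>verts \<Gamma>. ?s i)) (oclass (collapse G dss))"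
    using is_odd_graph_collapse B.is_odd_graph_collapse by (simp only: prod.collapse)
  have "h \<in> halves G" using h(1) C_halves by blast
  then have "idx (vert G h) < length dss" by (intro idx_lt(1)) (auto simp: verts_def)
  then have "(\<Prod>i\<in>verts \<Gamma>. ?s i) = -1" unfolding verts_Gamma by (subst prod.delta) auto
  then show "oclass (collapse ?G dss) = cscale (of_int (-1)) (oclass (collapse G dss))" using 1 by (simp only:)
qed

end

text \<open>The situation of \<open>ihx_triple\<close> with both stars as equivalences and all six
  half-edges distinct. In this form it visibly persists under renaming the outer half-edges and
  under the exchanges.\<close>

definition ihx_site :: "graph \<Rightarrow> nat \<Rightarrow> nat \<Rightarrow> nat \<Rightarrow> nat \<Rightarrow> nat \<Rightarrow> bool" where
  "ihx_site G h a b c d \<longleftrightarrow> h \<in> halves G \<and> vert G h \<noteq> vert G (opp G h) \<and>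
     (\<forall>k. k \<in> halves G \<and> vert G k = vert G h \<longleftrightarrow> k = h \<or> k = a \<or> k = b) \<and>
     (\<forall>k. k \<in> halves G \<and> vert G k = vert G (opp G h) \<longleftrightarrow> k = opp G h \<or> k = c \<or> k = d) \<and>
     distinct [h, a, b, opp G h, c, d]"

lemma ihx_siteD:
  assumes "ihx_site G h a b c d"
  shows "h \<in> halves G" "vert G h \<noteq> vert G (opp G h)" "distinct [h, a, b, opp G h, c, d]"
    "a \<in> halves G" "vert G a = vert G h" "b \<in> halves G" "vert G b = vert G h"
    "c \<in> halves G" "vert G c = vert G (opp G h)" "d \<in> halves G" "vert G d = vert G (opp G h)"
  using assms unfolding ihx_site_def by blast+

lemma ihx_site_swap: "ihx_site G h a b c d \<Longrightarrow> ihx_site G h a b d c" "ihx_site G h a b c d \<Longrightarrow> ihx_site G h b a c d"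
  unfolding ihx_site_def by auto

lemma ihx_site_exchange:
  assumes "ihx_site G h a b c d"
  shows "ihx_site (exchange b c G) h a c b d"
proof -
  note q = ihx_siteD[OF assms]
  have 1: "\<And>k. k \<in> halves G \<and> vert G k = vert G h \<longleftrightarrow> k = h \<or> k = a \<or> k = b"
    and 2: "\<And>k. k \<in> halves G \<and> vert G k = vert G (opp G h) \<longleftrightarrow> k = opp G h \<or> k = c \<or> k = d"
    using assms unfolding ihx_site_def by blast+
  have v: "vert (exchange b c G) h = vert G h" "vert (exchange b c G) (opp G h) = vert G (opp G h)"
    using q(3) by auto
  have "k \<in> halves G \<and> vert (exchange b c G) k = vert G h \<longleftrightarrow> k = h \<or> k = a \<or> k = c" for k
    using 1[of k] 2[of k] q by auto
  moreover have "k \<in> halves G \<and> vert (exchange b c G) k = vert G (opp G h) \<longleftrightarrow> k = opp G h \<or> k = b \<or> k = d" for k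
    using 1[of k] 2[of k] q by auto
  moreover have "distinct [h, a, c, opp G h, b, d]" using q(3) by auto
  ultimately show ?thesis
    unfolding ihx_site_def exchange_simps(1,2) v using q(1,2) by blast
qed

text \<open>Any two of the three expansions differ by a single exchange, so each of them can serve
  as the starting graph.\<close>

lemma exchange_exchange:
  assumes "ihx_site G h a b c d"
  shows "exchange c b (exchange b c G) = G"
    "exchange d b (exchange b d G) = G"
    "exchange d c (exchange b d G) = exchange b c G" "exchange c d (exchange b c G) = exchange b d G"
  using ihx_siteD[OF assms] by (intro graph.equality; auto simp: fun_eq_iff)+

text \<open>Both graphs split the four outer half-edges into \<open>a, d\<close> and
  \<open>b, c\<close>; they differ only in which end of the edge carries which pair, and swapping
  the halves \<open>h\<close> and \<open>opp G h\<close> undoes this.\<close>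

lemma graph_iso_flip:
  assumes G: "is_graph G" and q: "ihx_site G h a b c d"
  shows "graph_iso (transpose h (opp G h)) (exchange b d G) (exchange a c G)"
proof -
  note Q = ihx_siteD[OF q]
  let ?\<phi> = "transpose h (opp G h)" and ?\<tau> = "transpose (vert G h) (vert G (opp G h))"
  have "bij_betw ?\<phi> (halves G) (halves G)"
    using Q(1) is_graphD(2)[OF G Q(1)] by (intro permutes_imp_bij permutes_swap_id) auto
  \<comment> \<open>The transposition \<open>?\<tau>\<close> of the two vertex names is the effect
    of the flip on vertices.\<close>
  moreover have "vert (exchange a c G) (?\<phi> k) = ?\<tau> (vert (exchange b d G) k)" if k: "k \<in> halves G" for k
  proof -
    have neq: "h \<noteq> a" "h \<noteq> b" "h \<noteq> opp G h" "h \<noteq> c" "h \<noteq> d" "a \<noteq> b" "a \<noteq> opp G h" "a \<noteq> c" "a \<noteq> d"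
      "b \<noteq> opp G h" "b \<noteq> c" "b \<noteq> d" "opp G h \<noteq> c" "opp G h \<noteq> d" "c \<noteq> d"
      using Q(3) by auto
    have t: "?\<tau> (vert G h) = vert G (opp G h)" "?\<tau> (vert G (opp G h)) = vert G h" "?\<phi> h = opp G h" "?\<phi> (opp G h) = h"
      by (rule transpose_apply_first transpose_apply_second)+
    have "vert G k = vert G h \<Longrightarrow> k = h \<or> k = a \<or> k = b"
      "vert G k = vert G (opp G h) \<Longrightarrow> k = opp G h \<or> k = c \<or> k = d"
      using k q unfolding ihx_site_def by blast+
    then consider "k = h" | "k = opp G h" | "k = a" | "k = b" | "k = c" | "k = d"
      | (o) "vert G k \<noteq> vert G h" "vert G k \<noteq> vert G (opp G h)" by blast
    then show ?thesis
    proof cases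
      case o
      then have "k \<noteq> h" "k \<noteq> opp G h" "k \<noteq> a" "k \<noteq> b" "k \<noteq> c" "k \<noteq> d" using Q(5,7,9,11) by blast+
      then have "?\<phi> k = k" "vert (exchange a c G) k = vert G k" "vert (exchange b d G) k = vert G k"
        by (simp_all add: transpose_apply_other)
      then show ?thesis using o by (simp add: transpose_apply_other)
    qed (use neq Q(5,7,9,11) t in \<open>simp_all add: transpose_apply_other\<close>)
  qed
  moreover have "inj ?\<tau>" by (rule inj_on_transpose)
  ultimately show ?thesis
    unfolding graph_iso_def exchange_simps(1,2)
    using opp_transpose[OF G Q(1)] by (simp del: exchange_simps(4) add: inj_eq)
qed

text \<open>If \<open>a\<close> and \<open>c\<close> are off the cycles, they are spokes and
  \<open>exchange_spokes\<close> applies. If both are on the cycles, then \<open>b\<close> and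
  \<open>d\<close> are the spokes; exchanging those gives the same splitting up to the flip, which
  preserves \<open>C\<close> and every forest edge.\<close>

lemma has_value_exchange:
  assumes G: "cubic G" and G': "cubic (exchange a c G)" and q: "ihx_site G h a b c d"
    and e: "edge G h \<in> set es" and v: "has_value G es C v" and iff: "a \<in> C \<longleftrightarrow> c \<in> C"
  shows "has_value (exchange a c G) es C (- v)"
proof -
  have spokes: "has_value (exchange a c G) es C (- v)"
    if G': "cubic (exchange a c G)" and q: "ihx_site G h a b c d" and ac: "a \<notin> C" "c \<notin> C" for a b c d
  proof -
    note Q = ihx_siteD[OF q]
    obtain dss s where F: "forest_data G es dss s" and C: "cycle_halves G dss = C" and v: "v = trace_value G dss s"
      using v by (auto simp: has_value_def)
    interpret A: cycle_system G dss using G F by (rule forest_data_cycle_system)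
    have AC: "A.C = C" using C by (simp add: A.C_def)
    have "h \<in> A.C" using A.path_edges_C forest_data_set[OF F] e by (auto simp: edge_def)
    note S = A.exchange_spokes[OF G' this Q(2) Q(4) _ Q(5) Q(8) _ Q(9), unfolded AC, OF ac]
    have "forest_data (exchange a c G) es dss s"
      using F S(1) by (simp add: forest_data_def path_edges_def)
    moreover have "cycle_halves (exchange a c G) dss = C" using C by (simp add: cycle_halves_def)
    moreover have "trace_value (exchange a c G) dss s = - v"
      by (simp add: trace_value_def S(2) v)
    ultimately show ?thesis unfolding has_value_def by metis
  qed
  note Q = ihx_siteD[OF q]
  have gG: "is_graph G" using G by (simp add: cubic_def)
  obtain dss s where F: "forest_data G es dss s" and C: "cycle_halves G dss = C"
    using v by (auto simp: has_value_def)
  interpret A: cycle_system G dss using G F by (rule forest_data_cycle_system)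
  have AC: "A.C = C" using C by (simp add: A.C_def)
  have hC: "h \<in> C" "opp G h \<in> C"
    using A.path_edges_C forest_data_set[OF F] e AC by (auto simp: edge_def)
  have o: "opp G h \<in> halves G" using is_graphD(2)[OF gG Q(1)] .
  have ab: "a \<in> C \<longleftrightarrow> b \<notin> C" using A.star_cases[of h a b] Q hC AC by simp
  have cd: "c \<in> C \<longleftrightarrow> d \<notin> C" using A.star_cases[of "opp G h" c d] Q hC AC o by simp
  show ?thesis
  proof (cases "a \<in> C")
    case False
    then show ?thesis using spokes[OF G' q] iff by blast
  next
    case True
    let ?\<phi> = "transpose h (opp G h)"
    have q': "ihx_site G h b a d c" using ihx_site_swap q by blast
    have G2: "cubic (exchange b d G)"
      using cubic_iso[OF graph_iso_flip[OF gG q'] G' is_graph_exchange[OF gG]] .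
    have "has_value (exchange b d G) es C (- v)"
      using spokes[OF G2 q'] True iff ab cd by blast
    from has_value_iso[OF G2 G' graph_iso_flip[OF gG q] this]
    have *: "has_value (exchange a c G) (map ((`) ?\<phi>) es) (?\<phi> ` C) (- v)" .
    \<comment> \<open>The flip moves only the two halves of one edge, so it fixes every set that
      contains both or neither of them.\<close>
    have closed: "?\<phi> ` X = X" if "h \<in> X \<longleftrightarrow> opp G h \<in> X" for X
      using that by (auto simp: transpose_def image_iff)
    have "?\<phi> ` f = f" if "f \<in> set es" for f
    proof (rule closed)
      have "f \<in> edges G" using that forest_data_set[OF F] A.path_edges_edges by blast
      then obtain k where k: "k \<in> halves G" "f = {k, opp G k}" by (auto simp: edges_def edge_def)
      have "opp G h = opp G k \<longleftrightarrow> h = k" "opp G h = k \<longleftrightarrow> h = opp G k"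
        using is_graphD(4)[OF gG] Q(1) k(1) by metis+
      then show "h \<in> f \<longleftrightarrow> opp G h \<in> f" unfolding k(2) by blast
    qed
    then have "map ((`) ?\<phi>) es = es" by (intro map_idI) auto
    moreover have "?\<phi> ` C = C" using hC by (intro closed) simp
    ultimately show ?thesis using * by simp
  qed
qed

text \<open>By \<open>has_value_unique\<close> the choice is unambiguous on cubic graphs. The
  default 0 is the value required of \<open>graphical_trace\<close> in the absence of trace
  data.\<close>

definition tval :: "graph \<Rightarrow> nat set list \<Rightarrow> cG" where
  "tval G es = (if \<exists>C v. has_value G es C v then SOME v. \<exists>C. has_value G es C v else 0)"

lemma tval_eq:
  assumes "cubic G" "has_value G es C v"
  shows "tval G es = v"
proof -
  have "\<exists>C. has_value G es C (SOME v. \<exists>C. has_value G es C v)"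
    by (rule someI[of "\<lambda>v. \<exists>C. has_value G es C v" v]) (use assms in blast)
  then obtain C' where "has_value G es C' (SOME v. \<exists>C. has_value G es C v)" ..
  from has_value_unique(1)[OF assms(1) this assms(2)]
  have "(SOME v. \<exists>C. has_value G es C v) = v" .
  moreover have ex: "\<exists>C v. has_value G es C v" using assms(2) by blast
  ultimately show ?thesis unfolding tval_def if_P[OF ex] by blast
qed

lemma tval_zero: "(\<And>C v. has_value G es C v \<Longrightarrow> False) \<Longrightarrow> tval G es = 0"
  by (auto simp: tval_def)

text \<open>By the hypothesis on \<open>b\<close> and \<open>c\<close>, the expansion exchanging
  them has the same cycles and the value \<open>- v\<close>. What remains is to exclude a non-zero
  value of the third expansion.\<close>

lemma ihx_aux:
  assumes G: "cubic G" and G1: "cubic (exchange b c G)" and G2: "cubic (exchange b d G)"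
    and q: "ihx_site G h a b c d" and e: "edge G h \<in> set es" and v: "has_value G es C v"
    and bc: "b \<in> C \<longleftrightarrow> c \<in> C" and cd: "c \<in> C \<longleftrightarrow> d \<notin> C"
  shows "tval G es + tval (exchange b c G) es + tval (exchange b d G) es = 0"
proof -
  let ?G1 = "exchange b c G" and ?G2 = "exchange b d G"
  have v1: "has_value ?G1 es C (- v)"
    using has_value_exchange[OF G G1 ihx_site_swap(2)[OF q] e v] bc by blast
  have q2: "ihx_site ?G2 h a d c b" using ihx_site_swap(1)[OF ihx_site_exchange[OF ihx_site_swap(1)[OF q]]] .
  \<comment> \<open>A value of the third expansion is carried back, with its half-edge set
    \<open>C'\<close>, to one of the two cancelling graphs. There \<open>C'\<close> differs from
    \<open>C\<close>, as the two sets disagree about which of the outer half-edges go together, so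
    both values are 0.\<close>
  have "w = 0" if w: "has_value ?G2 es C' w" for C' w
  proof (cases "d \<in> C' \<longleftrightarrow> b \<in> C'")
    case True
    have "has_value (exchange d b ?G2) es C' (- w)"
      using has_value_exchange[OF G2 _ ihx_site_swap(2)[OF ihx_site_swap(1)[OF q2]] _ w] G e True
      by (simp add: exchange_exchange(2)[OF q])
    then have "has_value G es C' (- w)" by (simp add: exchange_exchange(2)[OF q])
    moreover have "C' \<noteq> C" using True bc cd by blast
    ultimately show ?thesis using has_value_unique(2)[OF G _ v] by fastforce
  next
    case False
    note Q = ihx_siteD[OF q2]
    obtain dss s where F: "forest_data ?G2 es dss s" and C: "cycle_halves ?G2 dss = C'"
      using w by (auto simp: has_value_def)
    interpret A: cycle_system ?G2 dss using G2 F by (rule forest_data_cycle_system)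
    have AC: "A.C = C'" using C by (simp add: A.C_def)
    have "opp G h \<in> C'"
      using A.path_edges_C forest_data_set[OF F] e AC by (auto simp: edge_def)
    moreover have "opp G h \<in> halves G" using A.graphD(2) Q(1) by simp
    ultimately have "c \<in> C' \<longleftrightarrow> b \<notin> C'" using A.star_cases[of "opp G h" c b] Q AC by simp
    \<comment> \<open>In the third expansion \<open>c\<close> and \<open>b\<close> sit at the same
      end of the edge and exactly one of them is on the cycle, so \<open>d\<close> must agree with
      \<open>c\<close> if it does not agree with \<open>b\<close>.\<close>
    then have dc: "d \<in> C' \<longleftrightarrow> c \<in> C'" using False by blast
    have "has_value (exchange d c ?G2) es C' (- w)"
      using has_value_exchange[OF G2 _ ihx_site_swap(2)[OF q2] _ w] G1 e dc
      by (simp add: exchange_exchange(3)[OF q])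
    then have "has_value ?G1 es C' (- w)" by (simp add: exchange_exchange(3)[OF q])
    moreover have "C' \<noteq> C" using dc cd by blast
    ultimately show ?thesis using has_value_unique(2)[OF G1 _ v1] by fastforce
  qed
  then have "tval ?G2 es = 0" using tval_eq[OF G2] tval_zero by metis
  then show ?thesis using tval_eq[OF G v] tval_eq[OF G1 v1] by simp
qed

text \<open>Exactly one of \<open>c\<close> and \<open>d\<close> continues the cycle beyond
  \<open>opp G h\<close>, so exactly one of them agrees with \<open>b\<close>; this decides which of
  the other two expansions cancels \<open>G\<close>.\<close>

lemma ihx_has_value:
  assumes G: "cubic G" and G1: "cubic (exchange b c G)" and G2: "cubic (exchange b d G)"
    and q: "ihx_site G h a b c d" and e: "edge G h \<in> set es" and v: "has_value G es C v"
  shows "tval G es + tval (exchange b c G) es + tval (exchange b d G) es = 0"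
proof -
  note Q = ihx_siteD[OF q]
  obtain dss s where F: "forest_data G es dss s" and C: "cycle_halves G dss = C"
    using v by (auto simp: has_value_def)
  interpret A: cycle_system G dss using G F by (rule forest_data_cycle_system)
  have AC: "A.C = C" using C by (simp add: A.C_def)
  have "opp G h \<in> C"
    using A.path_edges_C forest_data_set[OF F] e AC by (auto simp: edge_def)
  moreover have "opp G h \<in> halves G" using A.graphD(2) Q(1) by simp
  ultimately have cd: "c \<in> C \<longleftrightarrow> d \<notin> C" using A.star_cases[of "opp G h" c d] Q AC by simp
  show ?thesis
  proof (cases "b \<in> C \<longleftrightarrow> c \<in> C")
    case True
    then show ?thesis using ihx_aux[OF G G1 G2 q e v] cd by blast
  next
    case False
    then have "b \<in> C \<longleftrightarrow> d \<in> C" "d \<in> C \<longleftrightarrow> c \<notin> C" using cd by blast+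
    from ihx_aux[OF G G2 G1 ihx_site_swap(1)[OF q] e v this] show ?thesis by (simp add: ac_simps)
  qed
qed

text \<open>The three expansions play symmetric roles, so the argument can start from any one that
  has a value.\<close>

lemma tval_ihx:
  assumes G: "cubic G" and G1: "cubic (exchange b c G)" and G2: "cubic (exchange b d G)"
    and q: "ihx_site G h a b c d" and e: "edge G h \<in> set es"
  shows "tval G es + tval (exchange b c G) es + tval (exchange b d G) es = 0"
proof -
  let ?G1 = "exchange b c G" and ?G2 = "exchange b d G"
  have q1: "ihx_site ?G1 h a c b d" using ihx_site_exchange[OF q] .
  have q2: "ihx_site ?G2 h a d b c" using ihx_site_exchange[OF ihx_site_swap(1)[OF q]] .
  consider (0) C v where "has_value G es C v" | (1) C v where "has_value ?G1 es C v"
    | (2) C v where "has_value ?G2 es C v"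
    | (n) "\<And>C v. \<not> has_value G es C v" "\<And>C v. \<not> has_value ?G1 es C v" "\<And>C v. \<not> has_value ?G2 es C v"
    by blast
  then show ?thesis
  proof cases
    case 0
    then show ?thesis by (rule ihx_has_value[OF G G1 G2 q e])
  next
    case 1
    have "tval ?G1 es + tval (exchange c b ?G1) es + tval (exchange c d ?G1) es = 0"
      by (rule ihx_has_value[OF G1 _ _ q1 _ 1])
        (use G G2 e in \<open>simp_all add: exchange_exchange[OF q]\<close>)
    then show ?thesis by (simp add: exchange_exchange[OF q] ac_simps)
  next
    case 2
    have dc: "exchange d c ?G2 = ?G1" "exchange d b ?G2 = G" by (rule exchange_exchange[OF q])+
    have "tval ?G2 es + tval (exchange d b ?G2) es + tval (exchange d c ?G2) es = 0"
      by (rule ihx_has_value[OF G2 _ _ q2 _ 2]) (use G G1 e in \<open>simp_all add: dc\<close>)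
    then show ?thesis by (simp add: dc ac_simps)
  next
    case n
    then show ?thesis by (simp add: tval_def)
  qed
qed

section \<open>The boundary\<close>

lemma closed_path_rotate:
  assumes "closed_path G ds"
  shows "closed_path G (rotate m ds)"
proof -
  let ?n = "length ds"
  have ds: "ds \<noteq> []" "set ds \<subseteq> halves G"
    "\<And>j. j < ?n \<Longrightarrow> vert G (opp G (ds ! j)) = vert G (ds ! (Suc j mod ?n))"
    using assms closed_path_iff by blast+
  have "vert G (opp G (rotate m ds ! j)) = vert G (rotate m ds ! (Suc j mod ?n))" if j: "j < ?n" for j
  proof -
    have "(m + j) mod ?n < ?n" "Suc j mod ?n < ?n" using j by (auto intro: mod_less_divisor)
    moreover have "Suc ((m + j) mod ?n) mod ?n = (m + Suc j mod ?n) mod ?n"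
      by (simp add: mod_Suc_eq mod_add_right_eq)
    ultimately show ?thesis using ds(3)[of "(m + j) mod ?n"] j by (simp add: nth_rotate)
  qed
  then show ?thesis using ds(1,2) by (simp add: closed_path_iff)
qed

lemma path_edges_append: "path_edges G (xs @ ys) = path_edges G xs @ path_edges G ys"
  by (simp add: path_edges_def)

text \<open>Adding the edge \<open>e\<close> to a forest, the closing edge \<open>e1\<close> of the cycle through \<open>e\<close> could have been
  added instead, leaving \<open>e\<close> as closing edge. The vertices of the cycle are then reordered by
  a rotation, which is even, and the edges by an odd permutation.\<close>

lemma has_value_closing:
  assumes G: "cubic G" and v: "has_value G (e # es) C v"
  obtains e1 where "e1 \<noteq> e" "has_value G (e1 # es) C (- v)"
proof -
  obtain dss s where F: "forest_data G (e # es) dss s" and C: "cycle_halves G dss = C"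
      and v: "v = trace_value G dss s"
    using v by (auto simp: has_value_def)
  interpret A: cycle_system G dss using G F by (rule forest_data_cycle_system)
  have AC: "A.C = C" using C by (simp add: A.C_def)
  have "e \<in> set (path_edges G dss)" using forest_data_set[OF F] by auto
  then obtain ds x where ds: "ds \<in> set dss" "x \<in> set (butlast ds)" "e = edge G x"
    by (auto simp: path_edges_def)
  obtain p q where "butlast ds = p @ x # q" using ds(2) by (meson split_list)
  then obtain l where l: "ds = p @ x # q @ [l]"
    using append_butlast_last_id[OF A.nonempty[OF ds(1)]] by (metis append.assoc append_Cons)
  obtain A' B' where dss: "dss = A' @ ds # B'" using ds(1) by (meson split_list)
  \<comment> \<open>The cycle rotated to start behind \<open>x\<close>, so that \<open>e\<close>
    becomes the closing edge and the old closing edge \<open>?e1\<close> a path edge.\<close>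
  let ?ds = "q @ l # p @ [x]"
  let ?dss = "A' @ ?ds # B'"
  let ?e1 = "edge G l"
  have e1: "?e1 \<notin> set (e # es)" using F ds(1) l by (auto simp: forest_data_def)
  have dist: "e \<notin> set es" using forest_data_distinct[OF G F] by simp
  have ee: "?e1 \<noteq> e" using e1 by auto
  have rot: "?ds = rotate (length (p @ [x])) ds"
    using rotate_append[of "p @ [x]" "q @ [l]"] by (simp add: l)
  have mem: "set (concat ?dss) = set (concat dss)" by (auto simp: dss l)
  have "mset (map (vert G) (concat ?dss)) = mset (map (vert G) (concat dss))"
    by (simp add: dss l ac_simps)
  then have dm: "distinct (map (vert G) (concat ?dss))"
    using A.cyc mset_eq_imp_distinct_iff unfolding cyc_sys_def by blast
  have cl: "closed_path G ?ds \<and> odd (length ?ds)"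
    using closed_path_rotate[OF A.closed[OF ds(1)], of "length (p @ [x])"] A.odd_length[OF ds(1)]
    unfolding rot by simp
  have cyc: "cyc_sys G ?dss"
    unfolding cyc_sys_def mem
  proof (intro conjI ballI)
    fix ds' assume "ds' \<in> set ?dss"
    then have "ds' = ?ds \<or> ds' \<in> set dss" by (auto simp: dss)
    then show "closed_path G ds'" "odd (length ds')" using cl A.closed A.odd_length by auto
  qed (use dm A.cyc in \<open>auto simp: cyc_sys_def\<close>)
  interpret B: cycle_system G ?dss using G cyc by (simp add: cycle_system_def)
  have C': "cycle_halves G ?dss = C" unfolding C[symmetric] cycle_halves_def mem ..
  have closing: "edge G (last ds') \<notin> set (?e1 # es)" if ds': "ds' \<in> set ?dss" for ds'
  proof (cases "ds' = ?ds")
    case True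
    then show ?thesis using ee dist ds(3) by auto
  next
    case False
    then have "ds' \<in> set A' \<union> set B'" using ds' by auto
    moreover have "ds \<notin> set A' \<union> set B'" using A.distinct_dss by (auto simp: dss)
    ultimately have "ds' \<in> set dss" "ds' \<noteq> ds" by (auto simp: dss)
    then have "edge G (last ds') \<noteq> edge G (last ds)" "edge G (last ds') \<notin> set (e # es)"
      using A.last_edge_unique[OF _ ds(1)] F by (auto simp: forest_data_def)
    then show ?thesis using l by simp
  qed
  define P where "P = path_edges G A'"
  define Q where "Q = path_edges G B'"
  define X where "X = map (edge G) p"
  define Y where "Y = map (edge G) q"
  have bl: "butlast ds = p @ x # q" "butlast ?ds = q @ l # p" by (simp_all add: l butlast_append)
  have pe: "path_edges G dss = (P @ X) @ e # Y @ Q"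
    unfolding dss path_edges_append[of G A'] path_edges_append[of G "[_]" B', simplified]
    by (simp add: path_edges_def P_def Q_def X_def Y_def bl ds(3))
  have pe': "path_edges G ?dss = (P @ Y) @ ?e1 # X @ Q"
    unfolding path_edges_append[of G A'] path_edges_append[of G "[_]" B', simplified]
    by (simp add: path_edges_def P_def Q_def X_def Y_def bl)
  have par: "odd (length X + length Y)" using A.odd_length[OF ds(1)] by (simp add: l X_def Y_def)
  have "srel (e # es) (path_edges G dss) s" using F by (simp add: forest_data_def)
  moreover have "srel (path_edges G dss) (e # P @ X @ Y @ Q) ((-1) ^ (length P + length X))"
    using srel_append_right[OF srel_sym[OF srel_move[of e "P @ X"]], of "Y @ Q"] by (simp add: pe)
  ultimately have 1: "srel (e # es) (e # P @ X @ Y @ Q) (s * (-1) ^ (length P + length X))"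
    by (rule srel_trans)
  \<comment> \<open>Both orderings in \<open>1\<close> start with \<open>e\<close>, which occurs
    nowhere else; renaming it to \<open>?e1\<close> turns the comparison for one forest into that
    for the other.\<close>
  let ?f = "id(e := ?e1)"
  have "distinct (path_edges G dss)" by (rule A.distinct_path_edges)
  then have "e \<notin> set (P @ X @ Y @ Q)" by (auto simp: pe)
  then have "map ?f (P @ X @ Y @ Q) = P @ X @ Y @ Q" "map ?f es = es"
    using dist by (intro map_idI; auto)+
  then have 2: "srel (?e1 # es) (?e1 # P @ X @ Y @ Q) (s * (-1) ^ (length P + length X))"
    using srel_map[OF 1, of ?f] by simp
  \<comment> \<open>The cycle has \<open>length X + length Y + 2\<close> edges, an odd number; so
    one of the two segments has even length and they commute without sign.\<close>
  have "even (length X * length Y)" using par by auto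
  then have "srel (X @ Y) (Y @ X) 1" using srel_swap[of X Y] by simp
  from srel_append_left[OF srel_append_right[OF this, of Q], of "?e1 # P"]
  have 3: "srel (?e1 # P @ X @ Y @ Q) (?e1 # P @ Y @ X @ Q) 1" by simp
  have 4: "srel (?e1 # P @ Y @ X @ Q) (path_edges G ?dss) ((-1) ^ (length P + length Y))"
    using srel_append_right[OF srel_move[of ?e1 "P @ Y"], of "X @ Q"] by (simp add: pe')
  have "srel (?e1 # es) (path_edges G ?dss) (s * (-1) ^ (length P + length X) * 1 * (-1) ^ (length P + length Y))"
    by (rule srel_trans[OF srel_trans[OF 2 3] 4])
  \<comment> \<open>\<open>e\<close> passes over \<open>P\<close> and \<open>X\<close>, while
    \<open>?e1\<close> passes over \<open>P\<close> and \<open>Y\<close>; \<open>P\<close> counts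
    twice, and \<open>length X + length Y\<close> is odd.\<close>
  also have "s * (-1) ^ (length P + length X) * 1 * (-1) ^ (length P + length Y) = - s"
  proof -
    have "(-1 :: int) ^ (length P + length X) * (-1) ^ (length P + length Y) = -1"
      unfolding power_add[symmetric] using par by simp
    then show ?thesis by (simp only: mult.assoc mult_1_left mult_minus1_right)
  qed
  finally have F': "forest_data G (?e1 # es) ?dss (- s)"
    unfolding forest_data_def using cyc closing by blast
  have "oclass (collapse G ?dss) = cscale (of_int (\<Prod>i<length dss. 1)) (oclass (collapse G dss))"
  proof (rule A.oclass_collapse_reorder[OF B.cycle_system_axioms])
    show "cycle_halves G ?dss = A.C" using C' AC by simp
    show "length ?dss = length dss" by (simp add: dss)
    fix i assume i: "i < length dss"
    show "srel (map (vert G) (dss ! i)) (map (vert G) (?dss ! i)) 1"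
    proof (cases "i = length A'")
      case True
      have "even (length (p @ [x]) * length (q @ [l]))" using par by (auto simp: X_def Y_def)
      then have "srel ((p @ [x]) @ (q @ [l])) ((q @ [l]) @ (p @ [x])) 1"
        using srel_swap[of "p @ [x]" "q @ [l]"] by (simp only: neg_one_even_power)
      from srel_map[OF this, of "vert G"] show ?thesis unfolding True by (simp add: dss l nth_append)
    next
      case False
      then have "?dss ! i = dss ! i" by (auto simp: dss nth_append nth_Cons')
      then show ?thesis by (simp add: srel_refl)
    qed
  qed
  then have "trace_value G ?dss (- s) = - v" by (simp add: trace_value_def v dss)
  then have "has_value G (?e1 # es) C (- v)" using F' C' unfolding has_value_def by metis
  then show thesis using that ee by blast
qed

text \<open>The only possible partner is the closing edge of the cycle through \<open>e\<close>. It
  must close some cycle of the given system; were that another cycle, all of its edges would belong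
  to the new forest.\<close>

lemma has_value_closing_unique:
  assumes G: "cubic G" and v: "has_value G (e # es) C v"
    and v1: "has_value G (e1 # es) C v1" and v2: "has_value G (e2 # es) C v2" and ne: "e1 \<noteq> e" "e2 \<noteq> e"
  shows "e1 = e2"
proof -
  obtain dss s where F: "forest_data G (e # es) dss s" and C: "cycle_halves G dss = C"
    using v by (auto simp: has_value_def)
  interpret A: cycle_system G dss using G F by (rule forest_data_cycle_system)
  have AC: "A.C = C" using C by (simp add: A.C_def)
  have "e \<in> set (path_edges G dss)" using forest_data_set[OF F] by auto
  then obtain ds x where ds: "ds \<in> set dss" "x \<in> set (butlast ds)" "e = edge G x"
    by (auto simp: path_edges_def)
  have *: "e1 = edge G (last ds)" if v1: "has_value G (e1 # es) C v1" and ne: "e1 \<noteq> e" for e1 v1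
  proof -
    obtain dss1 s1 where F1: "forest_data G (e1 # es) dss1 s1" and C1: "cycle_halves G dss1 = C"
      using v1 by (auto simp: has_value_def)
    interpret B: cycle_system G dss1 using G F1 by (rule forest_data_cycle_system)
    have BC: "B.C = C" using C1 by (simp add: B.C_def)
    have e1: "e1 \<in> set (path_edges G dss1)" using forest_data_set[OF F1] by auto
    then have "e1 \<in> edges G" "e1 \<subseteq> C" using B.path_edges_edges B.path_edges_C BC by blast+
    then obtain h where h: "h \<in> A.C" "edge G h = e1" using AC by (auto simp: edges_def edge_def)
    have nes: "e1 \<notin> set (e # es)" using forest_data_distinct[OF G F1] ne by simp
    obtain ds2 where ds2: "ds2 \<in> set dss" "edge G (last ds2) = e1"
      using A.closing_edge[OF F h(1)] h(2) nes by blast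
    \<comment> \<open>A cycle avoiding \<open>e\<close> has all its path edges in \<open>es\<close>;
      with \<open>e1\<close> as closing edge it would be a closed walk inside the forest
      \<open>e1 # es\<close>.\<close>
    have "ds2 = ds"
    proof (rule ccontr)
      assume "ds2 \<noteq> ds"
      have "edge G d \<in> set (e1 # es)" if d: "d \<in> set ds2" for d
      proof (cases "d = last ds2")
        case True
        then show ?thesis using ds2(2) by simp
      next
        case False
        have "ds2 = butlast ds2 @ [last ds2]" using A.nonempty[OF ds2(1)] by simp
        then have "set ds2 = insert (last ds2) (set (butlast ds2))"
          by (metis Un_insert_right append_Nil2 list.set(1) list.simps(15) set_append sup_bot.right_neutral)
        then have "d \<in> set (butlast ds2)" using d False by blast
        then have "edge G d \<in> set (path_edges G dss)" using ds2(1) by (auto simp: path_edges_def)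
        then have "edge G d \<in> set (e # es)" using forest_data_set[OF F] by simp
        moreover have "edge G d \<noteq> e"
        proof
          assume "edge G d = e"
          have x: "x \<in> set ds" using ds(2) by (rule in_set_butlastD)
          then have "d = x" using \<open>edge G d = e\<close> ds(3)
            by (intro A.edge_inj_D[OF A.D_I[OF ds2(1) d] A.D_I[OF ds(1) x]]) simp
          then show False using A.disjoint_ds[OF ds2(1) ds(1) d] x \<open>ds2 \<noteq> ds\<close> by blast
        qed
        ultimately show ?thesis by simp
      qed
      then have "edge G ` set ds2 \<subseteq> set (path_edges G dss1)" using forest_data_set[OF F1] by auto
      moreover have "distinct (map (edge G) ds2)"
        using A.distinct_ds[OF ds2(1)] A.edge_inj_D A.D_I[OF ds2(1)]
        by (auto simp: distinct_map intro!: inj_onI)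
      ultimately show False
        using B.acyclic_path_edges A.closed[OF ds2(1)] unfolding acyclic_edges_def closed_path_iff by blast
    qed
    then show ?thesis using ds2(2) by simp
  qed
  show ?thesis using *[OF v1 ne(1)] *[OF v2 ne(2)] by simp
qed

lemma has_value_forested:
  assumes "cubic G" "has_value G es C v"
  shows "distinct es" "set es \<subseteq> edges G" "acyclic_edges G (set es)"
proof -
  obtain dss s where F: "forest_data G es dss s" using assms(2) by (auto simp: has_value_def)
  interpret A: cycle_system G dss using assms(1) F by (rule forest_data_cycle_system)
  show "distinct es" by (rule forest_data_distinct[OF assms(1) F])
  show "set es \<subseteq> edges G" "acyclic_edges G (set es)"
    using A.path_edges_edges A.acyclic_path_edges forest_data_set[OF F] by simp_all
qed

text \<open>\<open>R\<close> pairs an edge with the one that can take its place on the same cycles.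
  Reindexing the sum over the non-zero terms along this pairing turns it into its own
  negative.\<close>

lemma sum_tval_boundary:
  assumes G: "cubic G"
  shows "(\<Sum>e | e \<in> edges G - set es \<and> acyclic_edges G (insert e (set es)). tval G (e # es)) = 0"
proof -
  let ?A = "{e \<in> edges G - set es. acyclic_edges G (insert e (set es))}"
  let ?g = "\<lambda>e. tval G (e # es)"
  let ?S = "{e \<in> ?A. ?g e \<noteq> 0}"
  define R where "R e e1 \<longleftrightarrow> (\<exists>C v. v \<noteq> 0 \<and> has_value G (e # es) C v \<and> e1 \<noteq> e \<and> has_value G (e1 # es) C (- v))" for e e1
  have "finite (edges G)" using G by (auto simp: edges_def cubic_def is_graph_def)
  then have fin: "finite ?A" by simp
  have R_sym: "R e1 e" if "R e e1" for e e1
  proof -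
    obtain C v where "v \<noteq> 0" "has_value G (e # es) C v" "e1 \<noteq> e" "has_value G (e1 # es) C (- v)"
      using \<open>R e e1\<close> unfolding R_def by blast
    then show ?thesis unfolding R_def by (intro exI[of _ C] exI[of _ "- v"]) simp
  qed
  have unique: "e1 = e2" if "R e e1" "R e e2" for e e1 e2
  proof -
    obtain C v where 1: "v \<noteq> 0" "has_value G (e # es) C v" "e1 \<noteq> e" "has_value G (e1 # es) C (- v)"
      using \<open>R e e1\<close> unfolding R_def by blast
    obtain C' v' where 2: "v' \<noteq> 0" "has_value G (e # es) C' v'" "e2 \<noteq> e" "has_value G (e2 # es) C' (- v')"
      using \<open>R e e2\<close> unfolding R_def by blast
    \<comment> \<open>A non-zero value determines \<open>C\<close> and thereby the partner; this is
      why \<open>R\<close> is restricted to non-zero values.\<close>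
    have "C = C'" using has_value_unique(2)[OF G 1(2) 2(2)] 1(1) by blast
    then show ?thesis using has_value_closing_unique[OF G 1(2) 1(4) _ 1(3) 2(3)] 2(4) by blast
  qed
  have val: "?g e1 = - ?g e" if "R e e1" for e e1
  proof -
    obtain C v where "v \<noteq> 0" "has_value G (e # es) C v" "e1 \<noteq> e" "has_value G (e1 # es) C (- v)"
      using \<open>R e e1\<close> unfolding R_def by blast
    then show ?thesis using tval_eq[OF G] by simp
  qed
  have S: "e \<in> ?S" if "R e e1" for e e1
  proof -
    obtain C v where v: "v \<noteq> 0" "has_value G (e # es) C v" using \<open>R e e1\<close> unfolding R_def by blast
    then show ?thesis using has_value_forested[OF G v(2)] tval_eq[OF G v(2)] by auto
  qed
  have ex: "\<exists>e1. R e e1" if "e \<in> ?S" for e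
  proof -
    have "?g e \<noteq> 0" using that by simp
    then obtain C v where v: "has_value G (e # es) C v" using tval_zero by blast
    have "v \<noteq> 0" using tval_eq[OF G v] \<open>?g e \<noteq> 0\<close> by simp
    obtain e1 where "e1 \<noteq> e" "has_value G (e1 # es) C (- v)" by (rule has_value_closing[OF G v])
    then show ?thesis using v \<open>v \<noteq> 0\<close> unfolding R_def by blast
  qed
  define \<iota> where "\<iota> e = (SOME e1. R e e1)" for e
  have \<iota>: "R e (\<iota> e)" if "e \<in> ?S" for e using ex[OF that] unfolding \<iota>_def by (rule someI_ex)
  have inv: "\<iota> e \<in> ?S" "\<iota> (\<iota> e) = e" if e: "e \<in> ?S" for e
  proof -
    show 1: "\<iota> e \<in> ?S" using S[OF R_sym[OF \<iota>[OF e]]] .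
    show "\<iota> (\<iota> e) = e" by (rule unique[OF \<iota>[OF 1] R_sym[OF \<iota>[OF e]]])
  qed
  have "bij_betw \<iota> ?S ?S" by (rule bij_betw_byWitness[of _ \<iota>]) (use inv in blast)+
  from sum.reindex_bij_betw[OF this, of ?g] have "sum ?g ?S = (\<Sum>e\<in>?S. ?g (\<iota> e))" by (rule sym)
  also have "\<dots> = (\<Sum>e\<in>?S. - ?g e)" by (rule sum.cong[OF refl]) (rule val[OF \<iota>])
  also have "\<dots> = cscale (of_int (-1)) (sum ?g ?S)" by (simp add: sum_negf)
  finally have "sum ?g ?S = 0" by (rule cG_self_neg_zero)
  moreover have "sum ?g ?A = sum ?g ?S" using fin by (intro sum.mono_neutral_right) auto
  ultimately show ?thesis by simp
qed

section \<open>Existence of the graphical trace\<close>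

lemma is_forested_graph_Rep: "is_forested_graph (fgraph x, forest x)"
  using Rep_forested_graph[of x] by simp

lemma Rep_Abs_forested: "is_forested_graph X \<Longrightarrow> Rep_forested_graph (Abs_forested_graph X) = X"
  by (simp add: Abs_forested_graph_inverse)

lemma forestedD:
  shows "cubic (fgraph x)" "distinct (forest x)" "set (forest x) \<subseteq> edges (fgraph x)"
    "acyclic_edges (fgraph x) (set (forest x))"
  using is_forested_graph_Rep[of x] unfolding is_forested_graph_def cubic_def by blast+

lemma is_graph_fgraph: "is_graph (fgraph x)"
  using forestedD(1) by (simp add: cubic_def)

lemma tval_reorder:
  assumes "cubic G" "srel es es' t"
  shows "tval G es' = cscale (of_int t) (tval G es)"
proof (cases "\<exists>C v. has_value G es C v")
  case True
  then obtain C v where v: "has_value G es C v" by blast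
  show ?thesis using tval_eq[OF assms(1) v] tval_eq[OF assms(1) has_value_reorder[OF v assms(2)]] by simp
next
  case False
  then have "\<nexists>C v. has_value G es' C v" using has_value_reorder[OF _ srel_sym[OF assms(2)]] by blast
  then show ?thesis using False by (simp add: tval_def)
qed

text \<open>Used to carry the absence of a value across an isomorphism.\<close>

lemma forested_iso_sym:
  assumes "forested_iso x y"
  shows "forested_iso y x"
proof -
  obtain \<phi> where \<phi>: "graph_iso \<phi> (fgraph x) (fgraph y)" "forest y = map ((`) \<phi>) (forest x)"
    using assms by (auto simp: forested_iso_def)
  let ?\<psi> = "inv_into (halves (fgraph x)) \<phi>"
  have inj: "inj_on \<phi> (halves (fgraph x))" using \<phi>(1) by (auto simp: graph_iso_def bij_betw_def)
  have "?\<psi> ` (\<phi> ` f) = f" if "f \<in> set (forest x)" for f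
  proof -
    have "f \<subseteq> halves (fgraph x)"
      using that forestedD(3)[of x] is_graphD(2)[OF is_graph_fgraph] by (auto simp: edges_def edge_def)
    then show ?thesis using inj by (simp add: inv_into_image_cancel)
  qed
  then have "map ((`) ?\<psi>) (forest y) = forest x" unfolding \<phi>(2) map_map by (intro map_idI) simp
  then show ?thesis
    using graph_iso_sym[OF \<phi>(1) is_graph_fgraph] unfolding forested_iso_def by metis
qed

lemma tval_iso:
  assumes "forested_iso x y"
  shows "tval (fgraph x) (forest x) = tval (fgraph y) (forest y)"
proof -
  have 1: "has_value (fgraph y) (forest y) (\<phi> ` C) v"
    if "has_value (fgraph x) (forest x) C v" "graph_iso \<phi> (fgraph x) (fgraph y)" "forest y = map ((`) \<phi>) (forest x)"
    for x y \<phi> C v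
    using has_value_iso[OF forestedD(1) forestedD(1) that(2,1)] that(3) by simp
  have ex: "\<exists>C'. has_value (fgraph y) (forest y) C' v"
    if "has_value (fgraph x) (forest x) C v" "forested_iso x y" for x y C v
    using 1[OF that(1)] that(2) unfolding forested_iso_def by blast
  show ?thesis
  proof (cases "\<exists>C v. has_value (fgraph x) (forest x) C v")
    case True
    then obtain C v where v: "has_value (fgraph x) (forest x) C v" by blast
    obtain C' where v': "has_value (fgraph y) (forest y) C' v" using ex[OF v assms] by blast
    show ?thesis using tval_eq[OF forestedD(1) v] tval_eq[OF forestedD(1) v'] by simp
  next
    case False
    then have "\<nexists>C v. has_value (fgraph y) (forest y) C v"
      using ex[OF _ forested_iso_sym[OF assms]] by blast
    then show ?thesis using False by (simp add: tval_def)
  qed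
qed

lemma tval_separating:
  assumes "cubic G" "has_separating_edge G"
  shows "tval G es = 0"
proof (cases "\<exists>C v. has_value G es C v")
  case True
  then obtain C v where v: "has_value G es C v" by blast
  obtain dss s where F: "forest_data G es dss s" "v = trace_value G dss s"
    using v by (auto simp: has_value_def)
  interpret A: cycle_system G dss using assms(1) F(1) by (rule forest_data_cycle_system)
  have "oclass (A.\<Gamma>, snd (collapse G dss)) = 0"
    using A.separating_collapse[OF assms(2)] A.is_odd_graph_collapse
    by (intro oclass_separating) (simp_all only: prod.collapse)
  then have "v = 0" unfolding F(2) trace_value_def by (simp only: prod.collapse cG.scale_zero_right)
  then show ?thesis using tval_eq[OF assms(1) v] by simp
qed (simp add: tval_def)

text \<open>The ends of the edge differ because a loop in the forest would be a closed walk of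
  length 1, and the six half-edges are distinct because each of the two stars has three
  elements.\<close>

lemma ihx_triple_site:
  assumes "ihx_triple x y z"
  obtains h a b c d where "ihx_site (fgraph x) h a b c d" "edge (fgraph x) h \<in> set (forest x)"
    "fgraph y = exchange b c (fgraph x)" "forest y = forest x"
    "fgraph z = exchange b d (fgraph x)" "forest z = forest x"
proof -
  let ?G = "fgraph x"
  obtain h a b c d where h: "h \<in> halves ?G" "edge ?G h \<in> set (forest x)"
      and st: "star ?G (vert ?G h) = {h, a, b}" "star ?G (vert ?G (opp ?G h)) = {opp ?G h, c, d}"
      and yz: "Rep_forested_graph y = (exchange b c ?G, forest x)" "Rep_forested_graph z = (exchange b d ?G, forest x)"
    using assms unfolding ihx_triple_def by blast
  have G: "is_graph ?G" by (rule is_graph_fgraph)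
  have o: "opp ?G h \<in> halves ?G" using is_graphD(2)[OF G h(1)] .
  have ne: "vert ?G h \<noteq> vert ?G (opp ?G h)"
  proof
    assume "vert ?G h = vert ?G (opp ?G h)"
    then have "\<not> acyclic_edges ?G (set (forest x))"
      unfolding acyclic_edges_def using h by (auto intro!: exI[of _ "[h]"])
    then show False using forestedD(4) by blast
  qed
  have c3: "card (star ?G v) = 3" if "v \<in> verts ?G" for v
    using forestedD(1)[of x] that by (simp add: cubic_def valence_def)
  have 1: "k \<in> halves ?G \<and> vert ?G k = vert ?G h \<longleftrightarrow> k = h \<or> k = a \<or> k = b" for k
    using st(1) unfolding star_def by blast
  have 2: "k \<in> halves ?G \<and> vert ?G k = vert ?G (opp ?G h) \<longleftrightarrow> k = opp ?G h \<or> k = c \<or> k = d" for k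
    using st(2) unfolding star_def by blast
  have "card {h, a, b} = 3" "card {opp ?G h, c, d} = 3"
    using c3[of "vert ?G h"] c3[of "vert ?G (opp ?G h)"] st h(1) o by (simp_all add: verts_def)
  then have dist: "h \<noteq> a \<and> h \<noteq> b \<and> a \<noteq> b" "opp ?G h \<noteq> c \<and> opp ?G h \<noteq> d \<and> c \<noteq> d"
    by (auto simp: card_insert_if split: if_splits)
  have "vert ?G a = vert ?G h" "vert ?G b = vert ?G h" using 1[of a] 1[of b] by auto
  moreover have "vert ?G c = vert ?G (opp ?G h)" "vert ?G d = vert ?G (opp ?G h)" using 2[of c] 2[of d] by auto
  ultimately have "distinct [h, a, b, opp ?G h, c, d]" using dist ne by auto
  then have "ihx_site ?G h a b c d" unfolding ihx_site_def using h(1) ne 1 2 by blast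
  then show thesis using that h(2) yz by simp
qed

text \<open>That the trace is well defined comes down to one property of \<open>tval\<close> for
  each of the four families of relations.\<close>

lemma linear_trace_exists:
  obtains T where "Vector_Spaces.linear fscale cscale T" "\<And>x. T (fclass x) = tval (fgraph x) (forest x)"
proof -
  let ?g = "\<lambda>x. tval (fgraph x) (forest x)"
  note vs = cG.vector_space_axioms
  have "lin_ext cscale ?g r = 0" if r: "r \<in> forested_relations" for r
  proof -
    consider (iso) x y where "r = gen x - gen y" "forested_iso x y"
      | (sign) x y p where "r = gen y - free_scale (of_int (sign p)) (gen x)" "fgraph y = fgraph x"
          "p permutes {..<length (forest x)}" "forest y = permute_list p (forest x)"
      | (sep) x where "r = gen x" "has_separating_edge (fgraph x)"
      | (ihx) x y z where "r = gen x + gen y + gen z" "ihx_triple x y z"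
      using r unfolding forested_relations_def by blast
    then show ?thesis
    proof cases
      case iso
      then show ?thesis using tval_iso[OF iso(2)] by (simp add: lin_ext_gen_diff(2)[OF vs])
    next
      case sign
      have "srel (forest x) (forest y) (sign p)" using sign by (auto intro: srelI)
      from tval_reorder[OF forestedD(1) this] show ?thesis
        unfolding sign(1) lin_ext_gen_diff(1)[OF vs] sign(2) by simp
    next
      case sep
      then show ?thesis using tval_separating[OF forestedD(1)] by (simp add: lin_ext_gen_diff(3)[OF vs])
    next
      case ihx
      obtain h a b c d where q: "ihx_site (fgraph x) h a b c d" "edge (fgraph x) h \<in> set (forest x)"
        "fgraph y = exchange b c (fgraph x)" "forest y = forest x"
        "fgraph z = exchange b d (fgraph x)" "forest z = forest x"
        using ihx(2) by (rule ihx_triple_site)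
      have "?g x + ?g y + ?g z = 0"
        using tval_ihx[OF forestedD(1) _ _ q(1,2)] forestedD(1)[of y] forestedD(1)[of z]
        by (simp add: q(3-6))
      then show ?thesis
        by (simp add: ihx(1) lin_ext_add[OF vs] lin_ext_gen_diff(3)[OF vs])
    qed
  qed
  then show thesis using fG_linear_exists[OF vs] that by blast
qed

lemma trace_data_forest_data:
  assumes "trace_data x dss p"
  shows "forest_data (fgraph x) (forest x) dss (sign p)"
  using assms unfolding trace_data_def forest_data_def cyc_sys_def path_edges_def
  by (auto intro: srelI)

lemma forest_data_trace_data:
  assumes "forest_data (fgraph x) (forest x) dss s"
  obtains p where "trace_data x dss p"
proof -
  obtain p where "p permutes {..<length (forest x)}" "permute_list p (forest x) = path_edges (fgraph x) dss"
    using assms unfolding forest_data_def by (blast elim: srelE)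
  then have "trace_data x dss p"
    using assms unfolding trace_data_def forest_data_def cyc_sys_def path_edges_def by blast
  then show thesis by (rule that)
qed

definition is_trace :: "(fG \<Rightarrow> cG) \<Rightarrow> bool" where
  "is_trace T \<longleftrightarrow> Vector_Spaces.linear fscale cscale T \<and>
     (\<forall>x. (\<forall>dss p. trace_data x dss p \<longrightarrow>
             T (fclass x) = cscale (of_int (sign p) * (- 2) ^ length dss)
                              (cclass (Abs_odd_graph (collapse (fgraph x) dss)))) \<and>
          ((\<nexists>dss p. trace_data x dss p) \<longrightarrow> T (fclass x) = 0))"

text \<open>Replaces the quantification over all trace data by prescribed values on generators,
  which determine a linear map.\<close>

lemma is_trace_iff:
  "is_trace T \<longleftrightarrow> Vector_Spaces.linear fscale cscale T \<and> (\<forall>x. T (fclass x) = tval (fgraph x) (forest x))"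
proof -
  have val: "cscale (of_int (sign p) * (- 2) ^ length dss) (cclass (Abs_odd_graph (collapse (fgraph x) dss)))
      = tval (fgraph x) (forest x)" if "trace_data x dss p" for x dss p
  proof -
    have "has_value (fgraph x) (forest x) (cycle_halves (fgraph x) dss) (trace_value (fgraph x) dss (sign p))"
      using trace_data_forest_data[OF that] unfolding has_value_def by blast
    from tval_eq[OF forestedD(1) this] show ?thesis by (simp add: trace_value_def oclass_def)
  qed
  have zero: "tval (fgraph x) (forest x) = 0" if n: "\<nexists>dss p. trace_data x dss p" for x
  proof (rule tval_zero)
    fix C v assume "has_value (fgraph x) (forest x) C v"
    then obtain dss s where "forest_data (fgraph x) (forest x) dss s" by (auto simp: has_value_def)
    then show False using n by (blast elim: forest_data_trace_data)
  qed
  show ?thesis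
  proof
    assume T: "is_trace T"
    have "T (fclass x) = tval (fgraph x) (forest x)" for x
    proof (cases "\<exists>dss p. trace_data x dss p")
      case True
      then obtain dss p where d: "trace_data x dss p" by blast
      then show ?thesis using T val[OF d] by (simp add: is_trace_def)
    next
      case False
      then show ?thesis using T zero by (simp add: is_trace_def)
    qed
    then show "Vector_Spaces.linear fscale cscale T \<and> (\<forall>x. T (fclass x) = tval (fgraph x) (forest x))"
      using T by (simp add: is_trace_def)
  next
    assume "Vector_Spaces.linear fscale cscale T \<and> (\<forall>x. T (fclass x) = tval (fgraph x) (forest x))"
    then show "is_trace T" unfolding is_trace_def using val zero by simp
  qed
qed

lemma graphical_trace:
  "Vector_Spaces.linear fscale cscale graphical_trace"
  "graphical_trace (fclass x) = tval (fgraph x) (forest x)"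
proof -
  obtain T where T: "is_trace T" using linear_trace_exists is_trace_iff by metis
  have "T' = T" if "is_trace T'" for T'
    using T that by (intro fG_linear_unique[OF cG.vector_space_axioms]) (simp_all add: is_trace_iff)
  with T have "(THE T. is_trace T) = T" by (rule the_equality)
  then have "graphical_trace = T" by (simp add: graphical_trace_def is_trace_def)
  then have "is_trace graphical_trace" using T by simp
  then show "Vector_Spaces.linear fscale cscale graphical_trace"
    "graphical_trace (fclass x) = tval (fgraph x) (forest x)"
    by (simp_all add: is_trace_iff)
qed

lemma graphical_trace_boundary: "graphical_trace (boundary x) = 0"
proof -
  interpret L: Vector_Spaces.linear fscale cscale graphical_trace by (rule graphical_trace(1))
  have "graphical_trace (boundary x) = (\<Sum>e | e \<in> edges (fgraph x) - set (forest x) \<and>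
      acyclic_edges (fgraph x) (insert e (set (forest x))). tval (fgraph x) (e # forest x))"
    unfolding boundary_def L.sum
  proof (rule sum.cong[OF refl])
    fix e assume e: "e \<in> {e. e \<in> edges (fgraph x) - set (forest x) \<and>
        acyclic_edges (fgraph x) (insert e (set (forest x)))}"
    have "is_forested_graph (fgraph x, e # forest x)"
      using is_forested_graph_Rep[of x] e by (auto simp: is_forested_graph_def)
    then show "graphical_trace (fclass (Abs_forested_graph (fgraph x, e # forest x))) = tval (fgraph x) (e # forest x)"
      by (simp add: graphical_trace(2) Rep_Abs_forested)
  qed
  then show ?thesis using sum_tval_boundary[OF forestedD(1)] by simp
qed

lemma cocycle_mu:
  assumes "cclass \<Theta> \<noteq> 0"
  shows "cocycle (\<mu> \<Theta>)"
proof -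
  have P: "Vector_Spaces.linear cscale (*) (projection \<Theta>)"
    using is_projection_projection[OF assms] by (simp add: is_projection_def)
  interpret P: Vector_Spaces.linear cscale "(*)" "projection \<Theta>" by (rule P)
  have "Vector_Spaces.linear fscale (*) (projection \<Theta> \<circ> graphical_trace)"
    by (rule Vector_Spaces.linear_compose[OF graphical_trace(1) P])
  then show ?thesis unfolding cocycle_def \<mu>_def by (simp add: graphical_trace_boundary P.zero)
qed

section \<open>Blowing up the vertices of an odd graph to cycles\<close>

lemma mod3_simps:
  fixes h k :: nat
  shows "(3 * h) div 3 = h" "(3 * h + 1) div 3 = h" "(3 * h + 2) div 3 = h"
    "(3 * h) mod 3 = 0" "(3 * h + 1) mod 3 = 1" "(3 * h + 2) mod 3 = 2"
    "3 * h \<noteq> 3 * k + 1" "3 * h \<noteq> 3 * k + 2" "3 * h + 1 \<noteq> 3 * k + 2"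
    "3 * h + 1 \<noteq> 3 * k" "3 * h + 2 \<noteq> 3 * k" "3 * h + 2 \<noteq> 3 * k + 1"
  by presburger+

locale odd_oriented =
  fixes A :: graph and oa :: "nat \<Rightarrow> nat list"
  assumes odd_graph: "is_odd_graph (A, oa)"
begin

lemma graph_A: "is_graph A"
  using odd_graph by (simp add: is_odd_graph_def)

lemmas A = is_graphD[OF graph_A]

lemma oa: "v \<in> verts A \<Longrightarrow> distinct (oa v)" "v \<in> verts A \<Longrightarrow> set (oa v) = star A v"
  using odd_graph by (auto simp: is_odd_graph_def)

lemma odd_oa: "v \<in> verts A \<Longrightarrow> odd (length (oa v))"
  using odd_graph oa distinct_card[of "oa v"] by (auto simp: is_odd_graph_def valence_def)

lemma oa_nth:
  assumes "v \<in> verts A" "j < length (oa v)"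
  shows "oa v ! j \<in> halves A" "vert A (oa v ! j) = v"
  using nth_mem[OF assms(2)] oa(2)[OF assms(1)] by (auto simp: star_def)

lemma oa_ex:
  assumes "h \<in> halves A"
  obtains j where "j < length (oa (vert A h))" "oa (vert A h) ! j = h"
proof -
  have "vert A h \<in> verts A" using assms by (simp add: verts_def)
  then have "h \<in> set (oa (vert A h))" using assms oa(2) by (simp add: star_def)
  then show thesis using that by (auto simp: in_set_conv_nth)
qed

definition pos :: "nat \<Rightarrow> nat" where
  "pos h = (THE j. j < length (oa (vert A h)) \<and> oa (vert A h) ! j = h)"

text \<open>The cyclic successor in the ordering at the vertex: it closes the linear orientation up
  into the cycle that replaces the vertex.\<close>

definition sc :: "nat \<Rightarrow> nat" where
  "sc h = oa (vert A h) ! (Suc (pos h) mod length (oa (vert A h)))"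

definition pd :: "nat \<Rightarrow> nat" where
  "pd = inv_into (halves A) sc"

lemma sc_nth:
  assumes v: "v \<in> verts A" and j: "j < length (oa v)"
  shows "sc (oa v ! j) = oa v ! (Suc j mod length (oa v))"
proof -
  have "pos (oa v ! j) = j"
    unfolding pos_def oa_nth(2)[OF v j]
    using nth_eq_iff_index_eq[OF oa(1)[OF v]] j by (intro the_equality) auto
  then show ?thesis by (simp add: sc_def oa_nth(2)[OF v j])
qed

lemma sc_halves: "h \<in> halves A \<Longrightarrow> sc h \<in> halves A" and vert_sc: "h \<in> halves A \<Longrightarrow> vert A (sc h) = vert A h"
proof -
  have "sc h \<in> halves A \<and> vert A (sc h) = vert A h" if h: "h \<in> halves A"
  proof -
    have v: "vert A h \<in> verts A" using h by (simp add: verts_def)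
    obtain j where j: "j < length (oa (vert A h))" "oa (vert A h) ! j = h" using h by (rule oa_ex)
    have "Suc j mod length (oa (vert A h)) < length (oa (vert A h))" using j(1) by (intro mod_less_divisor) auto
    from oa_nth[OF v this] show ?thesis using sc_nth[OF v j(1)] j(2) by simp
  qed
  then show "h \<in> halves A \<Longrightarrow> sc h \<in> halves A" "h \<in> halves A \<Longrightarrow> vert A (sc h) = vert A h" by blast+
qed

lemma inj_sc: "inj_on sc (halves A)"
proof (rule inj_onI)
  fix h k assume h: "h \<in> halves A" and k: "k \<in> halves A" and eq: "sc h = sc k"
  have vv: "vert A h = vert A k" using vert_sc[OF h] vert_sc[OF k] eq by simp
  let ?L = "oa (vert A h)"
  have v: "vert A h \<in> verts A" using h by (simp add: verts_def)
  obtain i where i: "i < length ?L" "?L ! i = h" using h by (rule oa_ex)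
  obtain j where j: "j < length ?L" "?L ! j = k" using oa_ex[OF k] vv by metis
  have "Suc i mod length ?L < length ?L" "Suc j mod length ?L < length ?L"
    using i(1) by (auto intro: mod_less_divisor)
  then have "Suc i mod length ?L = Suc j mod length ?L"
    using nth_eq_iff_index_eq[OF oa(1)[OF v]] sc_nth[OF v i(1)] sc_nth[OF v j(1)] i(2) j(2) eq by metis
  then have "i = j" using i(1) j(1) by (simp add: mod_Suc split: if_splits)
  then show "h = k" using i j by simp
qed

lemma sc_image: "sc ` halves A = halves A"
  using endo_inj_surj[OF A(1) _ inj_sc] sc_halves by blast

lemma pd: "h \<in> halves A \<Longrightarrow> pd h \<in> halves A" "h \<in> halves A \<Longrightarrow> sc (pd h) = h"
    "h \<in> halves A \<Longrightarrow> pd (sc h) = h"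
  using sc_image inj_sc by (auto simp: pd_def inv_into_into f_inv_into_f)

text \<open>The half-edge \<open>h\<close> becomes the vertex \<open>h\<close>, at which sit \<open>3h\<close>, replacing \<open>h\<close>,
  and \<open>3h + 1\<close> and \<open>3h + 2\<close>, leading to the next and to the previous vertex of the cycle.\<close>

definition G :: graph where
  "G = \<lparr>halves = (\<Union>h\<in>halves A. {3 * h, 3 * h + 1, 3 * h + 2}),
        opp = (\<lambda>k. if k mod 3 = 0 then 3 * opp A (k div 3)
                   else if k mod 3 = 1 then 3 * sc (k div 3) + 2 else 3 * pd (k div 3) + 1),
        vert = (\<lambda>k. k div 3)\<rparr>"

text \<open>The cycles are traversed in the order given by the orientation, from the first half-edge
  to the last, so the edge from the last back to the first is the closing one. The sorting only
  fixes some numbering of the vertices.\<close>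

definition dss :: "nat list list" where
  "dss = map (\<lambda>v. map (\<lambda>h. 3 * h + 1) (oa v)) (sorted_list_of_set (verts A))"

lemma G_simps:
  "opp G (3 * h) = 3 * opp A h" "opp G (3 * h + 1) = 3 * sc h + 2" "opp G (3 * h + 2) = 3 * pd h + 1"
  "vert G (3 * h) = h" "vert G (3 * h + 1) = h" "vert G (3 * h + 2) = h"
  by (simp_all only: G_def graph.simps mod3_simps) simp_all

lemma vert_G: "vert G k = k div 3"
  by (simp add: G_def)

lemma G_halvesE:
  assumes "k \<in> halves G"
  obtains h where "h \<in> halves A" "k = 3 * h" | h where "h \<in> halves A" "k = 3 * h + 1"
    | h where "h \<in> halves A" "k = 3 * h + 2"
  using assms by (auto simp: G_def)

lemma G_halves:
  "h \<in> halves A \<Longrightarrow> 3 * h \<in> halves G" "h \<in> halves A \<Longrightarrow> 3 * h + 1 \<in> halves G"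
  "h \<in> halves A \<Longrightarrow> 3 * h + 2 \<in> halves G"
  by (auto simp: G_def)

lemma is_graph_G: "is_graph G"
  unfolding is_graph_def
proof (intro conjI ballI)
  show "finite (halves G)" using A(1) by (simp add: G_def)
  fix k assume "k \<in> halves G"
  then show "opp G k \<in> halves G" "opp G k \<noteq> k" "opp G (opp G k) = k"
    by (cases rule: G_halvesE; simp only: G_simps pd A mod3_simps not_False_eq_True G_halves sc_halves
        mult_cancel1 zero_neq_numeral numeral_neq_zero simp_thms; fail)+
qed

lemma verts_G: "verts G = halves A"
proof
  show "verts G \<subseteq> halves A"
  proof
    fix v assume "v \<in> verts G"
    then obtain k where k: "k \<in> halves G" "v = vert G k" by (auto simp: verts_def)
    then show "v \<in> halves A" by (cases rule: G_halvesE) (simp_all only: G_simps)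
  qed
  show "halves A \<subseteq> verts G"
  proof
    fix h assume "h \<in> halves A"
    then have "vert G (3 * h) \<in> verts G" unfolding verts_def by (intro imageI G_halves)
    then show "h \<in> verts G" by (simp only: G_simps)
  qed
qed

lemma valence_G:
  assumes "h \<in> halves A"
  shows "valence G h = 3"
proof -
  have "star G h = {3 * h, 3 * h + 1, 3 * h + 2}"
  proof
    show "star G h \<subseteq> {3 * h, 3 * h + 1, 3 * h + 2}"
    proof
      fix k assume "k \<in> star G h"
      then have "k \<in> halves G" "k div 3 = h" by (simp_all add: star_def vert_G)
      then show "k \<in> {3 * h, 3 * h + 1, 3 * h + 2}"
        by (cases rule: G_halvesE) (auto simp only: mod3_simps insert_iff)
    qed
    show "{3 * h, 3 * h + 1, 3 * h + 2} \<subseteq> star G h"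
      using G_halves[OF assms] by (simp only: star_def G_simps insert_subset mem_Collect_eq empty_subsetI simp_thms)
  qed
  then show ?thesis by (simp add: valence_def)
qed

lemma adjacent_G: "k \<in> halves G \<Longrightarrow> adjacent G (edges G) (vert G k) (vert G (opp G k))"
  by (auto simp: adjacent_def edges_def)

lemma adjacent_sc: "h \<in> halves A \<Longrightarrow> adjacent G (edges G) h (sc h)"
  using adjacent_G[OF G_halves(2)] by (simp only: G_simps)

lemma adjacent_opp: "h \<in> halves A \<Longrightarrow> adjacent G (edges G) h (opp A h)"
  using adjacent_G[OF G_halves(1)] by (simp only: G_simps)

text \<open>The half-edges at one vertex of \<open>A\<close> are joined along its cycle, and the two
  halves of an edge of \<open>A\<close> by the copy of that edge; so walks of \<open>A\<close>
  lift.\<close>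

lemma connected_G: "connected_by G (edges G)"
proof -
  let ?R = "(adjacent G (edges G))\<^sup>*\<^sup>*"
  have sym: "?R k h" if "?R h k" for h k
    using symp_rtranclp[OF symp_adjacent[OF is_graph_G]] that by (rule sympD)
  have same: "?R h k" if hk: "h \<in> halves A" "k \<in> halves A" "vert A h = vert A k" for h k
  proof -
    let ?L = "oa (vert A h)"
    have v: "vert A h \<in> verts A" using hk(1) by (simp add: verts_def)
    have base: "?R (?L ! 0) (?L ! j)" if "j < length ?L" for j
      using that
    proof (induction j)
      case (Suc j)
      then have "adjacent G (edges G) (?L ! j) (?L ! Suc j)"
        using adjacent_sc[OF oa_nth(1)[OF v, of j]] sc_nth[OF v, of j] by simp
      then show ?case using Suc by (auto intro: rtranclp.rtrancl_into_rtrancl)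
    qed simp
    obtain i where i: "i < length ?L" "?L ! i = h" using hk(1) by (rule oa_ex)
    obtain j where j: "j < length ?L" "?L ! j = k" using oa_ex[OF hk(2)] hk(3) by metis
    show ?thesis using rtranclp_trans[OF sym[OF base[OF i(1)]] base[OF j(1)]] i(2) j(2) by simp
  qed
  have path: "\<forall>k\<in>halves A. vert A k = w \<longrightarrow> ?R h k" if "(adjacent A (edges A))\<^sup>*\<^sup>* (vert A h) w" "h \<in> halves A" for h w
    using that
  proof (induction rule: rtranclp_induct)
    case base
    then show ?case using same by metis
  next
    case (step w x)
    then obtain l where l: "l \<in> halves A" "vert A l = w" "vert A (opp A l) = x" by (auto simp: adjacent_def)
    have "?R h l" using step l by blast
    then have 1: "?R h (opp A l)" using adjacent_opp[OF l(1)] by (rule rtranclp.rtrancl_into_rtrancl)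
    show ?case
    proof (intro ballI impI)
      fix k assume "k \<in> halves A" "vert A k = x"
      then have "?R (opp A l) k" using l A(2) by (intro same) auto
      with 1 show "?R h k" by (rule rtranclp_trans)
    qed
  qed
  have "connected_by A (edges A)" using odd_graph by (simp add: is_odd_graph_def connected_graph_def)
  then have "?R h k" if "h \<in> halves A" "k \<in> halves A" for h k
    using path[of h "vert A k"] that by (simp add: connected_by_def verts_def)
  then show ?thesis by (simp add: connected_by_def verts_G)
qed

lemma cubic_G: "cubic G"
proof -
  have "halves A \<noteq> {}" using odd_graph by (simp add: is_odd_graph_def connected_graph_def)
  then have "halves G \<noteq> {}" by (auto simp: G_def)
  then show ?thesis
    using is_graph_G connected_G valence_G verts_G by (simp add: cubic_def connected_graph_def)
qed

lemma finite_verts: "finite (verts A)"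
  using A(1) by (simp add: verts_def)

lemma concat_dss: "concat dss = map (\<lambda>h. 3 * h + 1) (concat (map oa (sorted_list_of_set (verts A))))"
  by (simp add: dss_def map_concat comp_def)

lemma set_concat_oa: "set (concat (map oa (sorted_list_of_set (verts A)))) = halves A"
  using oa(2) finite_verts by (auto simp: star_def verts_def)

lemma distinct_concat_oa: "distinct (concat (map oa (sorted_list_of_set (verts A))))"
proof -
  have "distinct (concat (map oa vs))" if "distinct vs" "set vs \<subseteq> verts A" for vs
    using that
  proof (induction vs)
    case (Cons v vs)
    have "set (oa v) \<inter> set (concat (map oa vs)) = {}"
      using Cons.prems oa(2) by (auto simp: star_def)
    then show ?case using Cons oa(1) by simp
  qed simp
  then show ?thesis using finite_verts by simp
qed

lemma cyc_sys_G: "cyc_sys G dss"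
proof -
  have "closed_path G ds \<and> odd (length ds)" if ds: "ds \<in> set dss" for ds
  proof -
    obtain v where v: "v \<in> verts A" "ds = map (\<lambda>h. 3 * h + 1) (oa v)"
      using ds finite_verts by (auto simp: dss_def)
    have "vert G (opp G (ds ! j)) = vert G (ds ! (Suc j mod length ds))" if j: "j < length ds" for j
    proof -
      have j': "j < length (oa v)" "Suc j mod length (oa v) < length (oa v)"
        using j by (auto simp: v(2) intro: mod_less_divisor)
      have "ds ! j = 3 * (oa v ! j) + 1"
        "ds ! (Suc j mod length ds) = 3 * (oa v ! (Suc j mod length (oa v))) + 1"
        using j' by (simp_all add: v(2))
      then show ?thesis by (simp only: G_simps sc_nth[OF v(1) j'(1)])
    qed
    moreover have "ds \<noteq> []" using odd_oa[OF v(1)] by (auto simp: v(2))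
    moreover have "set ds \<subseteq> halves G"
      using G_halves(2) oa(2)[OF v(1)] by (auto simp: v(2) star_def simp del: One_nat_def)
    ultimately show ?thesis using odd_oa[OF v(1)] by (simp add: closed_path_iff v(2))
  qed
  moreover have "map (vert G) (concat dss) = concat (map oa (sorted_list_of_set (verts A)))"
    unfolding concat_dss map_map comp_def G_simps(5) by simp
  moreover from this have "vert G ` set (concat dss) = verts G"
    unfolding set_map[symmetric] by (simp only: set_concat_oa verts_G)
  ultimately show ?thesis using distinct_concat_oa unfolding cyc_sys_def by simp
qed

sublocale B: cycle_system G dss
  using cubic_G cyc_sys_G by (simp add: cycle_system_def)

lemma D_eq: "B.D = (\<lambda>h. 3 * h + 1) ` halves A"
  unfolding B.D_def concat_dss set_map set_concat_oa ..

lemma halves_Diff_C: "halves G - B.C = (\<lambda>h. 3 * h) ` halves A"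
proof -
  have C: "B.C = (\<lambda>h. 3 * h + 1) ` halves A \<union> (\<lambda>h. 3 * h + 2) ` halves A"
  proof -
    have "opp G ` (\<lambda>h. 3 * h + 1) ` halves A = (\<lambda>h. 3 * h + 2) ` sc ` halves A"
      unfolding image_image G_simps(2) ..
    then show ?thesis unfolding B.C_eq D_eq sc_image by simp
  qed
  show ?thesis
  proof (intro equalityI subsetI)
    fix k assume k: "k \<in> halves G - B.C"
    then have "k \<in> halves G" by blast
    then show "k \<in> (\<lambda>h. 3 * h) ` halves A" using k by (cases rule: G_halvesE) (auto simp: C)
  next
    fix k assume "k \<in> (\<lambda>h. 3 * h) ` halves A"
    then obtain h where h: "h \<in> halves A" "k = 3 * h" by blast
    have "3 * h \<notin> B.C" unfolding C using mod3_simps(7,8) by blast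
    then show "k \<in> halves G - B.C" using h G_halves(1) by blast
  qed
qed

lemma idx_G:
  assumes "i < length (sorted_list_of_set (verts A))" "h \<in> set (oa (sorted_list_of_set (verts A) ! i))"
  shows "B.idx h = i"
proof -
  have "3 * h + 1 \<in> set (dss ! i)" "i < length dss" using assms by (auto simp: dss_def)
  from B.idx_eq[OF this(2,1)] show ?thesis by (simp only: G_simps)
qed

lemma idx_nth:
  assumes "h \<in> halves A"
  shows "B.idx h < length (sorted_list_of_set (verts A))" "sorted_list_of_set (verts A) ! B.idx h = vert A h"
proof -
  have v: "vert A h \<in> verts A" using assms by (simp add: verts_def)
  then have "vert A h \<in> set (sorted_list_of_set (verts A))" using finite_verts by simp
  then obtain i where i: "i < length (sorted_list_of_set (verts A))" "sorted_list_of_set (verts A) ! i = vert A h"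
    by (auto simp: in_set_conv_nth)
  have "h \<in> set (oa (vert A h))" using oa(2)[OF v] assms by (simp add: star_def)
  then have "B.idx h = i" using idx_G[OF i(1)] i(2) by simp
  then show "B.idx h < length (sorted_list_of_set (verts A))" "sorted_list_of_set (verts A) ! B.idx h = vert A h"
    using i by simp_all
qed

text \<open>The map taking \<open>h\<close> to \<open>3 * h\<close> identifies \<open>A\<close> with
  what the collapse leaves. The spoke at \<open>3 * k + 1\<close> is \<open>3 * k\<close>, so the
  orderings correspond entry by entry and every sign is 1.\<close>

lemma oclass_collapse: "oclass (collapse G dss) = oclass (A, oa)"
proof -
  let ?\<phi> = "\<lambda>h :: nat. 3 * h"
  have inj_idx: "vert A h = vert A k \<longleftrightarrow> B.idx h = B.idx k" if "h \<in> halves A" "k \<in> halves A" for h k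
    using idx_nth[OF that(1)] idx_nth[OF that(2)]
      nth_eq_iff_index_eq[OF distinct_sorted_list_of_set[of "verts A"]] by metis
  have iso: "graph_iso ?\<phi> A B.\<Gamma>"
    unfolding graph_iso_def B.collapse_simps G_simps(1,4)
    using inj_idx halves_Diff_C by (auto intro!: bij_betw_imageI inj_onI)
  have "srel (map ?\<phi> (oa (vert A h))) (snd (collapse G dss) (vert B.\<Gamma> (?\<phi> h))) 1" if h: "h \<in> halves A" for h
  proof -
    have v: "vert A h \<in> verts A" using h by (simp add: verts_def)
    have "dss ! B.idx h = map (\<lambda>h. 3 * h + 1) (oa (vert A h))"
      using idx_nth[OF h] by (simp add: dss_def)
    moreover have "spoke G dss (3 * k + 1) = 3 * k" if "k \<in> set (oa (vert A h))" for k
    proof (rule B.spoke_eq)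
      have k: "k \<in> halves A" using that oa(2)[OF v] by (simp add: star_def)
      then show "3 * k + 1 \<in> B.D" unfolding D_eq by blast
      have "3 * k \<in> halves G - B.C" unfolding halves_Diff_C using k by blast
      then show "3 * k \<in> halves G" "3 * k \<notin> B.C" by blast+
      show "vert G (3 * k) = vert G (3 * k + 1)" by (simp only: G_simps)
    qed
    ultimately have "map (spoke G dss) (dss ! B.idx h) = map ?\<phi> (oa (vert A h))" by simp
    then show ?thesis unfolding B.collapse_simps G_simps(4) by (simp add: srel_refl)
  qed
  from oclass_iso[of A oa "B.\<Gamma>" "snd (collapse G dss)" ?\<phi> "\<lambda>_. 1", OF odd_graph _ iso this]
  have "oclass (collapse G dss) = cscale (of_int (\<Prod>v\<in>verts A. 1)) (oclass (A, oa))"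
    using B.is_odd_graph_collapse by (simp only: prod.collapse)
  then show ?thesis by simp
qed

lemma is_forested_graph_G: "is_forested_graph (G, path_edges G dss)"
  using cubic_G B.distinct_path_edges B.path_edges_edges B.acyclic_path_edges
  by (simp add: is_forested_graph_def cubic_def)

text \<open>The forest is listed along the paths, whence the sign 1. A closing edge occupies the
  last position of its cycle, a path edge an earlier one, so the two kinds are disjoint.\<close>

lemma forest_data_G: "forest_data G (path_edges G dss) dss 1"
proof -
  have "edge G (last ds) \<notin> set (path_edges G dss)" if ds: "ds \<in> set dss" for ds
  proof
    assume "edge G (last ds) \<in> set (path_edges G dss)"
    then obtain ds' j where d: "ds' \<in> set dss" "Suc j < length ds'" "edge G (last ds) = edge G (ds' ! j)"
      by (rule B.path_edgesE)
    let ?n = "length ds - 1"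
    have n: "?n < length ds" "last ds = ds ! ?n" using B.nonempty[OF ds] by (simp_all add: last_conv_nth)
    have j: "j < length ds'" using d(2) by simp
    have "ds ! ?n = ds' ! j"
      using d(3) n(2) by (intro B.edge_inj_D[OF B.D_nth[OF ds n(1)] B.D_nth[OF d(1) j]]) simp
    then have "ds = ds'" "?n = j" using B.pos_unique[OF ds d(1) n(1) j] by simp_all
    then show False using d(2) by simp
  qed
  then show ?thesis using cyc_sys_G by (simp add: forest_data_def srel_refl)
qed

lemma tval_G: "tval G (path_edges G dss) = cscale ((-2) ^ length dss) (oclass (A, oa))"
proof -
  have "has_value G (path_edges G dss) (cycle_halves G dss) (trace_value G dss 1)"
    using forest_data_G unfolding has_value_def by blast
  from tval_eq[OF cubic_G this] show ?thesis by (simp add: trace_value_def oclass_collapse)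
qed

end

theorem proposition6p1:
  fixes \<Theta> :: odd_graph
  assumes "cclass \<Theta> \<noteq> 0"
  shows "cocycle (\<mu> \<Theta>) \<and> \<mu> \<Theta> \<noteq> (\<lambda>_. 0)"
proof
  show "cocycle (\<mu> \<Theta>)" using assms by (rule cocycle_mu)
  interpret odd_oriented "ograph \<Theta>" "ordering \<Theta>"
    using is_odd_graph_Rep by (simp add: odd_oriented_def)
  have P: "is_projection \<Theta> (projection \<Theta>)" using assms by (rule is_projection_projection)
  then interpret P: Vector_Spaces.linear cscale "(*)" "projection \<Theta>" by (simp add: is_projection_def)
  \<comment> \<open>The generator that detects the cocycle is the blow-up of \<open>\<Theta>\<close>
    with the paths as forest; the projection then leaves a power of -2, which is not 0.\<close>
  have "graphical_trace (fclass (Abs_forested_graph (G, path_edges G dss))) = cscale ((-2) ^ length dss) (cclass \<Theta>)"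
    by (simp add: graphical_trace(2) Rep_Abs_forested[OF is_forested_graph_G] tval_G oclass_Rep)
  then have "\<mu> \<Theta> (fclass (Abs_forested_graph (G, path_edges G dss))) = (-2) ^ length dss"
    using P by (simp add: \<mu>_def P.scale is_projection_def)
  then show "\<mu> \<Theta> \<noteq> (\<lambda>_. 0)" by (metis power_eq_0_iff zero_neq_neg_numeral)
qed

end
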